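(* Let $k$ be a perfect field of characteristic $p>0$, $W=W(k)$, $\zeta$ a primitive $p$th root of unity, $K=\mathrm{Frac}(W)(\zeta)$, $\mathcal O_K=W[\zeta]$ and $S=K[[q-\zeta]]$. Let $E$ be a de Rham prismatic crystal on $\mathcal O_K$ and $M$ the corresponding $S$-module, with its higher log-derivatives $\partial_{\log}^{\langle k\rangle}$ and higher $\mathbb{\Delta}$-derivatives $\partial_{\mathbb{\Delta}}^{\langle k\rangle}$. Then for all $s\in M$ and $k\in\mathbb N$, $$\partial_{\log}^{\langle k\rangle}(s)=\sum_{n=k}^\infty\frac{k!}{(n)_{q^p}!}\,s_{q^p}(n,k)(q-1)^{n-k}q^{n-k}\,\partial^{\langle n\rangle}_{\mathbb{\Delta}}(s)$$ and $$\partial^{\langle k\rangle}_{\mathbb{\Delta}}(s)=\sum_{n=k}^\infty\frac{(k)_{q^p}!}{n!}\,S_{q^p}(n,k)(q-1)^{n-k}q^{n-k}\,\partial_{\log}^{\langle n\rangle}(s),$$ where $s_{q^p}(n,k)$ (resp. $S_{q^p}(n,k)$) denotes the $q^p$-Stirling number of the first (resp. second) kind.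
   Context: Twisted numbers: $(n)_q=1+q+\cdots+q^{n-1}$, $(n)_q!=(n)_q\cdots(1)_q$. Twisted Stirling numbers of the first and second kind are defined by $s_q(n+1,k)=s_q(n,k-1)-(n)_qs_q(n,k)$, $S_q(n+1,k)=S_q(n,k-1)+(k)_qS_q(n,k)$, with $s_q(0,0)=S_q(0,0)=1$ and $s_q(n,0)=s_q(0,k)=S_q(n,0)=S_q(0,k)=0$ for $n,k>0$; the $q^p$-versions are obtained replacing $q$ by $q^p$. Crystals: a bounded prism $(B,J)$ is a $\delta$-ring $B$ with an invertible ideal $J$ such that $B/J$ has bounded $p^\infty$-torsion, $B$ is $((p)+J)$-adically complete and $p\in J+\phi(J)B$. The prismatic site of $\mathcal O_K$ is the opposite of the category of bounded prisms with a morphism $\mathcal O_K\to B/J$ (coverings: faithfully flat modulo any ideal of definition). $\mathbb B^+_{\mathrm{dR}}(B,J)$ is the $J$-adic completion of $B[1/p]$. A de Rham prismatic crystal is a locally finite free $\mathbb B^+_{\mathrm{dR}}$-module. Rings: let $R=W[[q-1]]$ with $\delta(q)=0$, so that $(R,(p)_q)$ is an object of the site and $\mathbb B^+_{\mathrm{dR}}(R,(p)_q)=S$. Its self-product in the site is $(A,(p)_q)$, where $A=\widehat{R\langle\omega\rangle}_{\mathbb{\Delta}}$ is the $(p,q-1)$-adic completion of the $R$-algebra $R\langle\omega\rangle_{\mathbb{\Delta}}$, free as a module on elements $\omega^{\{n\}_{\mathbb{\Delta}}}$ ($n\in\mathbb N$), with $\omega=\omega^{\{1\}_{\mathbb{\Delta}}}$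 and characterized by $(n)_{q^p}!\,\omega^{\{n\}_{\mathbb{\Delta}}}=\prod_{k=0}^{n-1}(\omega-(k)_{q^p}(q^2-q))$; the two projections correspond to the inclusion $\iota:R\to A$ and the map $\theta:R\to A$, $q\mapsto q+(p)_q\omega$. $S$ has the linear topology with basis of neighborhoods of $0$ given by $p^n\mathcal O_K[[q-\zeta]]+(q-\zeta)^mS$. Let $S\langle\omega\rangle$ be the usual divided power polynomial ring with basis $\omega^{[n]}=\omega^n/n!$ and $S\langle\omega\rangle_{\mathbb{\Delta}}=S\otimes_RR\langle\omega\rangle_{\mathbb{\Delta}}$, with direct sum topologies for these bases. Both are equal to $S[\omega]$ as rings, their completions coincide, $\widehat{S\langle\omega\rangle}=\widehat{S\langle\omega\rangle}_{\mathbb{\Delta}}$, and $\mathbb B^+_{\mathrm{dR}}(A,(p)_q)=\widehat{S\langle\omega\rangle}$. Derivatives: $M:=E(R,(p)_q)$ is a finite free $S$-module. The crystal structure gives an isomorphism $\epsilon$ from the base change of $M$ along $\theta$ to the base change of $M$ along $\iota$ (both identified with $E(A,(p)_q)$). Put $\theta_M(s)=\epsilon(1\otimes s)\in M\widehat\otimes_S\widehat{S\langle\omega\rangle}$. The continuous maps $\partial_{\log}^{\langle k\rangle},\partial_{\mathbb{\Delta}}^{\langle k\rangle}:M\to M$ are defined by $$\theta_M(s)=\sum_{k\ge0}\partial_{\log}^{\langle k\rangle}(s)\otimes\omega^{[k]}=\sum_{k\ge0}\partial_{\mathbb{\Delta}}^{\langle k\rangle}(s)\otimes\omega^{\{k\}_{\mathbb{\Delta}}}.$$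 *)

theory Defs
  imports
    "HOL-Computational_Algebra.Computational_Algebra"
    "HOL-Algebra.Algebra"
    "HOL-Algebra.Algebraic_Closure_Type"
begin

section \<open>Twisted numbers and twisted Stirling numbers\<close>

definition qnum :: "'a::comm_ring_1 \<Rightarrow> nat \<Rightarrow> 'a" where
  "qnum q n = (\<Sum>i<n. q ^ i)"

definition qfact :: "'a::comm_ring_1 \<Rightarrow> nat \<Rightarrow> 'a" where
  "qfact q n = (\<Prod>i=1..n. qnum q i)"

fun qstirling1 :: "'a::comm_ring_1 \<Rightarrow> nat \<Rightarrow> nat \<Rightarrow> 'a" where
  "qstirling1 q 0 0 = 1"
| "qstirling1 q 0 (Suc k) = 0"
| "qstirling1 q (Suc n) 0 = 0"
| "qstirling1 q (Suc n) (Suc k) = qstirling1 q n k - qnum q n * qstirling1 q n (Suc k)"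

fun qstirling2 :: "'a::comm_ring_1 \<Rightarrow> nat \<Rightarrow> nat \<Rightarrow> 'a" where
  "qstirling2 q 0 0 = 1"
| "qstirling2 q 0 (Suc k) = 0"
| "qstirling2 q (Suc n) 0 = 0"
| "qstirling2 q (Suc n) (Suc k) = qstirling2 q n k + qnum q (Suc k) * qstirling2 q n (Suc k)"


section \<open>Completion and localization\<close>

primrec ideal_pow :: "('a, 'x) ring_scheme \<Rightarrow> 'a set \<Rightarrow> nat \<Rightarrow> 'a set" where
  "ideal_pow B I 0 = carrier B"
| "ideal_pow B I (Suc n) = ideal_prod B I (ideal_pow B I n)"

text \<open>The inverse limit of the quotients by the powers of the ideal: the transition maps send a
  coset to the (unique) larger coset that contains it.\<close>

definition adic_completion :: "('a, 'x) ring_scheme \<Rightarrow> 'a set \<Rightarrow> (nat \<Rightarrow> 'a set) ring" where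
  "adic_completion B I =
    \<lparr>carrier = {x. \<forall>n. x n \<in> carrier (B Quot ideal_pow B I n) \<and> x (Suc n) \<subseteq> x n},
     monoid.mult = (\<lambda>x y n. x n \<otimes>\<^bsub>B Quot ideal_pow B I n\<^esub> y n),
     monoid.one = (\<lambda>n. \<one>\<^bsub>B Quot ideal_pow B I n\<^esub>),
     ring.zero = (\<lambda>n. \<zero>\<^bsub>B Quot ideal_pow B I n\<^esub>),
     ring.add = (\<lambda>x y n. x n \<oplus>\<^bsub>B Quot ideal_pow B I n\<^esub> y n)\<rparr>"

definition to_completion :: "('a, 'x) ring_scheme \<Rightarrow> 'a set \<Rightarrow> 'a \<Rightarrow> nat \<Rightarrow> 'a set" where
  "to_completion B I b = (\<lambda>n. ideal_pow B I n +>\<^bsub>B\<^esub> b)"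

definition adically_complete :: "('a, 'x) ring_scheme \<Rightarrow> 'a set \<Rightarrow> bool" where
  "adically_complete B I \<longleftrightarrow>
    bij_betw (to_completion B I) (carrier B) (carrier (adic_completion B I))"

text \<open>The map of quotients induced by a ring homomorphism \<open>f\<close> into \<open>B'\<close>.\<close>

definition quot_map :: "('b, 'y) ring_scheme \<Rightarrow> 'b set \<Rightarrow> ('a \<Rightarrow> 'b) \<Rightarrow> 'a set \<Rightarrow> 'b set" where
  "quot_map B' I' f C = (\<Union>b\<in>C. I' +>\<^bsub>B'\<^esub> f b)"

text \<open>The localization at the powers of one element; the pair \<open>(b, k)\<close> stands for the fraction
  \<open>b / s ^ k\<close>.\<close>

definition frac :: "('a, 'x) ring_scheme \<Rightarrow> 'a \<Rightarrow> 'a \<Rightarrow> nat \<Rightarrow> ('a \<times> nat) set" where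
  "frac B s b k = {(c, l). c \<in> carrier B \<and>
     (\<exists>m::nat. s [^]\<^bsub>B\<^esub> m \<otimes>\<^bsub>B\<^esub> (s [^]\<^bsub>B\<^esub> l \<otimes>\<^bsub>B\<^esub> b \<ominus>\<^bsub>B\<^esub> s [^]\<^bsub>B\<^esub> k \<otimes>\<^bsub>B\<^esub> c) = \<zero>\<^bsub>B\<^esub>)}"

definition localization :: "('a, 'x) ring_scheme \<Rightarrow> 'a \<Rightarrow> ('a \<times> nat) set ring" where
  "localization B s =
    \<lparr>carrier = {frac B s b k |b k. b \<in> carrier B},
     monoid.mult = (\<lambda>C D. \<Union>(b, k)\<in>C. \<Union>(c, l)\<in>D. frac B s (b \<otimes>\<^bsub>B\<^esub> c) (k + l)),
     monoid.one = frac B s \<one>\<^bsub>B\<^esub> 0,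
     ring.zero = frac B s \<zero>\<^bsub>B\<^esub> 0,
     ring.add = (\<lambda>C D. \<Union>(b, k)\<in>C. \<Union>(c, l)\<in>D.
              frac B s (s [^]\<^bsub>B\<^esub> l \<otimes>\<^bsub>B\<^esub> b \<oplus>\<^bsub>B\<^esub> s [^]\<^bsub>B\<^esub> k \<otimes>\<^bsub>B\<^esub> c) (k + l))\<rparr>"


section \<open>Base change of modules\<close>

definition module_hom ::
    "('c, 'x) ring_scheme \<Rightarrow> ('c, 'm, 'y) module_scheme \<Rightarrow> ('c, 'n, 'z) module_scheme \<Rightarrow>
     ('m \<Rightarrow> 'n) \<Rightarrow> bool" where
  "module_hom C N N' u \<longleftrightarrow> u \<in> carrier N \<rightarrow> carrier N' \<and>
     (\<forall>x\<in>carrier N. \<forall>y\<in>carrier N. u (x \<oplus>\<^bsub>N\<^esub> y) = u x \<oplus>\<^bsub>N'\<^esub> u y) \<and>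
     (\<forall>c\<in>carrier C. \<forall>x\<in>carrier N. u (c \<odot>\<^bsub>N\<^esub> x) = c \<odot>\<^bsub>N'\<^esub> u x)"

text \<open>Given \<open>h : C \<rightarrow> D\<close> and a \<open>C\<close>-module \<open>N\<close>, the module \<open>D \<otimes>\<^sub>C N\<close> is
  the free \<open>D\<close>-module on the underlying set of \<open>N\<close>, modulo the usual relations. The relations
  already contain an arbitrary factor \<open>t\<close> in \<open>D\<close>, so that closing them under addition and
  opposite gives a submodule.\<close>

definition free_module_carrier ::
    "('d, 'y) ring_scheme \<Rightarrow> ('c, 'm, 'z) module_scheme \<Rightarrow> ('m \<Rightarrow> 'd) set" where
  "free_module_carrier D N = {z. (\<forall>x. z x \<in> carrier D) \<and> (\<forall>x. x \<notin> carrier N \<longrightarrow> z x = \<zero>\<^bsub>D\<^esub>) \<and>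
     finite {x. z x \<noteq> \<zero>\<^bsub>D\<^esub>}}"

definition single :: "('d, 'y) ring_scheme \<Rightarrow> 'd \<Rightarrow> 'm \<Rightarrow> 'm \<Rightarrow> 'd" where
  "single D t x = (\<lambda>y. if y = x then t else \<zero>\<^bsub>D\<^esub>)"

inductive_set tensor_relations ::
    "('c, 'x) ring_scheme \<Rightarrow> ('d, 'y) ring_scheme \<Rightarrow> ('c \<Rightarrow> 'd) \<Rightarrow> ('c, 'm, 'z) module_scheme \<Rightarrow>
     ('m \<Rightarrow> 'd) set"
  for C D h N where
    zero: "(\<lambda>_. \<zero>\<^bsub>D\<^esub>) \<in> tensor_relations C D h N"
  | additive: "\<lbrakk>t \<in> carrier D; x \<in> carrier N; y \<in> carrier N\<rbrakk> \<Longrightarrow>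
      (\<lambda>v. single D t (x \<oplus>\<^bsub>N\<^esub> y) v \<ominus>\<^bsub>D\<^esub> (single D t x v \<oplus>\<^bsub>D\<^esub> single D t y v))
        \<in> tensor_relations C D h N"
  | balanced: "\<lbrakk>t \<in> carrier D; c \<in> carrier C; x \<in> carrier N\<rbrakk> \<Longrightarrow>
      (\<lambda>v. single D t (c \<odot>\<^bsub>N\<^esub> x) v \<ominus>\<^bsub>D\<^esub> single D (t \<otimes>\<^bsub>D\<^esub> h c) x v) \<in> tensor_relations C D h N"
  | add: "\<lbrakk>z \<in> tensor_relations C D h N; z' \<in> tensor_relations C D h N\<rbrakk> \<Longrightarrow>
      (\<lambda>v. z v \<oplus>\<^bsub>D\<^esub> z' v) \<in> tensor_relations C D h N"
  | neg: "z \<in> tensor_relations C D h N \<Longrightarrow> (\<lambda>v. \<ominus>\<^bsub>D\<^esub> z v) \<in> tensor_relations C D h N"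

definition tensor_class ::
    "('c, 'x) ring_scheme \<Rightarrow> ('d, 'y) ring_scheme \<Rightarrow> ('c \<Rightarrow> 'd) \<Rightarrow> ('c, 'm, 'z) module_scheme \<Rightarrow>
     ('m \<Rightarrow> 'd) \<Rightarrow> ('m \<Rightarrow> 'd) set" where
  "tensor_class C D h N z = {(\<lambda>v. z v \<oplus>\<^bsub>D\<^esub> r v) |r. r \<in> tensor_relations C D h N}"

text \<open>The record type of modules extends that of rings; the fields \<open>mult\<close> and \<open>one\<close> play no role.\<close>

definition base_change ::
    "('c, 'x) ring_scheme \<Rightarrow> ('d, 'y) ring_scheme \<Rightarrow> ('c \<Rightarrow> 'd) \<Rightarrow> ('c, 'm, 'z) module_scheme \<Rightarrow>
     ('d, ('m \<Rightarrow> 'd) set) module" where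
  "base_change C D h N =
    \<lparr>carrier = tensor_class C D h N ` free_module_carrier D N,
     monoid.mult = undefined, monoid.one = undefined,
     ring.zero = tensor_class C D h N (\<lambda>_. \<zero>\<^bsub>D\<^esub>),
     ring.add = (\<lambda>V Y. \<Union>z\<in>V. \<Union>z'\<in>Y. tensor_class C D h N (\<lambda>v. z v \<oplus>\<^bsub>D\<^esub> z' v)),
     Module.module.smult = (\<lambda>t V. \<Union>z\<in>V. tensor_class C D h N (\<lambda>v. t \<otimes>\<^bsub>D\<^esub> z v))\<rparr>"

definition tensor ::
    "('c, 'x) ring_scheme \<Rightarrow> ('d, 'y) ring_scheme \<Rightarrow> ('c \<Rightarrow> 'd) \<Rightarrow> ('c, 'm, 'z) module_scheme \<Rightarrow>
     'd \<Rightarrow> 'm \<Rightarrow> ('m \<Rightarrow> 'd) set" where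
  "tensor C D h N t x = tensor_class C D h N (single D t x)"

text \<open>The \<open>D\<close>-linear map \<open>D \<otimes>\<^sub>C N \<rightarrow> N'\<close>, \<open>t \<otimes> x \<mapsto> t \<odot> g x\<close> attached to a semilinear map \<open>g\<close>;
  the value does not depend on the chosen representative.\<close>

definition linearization ::
    "('d, 'y) ring_scheme \<Rightarrow> ('d, 'n, 'w) module_scheme \<Rightarrow> ('m \<Rightarrow> 'n) \<Rightarrow>
     ('m \<Rightarrow> 'd) set \<Rightarrow> 'n" where
  "linearization D N' g V =
    (let z = SOME z. z \<in> V in \<Oplus>\<^bsub>N'\<^esub>x\<in>{x. z x \<noteq> \<zero>\<^bsub>D\<^esub>}. z x \<odot>\<^bsub>N'\<^esub> g x)"

definition restrict_scalars ::
    "('c \<Rightarrow> 'd) \<Rightarrow> ('d, 'm) module \<Rightarrow> ('c, 'm) module" where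
  "restrict_scalars h N =
    \<lparr>carrier = carrier N, monoid.mult = monoid.mult N, monoid.one = monoid.one N, ring.zero = ring.zero N,
     ring.add = ring.add N, Module.module.smult = (\<lambda>c. Module.module.smult N (h c))\<rparr>"

definition is_basis ::
    "('c, 'x) ring_scheme \<Rightarrow> ('c, 'm, 'z) module_scheme \<Rightarrow> nat \<Rightarrow> (nat \<Rightarrow> 'm) \<Rightarrow> bool" where
  "is_basis C N r e \<longleftrightarrow> (\<forall>i<r. e i \<in> carrier N) \<and>
     (\<forall>x\<in>carrier N. \<exists>!c. c \<in> {..<r} \<rightarrow>\<^sub>E carrier C \<and> x = (\<Oplus>\<^bsub>N\<^esub>i\<in>{..<r}. c i \<odot>\<^bsub>N\<^esub> e i))"

definition finite_free :: "('c, 'x) ring_scheme \<Rightarrow> ('c, 'm, 'z) module_scheme \<Rightarrow> bool" where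
  "finite_free C N \<longleftrightarrow> Module.module C N \<and> (\<exists>r e. is_basis C N r e)"

text \<open>Flatness is tested on modules whose carrier lies in the type of \<open>C\<close>. This is no restriction:
  the inclusions of ideals into \<open>C\<close>, and the quotients of \<open>C\<close>, all have copies there.
  An element of \<open>D \<otimes>\<^sub>C N\<close> is zero iff it is represented by an element of \<open>tensor_relations\<close>.\<close>

definition flat :: "('c, 'x) ring_scheme \<Rightarrow> ('d, 'y) ring_scheme \<Rightarrow> ('c \<Rightarrow> 'd) \<Rightarrow> bool" where
  "flat C D h \<longleftrightarrow>
    (\<forall>(N :: ('c, 'c) module) (N' :: ('c, 'c) module) u.
       Module.module C N \<and> Module.module C N' \<and> module_hom C N N' u \<and> inj_on u (carrier N) \<longrightarrow>
       (\<forall>z\<in>free_module_carrier D N.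
          (\<lambda>y. \<Oplus>\<^bsub>D\<^esub>x\<in>{x. z x \<noteq> \<zero>\<^bsub>D\<^esub> \<and> u x = y}. z x) \<in> tensor_relations C D h N' \<longrightarrow>
          z \<in> tensor_relations C D h N))"

definition faithfully_flat ::
    "('c, 'x) ring_scheme \<Rightarrow> ('d, 'y) ring_scheme \<Rightarrow> ('c \<Rightarrow> 'd) \<Rightarrow> bool" where
  "faithfully_flat C D h \<longleftrightarrow> flat C D h \<and>
    (\<forall>N :: ('c, 'c) module. Module.module C N \<and>
       free_module_carrier D N \<subseteq> tensor_relations C D h N \<longrightarrow> carrier N = {\<zero>\<^bsub>N\<^esub>})"


section \<open>The prismatic site\<close>

definition delta_ring :: "nat \<Rightarrow> 'u ring \<Rightarrow> ('u \<Rightarrow> 'u) \<Rightarrow> bool" where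
  "delta_ring p B \<delta> \<longleftrightarrow> cring B \<and> \<delta> \<in> carrier B \<rightarrow> carrier B \<and>
     \<delta> \<zero>\<^bsub>B\<^esub> = \<zero>\<^bsub>B\<^esub> \<and> \<delta> \<one>\<^bsub>B\<^esub> = \<zero>\<^bsub>B\<^esub> \<and>
     (\<forall>x\<in>carrier B. \<forall>y\<in>carrier B.
        \<delta> (x \<oplus>\<^bsub>B\<^esub> y) = \<delta> x \<oplus>\<^bsub>B\<^esub> \<delta> y \<ominus>\<^bsub>B\<^esub>
          (\<Oplus>\<^bsub>B\<^esub>i\<in>{1..<p}. [((p choose i) div p)] \<cdot>\<^bsub>B\<^esub> (x [^]\<^bsub>B\<^esub> i \<otimes>\<^bsub>B\<^esub> y [^]\<^bsub>B\<^esub> (p - i))) \<and>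
        \<delta> (x \<otimes>\<^bsub>B\<^esub> y) = x [^]\<^bsub>B\<^esub> p \<otimes>\<^bsub>B\<^esub> \<delta> y \<oplus>\<^bsub>B\<^esub> y [^]\<^bsub>B\<^esub> p \<otimes>\<^bsub>B\<^esub> \<delta> x \<oplus>\<^bsub>B\<^esub> [p] \<cdot>\<^bsub>B\<^esub> (\<delta> x \<otimes>\<^bsub>B\<^esub> \<delta> y))"

definition frobenius :: "nat \<Rightarrow> 'u ring \<Rightarrow> ('u \<Rightarrow> 'u) \<Rightarrow> 'u \<Rightarrow> 'u" where
  "frobenius p B \<delta> x = x [^]\<^bsub>B\<^esub> p \<oplus>\<^bsub>B\<^esub> [p] \<cdot>\<^bsub>B\<^esub> \<delta> x"

text \<open>An ideal that is, Zariski-locally, generated by a nonzerodivisor.\<close>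

definition invertible_ideal :: "'u ring \<Rightarrow> 'u set \<Rightarrow> bool" where
  "invertible_ideal B J \<longleftrightarrow> ideal J B \<and>
     (\<exists>F. finite F \<and> F \<subseteq> carrier B \<and> Idl\<^bsub>B\<^esub> F = carrier B \<and>
        (\<forall>s\<in>F. \<exists>d\<in>carrier (localization B s).
           (\<forall>x\<in>carrier (localization B s).
              d \<otimes>\<^bsub>localization B s\<^esub> x = \<zero>\<^bsub>localization B s\<^esub> \<longrightarrow> x = \<zero>\<^bsub>localization B s\<^esub>) \<and>
           Idl\<^bsub>localization B s\<^esub> ((\<lambda>b. frac B s b 0) ` J) = PIdl\<^bsub>localization B s\<^esub> d))"

abbreviation p_of :: "nat \<Rightarrow> 'u ring \<Rightarrow> 'u" where
  "p_of p B \<equiv> [p] \<cdot>\<^bsub>B\<^esub> \<one>\<^bsub>B\<^esub>"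

definition p_plus :: "nat \<Rightarrow> 'u ring \<Rightarrow> 'u set \<Rightarrow> 'u set" where
  "p_plus p B J = PIdl\<^bsub>B\<^esub> (p_of p B) <+>\<^bsub>B\<^esub> J"

definition bounded_prism :: "nat \<Rightarrow> 'u ring \<Rightarrow> ('u \<Rightarrow> 'u) \<Rightarrow> 'u set \<Rightarrow> bool" where
  "bounded_prism p B \<delta> J \<longleftrightarrow> delta_ring p B \<delta> \<and> invertible_ideal B J \<and>
     (\<exists>N::nat. \<forall>x\<in>carrier (B Quot J).
        (\<exists>m::nat. [(p ^ m)] \<cdot>\<^bsub>B Quot J\<^esub> x = \<zero>\<^bsub>B Quot J\<^esub>) \<longrightarrow> [(p ^ N)] \<cdot>\<^bsub>B Quot J\<^esub> x = \<zero>\<^bsub>B Quot J\<^esub>) \<and>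
     adically_complete B (p_plus p B J) \<and>
     p_of p B \<in> J <+>\<^bsub>B\<^esub> Idl\<^bsub>B\<^esub> (frobenius p B \<delta> ` J)"

text \<open>An object of the site: a prism together with its structural map \<open>O\<^sub>K \<rightarrow> B/J\<close>, where
  \<open>O\<^sub>K\<close> is a subring of a field \<open>'f\<close>. The type \<open>'u\<close> plays the role of a universe.\<close>

record ('u, 'f) prism =
  pring :: "'u ring"
  pdelta :: "'u \<Rightarrow> 'u"
  pideal :: "'u set"
  pstr :: "'f \<Rightarrow> 'u set"

definition subset_ring :: "'f::comm_ring_1 set \<Rightarrow> 'f ring" where
  "subset_ring A = ring_of_type_algebra\<lparr>carrier := A\<rparr>"

definition site_object :: "nat \<Rightarrow> 'f::comm_ring_1 set \<Rightarrow> ('u, 'f) prism \<Rightarrow> bool" where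
  "site_object p OK V \<longleftrightarrow> bounded_prism p (pring V) (pdelta V) (pideal V) \<and>
     pstr V \<in> ring_hom (subset_ring OK) (pring V Quot pideal V)"

definition site_morphism ::
    "nat \<Rightarrow> 'f::comm_ring_1 set \<Rightarrow> ('u, 'f) prism \<Rightarrow> ('u, 'f) prism \<Rightarrow> ('u \<Rightarrow> 'u) \<Rightarrow> bool" where
  "site_morphism p OK V Y f \<longleftrightarrow> site_object p OK V \<and> site_object p OK Y \<and>
     f \<in> ring_hom (pring V) (pring Y) \<and>
     (\<forall>x\<in>carrier (pring V). f (pdelta V x) = pdelta Y (f x)) \<and>
     f ` pideal V \<subseteq> pideal Y \<and>
     (\<forall>a\<in>OK. quot_map (pring Y) (pideal Y) f (pstr V a) = pstr Y a)"

definition ideal_of_definition :: "nat \<Rightarrow> ('u, 'f) prism \<Rightarrow> 'u set \<Rightarrow> bool" where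
  "ideal_of_definition p V I \<longleftrightarrow> ideal I (pring V) \<and>
     (\<exists>n. ideal_pow (pring V) I n \<subseteq> p_plus p (pring V) (pideal V)) \<and>
     (\<exists>n. ideal_pow (pring V) (p_plus p (pring V) (pideal V)) n \<subseteq> I)"

definition site_cover ::
    "nat \<Rightarrow> 'f::comm_ring_1 set \<Rightarrow> ('u, 'f) prism \<Rightarrow> ('u, 'f) prism \<Rightarrow> ('u \<Rightarrow> 'u) \<Rightarrow> bool" where
  "site_cover p OK V Y f \<longleftrightarrow> site_morphism p OK V Y f \<and>
     (\<forall>I. ideal_of_definition p V I \<longrightarrow>
        (let I' = Idl\<^bsub>pring Y\<^esub> (f ` I)
         in faithfully_flat (pring V Quot I) (pring Y Quot I') (quot_map (pring Y) I' f)))"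


section \<open>De Rham prismatic crystals\<close>

type_synonym 'u bdr = "nat \<Rightarrow> ('u \<times> nat) set set"

definition p_inverted :: "nat \<Rightarrow> ('u, 'f) prism \<Rightarrow> ('u \<times> nat) set ring" where
  "p_inverted p V = localization (pring V) (p_of p (pring V))"

definition to_p_inverted :: "nat \<Rightarrow> ('u, 'f) prism \<Rightarrow> 'u \<Rightarrow> ('u \<times> nat) set" where
  "to_p_inverted p V b = frac (pring V) (p_of p (pring V)) b 0"

definition bdr_ideal :: "nat \<Rightarrow> ('u, 'f) prism \<Rightarrow> ('u \<times> nat) set set" where
  "bdr_ideal p V = Idl\<^bsub>p_inverted p V\<^esub> (to_p_inverted p V ` pideal V)"

definition BdR :: "nat \<Rightarrow> ('u, 'f) prism \<Rightarrow> 'u bdr ring" where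
  "BdR p V = adic_completion (p_inverted p V) (bdr_ideal p V)"

definition to_BdR :: "nat \<Rightarrow> ('u, 'f) prism \<Rightarrow> 'u \<Rightarrow> 'u bdr" where
  "to_BdR p V b = to_completion (p_inverted p V) (bdr_ideal p V) (to_p_inverted p V b)"

definition BdR_map :: "nat \<Rightarrow> ('u, 'f) prism \<Rightarrow> ('u \<Rightarrow> 'u) \<Rightarrow> 'u bdr \<Rightarrow> 'u bdr" where
  "BdR_map p Y f x = (\<lambda>n. quot_map (p_inverted p Y) (ideal_pow (p_inverted p Y) (bdr_ideal p Y) n)
     (\<lambda>C. \<Union>(b, k)\<in>C. frac (pring Y) (p_of p (pring Y)) (f b) k) (x n))"

text \<open>\<open>Eobj E V\<close> is the module of sections on \<open>V\<close>, and \<open>Emap E V Y f\<close> is the map from the sections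
  on \<open>V\<close> to the sections on \<open>Y\<close> attached to the map of prisms \<open>f : V \<rightarrow> Y\<close>.\<close>

record ('u, 'f, 'm) site_presheaf =
  Eobj :: "('u, 'f) prism \<Rightarrow> ('u bdr, 'm) module"
  Emap :: "('u, 'f) prism \<Rightarrow> ('u, 'f) prism \<Rightarrow> ('u \<Rightarrow> 'u) \<Rightarrow> 'm \<Rightarrow> 'm"

definition BdR_presheaf_module ::
    "nat \<Rightarrow> 'f::comm_ring_1 set \<Rightarrow> ('u, 'f, 'm) site_presheaf \<Rightarrow> bool" where
  "BdR_presheaf_module p OK E \<longleftrightarrow>
    (\<forall>V. site_object p OK V \<longrightarrow> Module.module (BdR p V) (Eobj E V)) \<and>
    (\<forall>V Y f. site_morphism p OK V Y f \<longrightarrow>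
       Emap E V Y f \<in> carrier (Eobj E V) \<rightarrow> carrier (Eobj E Y) \<and>
       (\<forall>x\<in>carrier (Eobj E V). \<forall>y\<in>carrier (Eobj E V).
          Emap E V Y f (x \<oplus>\<^bsub>Eobj E V\<^esub> y) = Emap E V Y f x \<oplus>\<^bsub>Eobj E Y\<^esub> Emap E V Y f y) \<and>
       (\<forall>b\<in>carrier (BdR p V). \<forall>x\<in>carrier (Eobj E V).
          Emap E V Y f (b \<odot>\<^bsub>Eobj E V\<^esub> x) = BdR_map p Y f b \<odot>\<^bsub>Eobj E Y\<^esub> Emap E V Y f x)) \<and>
    (\<forall>V Y f g. site_morphism p OK V Y f \<and> site_morphism p OK V Y g \<and>
       (\<forall>b\<in>carrier (pring V). f b = g b) \<longrightarrow>
       (\<forall>x\<in>carrier (Eobj E V). Emap E V Y f x = Emap E V Y g x)) \<and>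
    (\<forall>V. site_object p OK V \<longrightarrow> (\<forall>x\<in>carrier (Eobj E V). Emap E V V (\<lambda>b. b) x = x)) \<and>
    (\<forall>V Y Z f g. site_morphism p OK V Y f \<and> site_morphism p OK Y Z g \<longrightarrow>
       (\<forall>x\<in>carrier (Eobj E V). Emap E V Z (g \<circ> f) x = Emap E Y Z g (Emap E V Y f x)))"

text \<open>The sheaf condition in terms of matching families: a section on the covering object is
  compatible iff its restrictions along any two maps that agree on \<open>V\<close> coincide.\<close>

definition is_sheaf :: "nat \<Rightarrow> 'f::comm_ring_1 set \<Rightarrow> ('u, 'f, 'm) site_presheaf \<Rightarrow> bool" where
  "is_sheaf p OK E \<longleftrightarrow>
    (\<forall>V Y f. site_cover p OK V Y f \<longrightarrow>
       (\<forall>y\<in>carrier (Eobj E Y).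
          (\<forall>Z g h. site_morphism p OK Y Z g \<and> site_morphism p OK Y Z h \<and>
             (\<forall>b\<in>carrier (pring V). g (f b) = h (f b)) \<longrightarrow> Emap E Y Z g y = Emap E Y Z h y) \<longrightarrow>
          (\<exists>!x. x \<in> carrier (Eobj E V) \<and> Emap E V Y f x = y)))"

definition locally_finite_free ::
    "nat \<Rightarrow> 'f::comm_ring_1 set \<Rightarrow> ('u, 'f, 'm) site_presheaf \<Rightarrow> bool" where
  "locally_finite_free p OK E \<longleftrightarrow>
    (\<forall>V. site_object p OK V \<longrightarrow>
       (\<exists>Y f r e. site_cover p OK V Y f \<and> (\<forall>i<r. e i \<in> carrier (Eobj E Y)) \<and>
          (\<forall>Z g. site_morphism p OK Y Z g \<longrightarrow>
             is_basis (BdR p Z) (Eobj E Z) r (\<lambda>i. Emap E Y Z g (e i)))))"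

definition de_rham_crystal ::
    "nat \<Rightarrow> 'f::comm_ring_1 set \<Rightarrow> ('u, 'f, 'm) site_presheaf \<Rightarrow> bool" where
  "de_rham_crystal p OK E \<longleftrightarrow>
     BdR_presheaf_module p OK E \<and> is_sheaf p OK E \<and> locally_finite_free p OK E"


section \<open>The rings attached to the cyclotomic extension\<close>

text \<open>The field \<open>K\<close> is the whole type \<open>'f\<close>, and \<open>W\<close> and \<open>O\<^sub>K\<close> are subrings of \<open>K\<close>.
  As in Serre's \<^emph>\<open>Local Fields\<close>, the ring of Witt vectors of the perfect field \<open>k\<close> is the
  strict \<open>p\<close>-ring with residue ring \<open>k\<close> (unique up to unique isomorphism); \<open>res\<close> is the reduction
  map. That \<open>p\<close> is a nonzerodivisor follows from \<open>K\<close> being a field of characteristic zero.\<close>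

definition ring_of_integers :: "'f::field_char_0 set \<Rightarrow> 'f \<Rightarrow> 'f set" where
  "ring_of_integers W \<zeta> = generate_ring ring_of_type_algebra (W \<union> {\<zeta>})"

locale cyclotomic_base =
  fixes p :: nat and W :: "'f::field_char_0 set" and res :: "'f \<Rightarrow> 'k::field" and \<zeta> :: 'f
  assumes prime_p: "Factorial_Ring.prime p"
    and char_k: "CHAR('k) = p"
    and perfect_k: "\<forall>y::'k. \<exists>x. x ^ p = y"
    and W_subring: "subring W ring_of_type_algebra"
    and W_complete: "adically_complete (subset_ring W) (PIdl\<^bsub>subset_ring W\<^esub> (of_nat p))"
    and res_hom: "res \<in> ring_hom (subset_ring W) ring_of_type_algebra"
    and res_surj: "res ` W = UNIV"
    and res_kernel: "{w \<in> W. res w = 0} = {of_nat p * w |w. w \<in> W}"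
    and zeta_primitive: "\<zeta> ^ p = 1" "\<zeta> \<noteq> 1"
    and K_generated: "generate_field ring_of_type_algebra (W \<union> {\<zeta>}) = UNIV"

text \<open>The type \<open>'f fps\<close> is used in two ways: as \<open>S = K[[q - \<zeta>]]\<close>, in which case \<open>fps_X\<close> is
  \<open>q - \<zeta>\<close>, and as a type containing \<open>W[[q - 1]]\<close>, in which case \<open>fps_X\<close> is \<open>q - 1\<close>.\<close>

abbreviation S_ring :: "'f::field_char_0 fps ring" where
  "S_ring \<equiv> ring_of_type_algebra"

definition qS :: "'f::field_char_0 \<Rightarrow> 'f fps" where
  "qS \<zeta> = fps_const \<zeta> + fps_X"

definition S_nbhds :: "nat \<Rightarrow> 'f::field_char_0 set \<Rightarrow> 'f fps set set" where
  "S_nbhds p OK =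
    {{of_nat p ^ n * a + fps_X ^ m * b |a b. \<forall>i. fps_nth a i \<in> OK} |n m. True}"

definition WR :: "'f::field_char_0 set \<Rightarrow> 'f fps ring" where
  "WR W = subset_ring {f. \<forall>i. fps_nth f i \<in> W}"

definition qR :: "'f::field_char_0 fps" where
  "qR = 1 + fps_X"

text \<open>The continuous map \<open>W[[q - 1]] \<rightarrow> S\<close>, which is the expansion at \<open>q = \<zeta>\<close>.\<close>

definition R_to_S :: "nat \<Rightarrow> 'f::field_char_0 set \<Rightarrow> 'f \<Rightarrow> 'f fps \<Rightarrow> 'f fps" where
  "R_to_S p OK \<zeta> f = (THE g. \<forall>U\<in>S_nbhds p OK. \<exists>n0. \<forall>n\<ge>n0.
     (\<Sum>i<n. fps_const (fps_nth f i) * (qS \<zeta> - 1) ^ i) - g \<in> U)"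

text \<open>The completion of the divided power polynomial ring \<open>S\<langle>\<omega>\<rangle>\<close>: for the direct sum topology (given
  by the same neighborhood \<open>U\<close> in all the summands), it consists of the families \<open>f\<close> of elements of
  \<open>S\<close> that tend to zero, such an \<open>f\<close> standing for the sum of the \<open>f n \<cdot> \<omega>\<^bsup>[n]\<^esup>\<close>.\<close>

definition T_ring :: "nat \<Rightarrow> 'f::field_char_0 set \<Rightarrow> (nat \<Rightarrow> 'f fps) ring" where
  "T_ring p OK =
    \<lparr>carrier = {f. \<forall>U\<in>S_nbhds p OK. \<exists>n0. \<forall>n\<ge>n0. f n \<in> U},
     monoid.mult = (\<lambda>f g n. \<Sum>i\<le>n. of_nat (n choose i) * f i * g (n - i)),
     monoid.one = (\<lambda>n. if n = 0 then 1 else 0),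
     ring.zero = (\<lambda>n. 0),
     ring.add = (\<lambda>f g n. f n + g n)\<rparr>"

definition T_nbhds :: "nat \<Rightarrow> 'f::field_char_0 set \<Rightarrow> (nat \<Rightarrow> 'f fps) set set" where
  "T_nbhds p OK = {{f \<in> carrier (T_ring p OK). \<forall>n. f n \<in> U} |U. U \<in> S_nbhds p OK}"

definition S_to_T :: "'f::field_char_0 fps \<Rightarrow> nat \<Rightarrow> 'f fps" where
  "S_to_T s = (\<lambda>n. if n = 0 then s else 0)"

definition omega_log :: "nat \<Rightarrow> nat \<Rightarrow> 'f::field_char_0 fps" where
  "omega_log k = (\<lambda>n. if n = k then 1 else 0)"

text \<open>The constant coefficient of \<open>qfact (qS \<zeta> ^ p) n\<close> is \<open>n!\<close>, so that this is a unit of \<open>S\<close>.\<close>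

definition omega_delta :: "nat \<Rightarrow> 'f::field_char_0 set \<Rightarrow> 'f \<Rightarrow> nat \<Rightarrow> nat \<Rightarrow> 'f fps" where
  "omega_delta p OK \<zeta> n =
    S_to_T (inverse (qfact (qS \<zeta> ^ p) n)) \<otimes>\<^bsub>T_ring p OK\<^esub>
      (\<Otimes>\<^bsub>T_ring p OK\<^esub>k\<in>{..<n}.
         omega_log 1 \<ominus>\<^bsub>T_ring p OK\<^esub> S_to_T (qnum (qS \<zeta> ^ p) k * (qS \<zeta> ^ 2 - qS \<zeta>)))"


section \<open>The prism \<open>(R, (p)\<^sub>q)\<close> and its self-product\<close>

text \<open>\<open>R\<close> is a copy, via \<open>\<rho>\<close>, of \<open>W[[q - 1]]\<close> inside the universe \<open>'u\<close>. There is only one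
  \<open>\<delta>\<close>-structure on this ring such that \<open>\<delta> q = 0\<close>.\<close>

locale q_prism =
  fixes p :: nat and W :: "'f::field_char_0 set" and \<zeta> :: 'f
    and R :: "('u, 'f) prism" and \<rho> :: "'f fps \<Rightarrow> 'u"
  assumes R_object: "site_object p (ring_of_integers W \<zeta>) R"
    and R_ring: "\<rho> \<in> ring_iso (WR W) (pring R)"
    and R_delta: "pdelta R (\<rho> qR) = \<zero>\<^bsub>pring R\<^esub>"
    and R_ideal: "pideal R = PIdl\<^bsub>pring R\<^esub> (\<rho> (qnum qR p))"
    and R_str_zeta: "pstr R \<zeta> = pideal R +>\<^bsub>pring R\<^esub> \<rho> qR"
    and R_str_W: "w \<in> W \<Longrightarrow> pstr R w = pideal R +>\<^bsub>pring R\<^esub> \<rho> (fps_const w)"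

text \<open>\<open>P\<close> is the \<open>R\<close>-algebra \<open>R\<langle>\<omega>\<rangle>\<^sub>\<Delta>\<close>, with structural map \<open>j\<close> and basis \<open>w\<close>.\<close>

locale delta_polynomials =
  fixes p :: nat and W :: "'f::field_char_0 set"
    and P :: "'v ring" and j :: "'f fps \<Rightarrow> 'v" and w :: "nat \<Rightarrow> 'v"
  assumes P_cring: "cring P"
    and j_hom: "j \<in> ring_hom (WR W) P"
    and w_closed: "w n \<in> carrier P"
    and w_basis: "x \<in> carrier P \<Longrightarrow>
      \<exists>!c. (\<forall>n. c n \<in> carrier (WR W)) \<and> finite {n. c n \<noteq> 0} \<and>
           x = (\<Oplus>\<^bsub>P\<^esub>n\<in>{n. c n \<noteq> 0}. j (c n) \<otimes>\<^bsub>P\<^esub> w n)"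
    and w_relation: "j (qfact (qR ^ p) n) \<otimes>\<^bsub>P\<^esub> w n =
      (\<Otimes>\<^bsub>P\<^esub>k\<in>{..<n}. w 1 \<ominus>\<^bsub>P\<^esub> j (qnum (qR ^ p) k * (qR ^ 2 - qR)))"

text \<open>\<open>A\<close> is a copy, via \<open>\<alpha>\<close>, of the completion of \<open>P\<close> inside the universe \<open>'u\<close>, and \<open>\<iota>\<close>
  and \<open>\<theta>\<close> are the two projections. The \<open>\<delta>\<close>-structure and the structural map of \<open>A\<close> are
  determined by the condition that \<open>\<iota>\<close> and \<open>\<theta>\<close> are maps in the site.\<close>

locale q_self_product =
  q_prism p W \<zeta> R \<rho> + delta_polynomials p W P j w
  for p :: nat and W :: "'f::field_char_0 set" and \<zeta> :: 'f
    and R :: "('u, 'f) prism" and \<rho> :: "'f fps \<Rightarrow> 'u"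
    and P :: "'v ring" and j :: "'f fps \<Rightarrow> 'v" and w :: "nat \<Rightarrow> 'v" +
  fixes A :: "('u, 'f) prism" and \<alpha> :: "(nat \<Rightarrow> 'v set) \<Rightarrow> 'u"
    and \<iota> :: "'u \<Rightarrow> 'u" and \<theta> :: "'u \<Rightarrow> 'u"
  assumes A_object: "site_object p (ring_of_integers W \<zeta>) A"
    and A_ring: "\<alpha> \<in> ring_iso (adic_completion P (Idl\<^bsub>P\<^esub> {p_of p P, j (qR - 1)})) (pring A)"
    and A_ideal: "pideal A = PIdl\<^bsub>pring A\<^esub> (\<iota> (\<rho> (qnum qR p)))"
    and iota_morphism: "site_morphism p (ring_of_integers W \<zeta>) R A \<iota>"
    and iota: "f \<in> carrier (WR W) \<Longrightarrow>
      \<iota> (\<rho> f) = \<alpha> (to_completion P (Idl\<^bsub>P\<^esub> {p_of p P, j (qR - 1)}) (j f))"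
    and theta_morphism: "site_morphism p (ring_of_integers W \<zeta>) R A \<theta>"
    and theta: "\<theta> (\<rho> qR) = \<iota> (\<rho> qR) \<oplus>\<^bsub>pring A\<^esub> \<iota> (\<rho> (qnum qR p)) \<otimes>\<^bsub>pring A\<^esub>
      \<alpha> (to_completion P (Idl\<^bsub>P\<^esub> {p_of p P, j (qR - 1)}) (w 1))"

text \<open>The identification \<open>\<sigma>\<close> of \<open>S\<close> with \<open>BdR p R\<close> and the identification \<open>\<tau>\<close> of the
  completion of \<open>S\<langle>\<omega>\<rangle>\<close> with \<open>BdR p A\<close>. They are determined by these conditions.\<close>

locale bdr_identification =
  q_self_product p W \<zeta> R \<rho> P j w A \<alpha> \<iota> \<theta>
  for p :: nat and W :: "'f::field_char_0 set" and \<zeta> :: 'f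
    and R :: "('u, 'f) prism" and \<rho> :: "'f fps \<Rightarrow> 'u"
    and P :: "'v ring" and j :: "'f fps \<Rightarrow> 'v" and w :: "nat \<Rightarrow> 'v"
    and A :: "('u, 'f) prism" and \<alpha> :: "(nat \<Rightarrow> 'v set) \<Rightarrow> 'u"
    and \<iota> :: "'u \<Rightarrow> 'u" and \<theta> :: "'u \<Rightarrow> 'u" +
  fixes \<sigma> :: "'f fps \<Rightarrow> 'u bdr" and \<tau> :: "(nat \<Rightarrow> 'f fps) \<Rightarrow> 'u bdr"
  assumes sigma_iso: "\<sigma> \<in> ring_iso S_ring (BdR p R)"
    and sigma_R: "f \<in> carrier (WR W) \<Longrightarrow>
      \<sigma> (R_to_S p (ring_of_integers W \<zeta>) \<zeta> f) = to_BdR p R (\<rho> f)"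
    and tau_iso: "\<tau> \<in> ring_iso (T_ring p (ring_of_integers W \<zeta>)) (BdR p A)"
    and tau_S: "\<tau> (S_to_T s) = BdR_map p A \<iota> (\<sigma> s)"
    and tau_omega: "\<tau> (omega_log 1) =
      to_BdR p A (\<alpha> (to_completion P (Idl\<^bsub>P\<^esub> {p_of p P, j (qR - 1)}) (w 1)))"
    and tau_continuous: "U \<in> T_nbhds p (ring_of_integers W \<zeta>) \<Longrightarrow>
      \<exists>n. \<forall>a\<in>ideal_pow (pring A) (Idl\<^bsub>pring A\<^esub> {p_of p (pring A), \<iota> (\<rho> (qR - 1))}) n.
        \<exists>t\<in>U. \<tau> t = to_BdR p A a"


section \<open>Convergence and Taylor expansions\<close>

text \<open>Let \<open>D\<close> be a ring with a linear topology, \<open>nbhds\<close> being a basis of neighborhoods of zero. A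
  \<open>D\<close>-module is given the finest topology, among those defined by additive subgroups, for which
  all the maps \<open>D \<rightarrow> N\<close>, \<open>t \<mapsto> t \<odot> x\<close> are continuous. On a finite free module, this is the
  product topology, for any choice of a basis.\<close>

definition open_subgroup ::
    "'d set set \<Rightarrow> ('d, 'n, 'z) module_scheme \<Rightarrow> 'n set \<Rightarrow> bool" where
  "open_subgroup nbhds N H \<longleftrightarrow> additive_subgroup H N \<and>
     (\<forall>x\<in>carrier N. \<exists>U\<in>nbhds. \<forall>t\<in>U. t \<odot>\<^bsub>N\<^esub> x \<in> H)"

definition module_tendsto ::
    "'d set set \<Rightarrow> ('d, 'n, 'z) module_scheme \<Rightarrow> (nat \<Rightarrow> 'n) \<Rightarrow> 'n \<Rightarrow> bool" where
  "module_tendsto nbhds N x l \<longleftrightarrow> l \<in> carrier N \<and>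
     (\<forall>H. open_subgroup nbhds N H \<longrightarrow> (\<exists>n0. \<forall>n\<ge>n0. x n \<ominus>\<^bsub>N\<^esub> l \<in> H))"

text \<open>\<open>\<Sum>\<^sub>n\<^sub>\<ge>\<^sub>k x n = l\<close>, as limit of the partial sums\<close>

definition module_sums ::
    "'d set set \<Rightarrow> ('d, 'n, 'z) module_scheme \<Rightarrow> nat \<Rightarrow> (nat \<Rightarrow> 'n) \<Rightarrow> 'n \<Rightarrow> bool" where
  "module_sums nbhds N k x l \<longleftrightarrow> module_tendsto nbhds N (\<lambda>m. \<Oplus>\<^bsub>N\<^esub>n\<in>{k..m}. x n) l"

text \<open>Let \<open>f\<close> be \<open>\<iota>\<close> or \<open>\<theta>\<close>. Then \<open>S_to_T_along\<close> is the induced map from \<open>S\<close> to the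
  completion of \<open>S\<langle>\<omega>\<rangle>\<close>.\<close>

definition S_to_T_along ::
    "nat \<Rightarrow> 'f::field_char_0 set \<Rightarrow> ('u, 'f) prism \<Rightarrow> ('f fps \<Rightarrow> 'u bdr) \<Rightarrow>
     ((nat \<Rightarrow> 'f fps) \<Rightarrow> 'u bdr) \<Rightarrow> ('u \<Rightarrow> 'u) \<Rightarrow> 'f fps \<Rightarrow> nat \<Rightarrow> 'f fps" where
  "S_to_T_along p OK A \<sigma> \<tau> f s =
     the_inv_into (carrier (T_ring p OK)) \<tau> (BdR_map p A f (\<sigma> s))"

definition crystal_module ::
    "('u, 'f, 'm) site_presheaf \<Rightarrow> ('u, 'f) prism \<Rightarrow> ('d \<Rightarrow> 'u bdr) \<Rightarrow> ('d, 'm) module" where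
  "crystal_module E V \<sigma> = restrict_scalars \<sigma> (Eobj E V)"

definition pullback ::
    "nat \<Rightarrow> 'f::field_char_0 set \<Rightarrow> ('u, 'f, 'm) site_presheaf \<Rightarrow> ('u, 'f) prism \<Rightarrow> ('u, 'f) prism \<Rightarrow>
     ('f fps \<Rightarrow> 'u bdr) \<Rightarrow> ((nat \<Rightarrow> 'f fps) \<Rightarrow> 'u bdr) \<Rightarrow> ('u \<Rightarrow> 'u) \<Rightarrow>
     (nat \<Rightarrow> 'f fps, ('m \<Rightarrow> nat \<Rightarrow> 'f fps) set) module" where
  "pullback p OK E R A \<sigma> \<tau> f =
     base_change S_ring (T_ring p OK) (S_to_T_along p OK A \<sigma> \<tau> f) (crystal_module E R \<sigma>)"

definition pullback_tensor ::
    "nat \<Rightarrow> 'f::field_char_0 set \<Rightarrow> ('u, 'f, 'm) site_presheaf \<Rightarrow> ('u, 'f) prism \<Rightarrow> ('u, 'f) prism \<Rightarrow>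
     ('f fps \<Rightarrow> 'u bdr) \<Rightarrow> ((nat \<Rightarrow> 'f fps) \<Rightarrow> 'u bdr) \<Rightarrow> ('u \<Rightarrow> 'u) \<Rightarrow>
     (nat \<Rightarrow> 'f fps) \<Rightarrow> 'm \<Rightarrow> ('m \<Rightarrow> nat \<Rightarrow> 'f fps) set" where
  "pullback_tensor p OK E R A \<sigma> \<tau> f t x =
     tensor S_ring (T_ring p OK) (S_to_T_along p OK A \<sigma> \<tau> f) (crystal_module E R \<sigma>) t x"

definition pullback_to_sections ::
    "nat \<Rightarrow> 'f::field_char_0 set \<Rightarrow> ('u, 'f, 'm) site_presheaf \<Rightarrow> ('u, 'f) prism \<Rightarrow> ('u, 'f) prism \<Rightarrow>
     ((nat \<Rightarrow> 'f fps) \<Rightarrow> 'u bdr) \<Rightarrow> ('u \<Rightarrow> 'u) \<Rightarrow> ('m \<Rightarrow> nat \<Rightarrow> 'f fps) set \<Rightarrow> 'm" where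
  "pullback_to_sections p OK E R A \<tau> f =
     linearization (T_ring p OK) (crystal_module E A \<tau>) (Emap E R A f)"

text \<open>The isomorphism \<open>\<epsilon>\<close> from the pullback along \<open>\<theta>\<close> to the pullback along \<open>\<iota>\<close>, obtained by
  identifying both with the sections on \<open>A\<close>. As \<open>M\<close> is finite free, the pullback along \<open>\<iota>\<close> is also
  the completed tensor product.\<close>

definition crystal_iso ::
    "nat \<Rightarrow> 'f::field_char_0 set \<Rightarrow> ('u, 'f, 'm) site_presheaf \<Rightarrow> ('u, 'f) prism \<Rightarrow> ('u, 'f) prism \<Rightarrow>
     ('f fps \<Rightarrow> 'u bdr) \<Rightarrow> ((nat \<Rightarrow> 'f fps) \<Rightarrow> 'u bdr) \<Rightarrow> ('u \<Rightarrow> 'u) \<Rightarrow> ('u \<Rightarrow> 'u) \<Rightarrow>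
     ('m \<Rightarrow> nat \<Rightarrow> 'f fps) set \<Rightarrow> ('m \<Rightarrow> nat \<Rightarrow> 'f fps) set" where
  "crystal_iso p OK E R A \<sigma> \<tau> \<iota> \<theta> y =
     the_inv_into (carrier (pullback p OK E R A \<sigma> \<tau> \<iota>)) (pullback_to_sections p OK E R A \<tau> \<iota>)
       (pullback_to_sections p OK E R A \<tau> \<theta> y)"

definition taylor_map ::
    "nat \<Rightarrow> 'f::field_char_0 set \<Rightarrow> ('u, 'f, 'm) site_presheaf \<Rightarrow> ('u, 'f) prism \<Rightarrow> ('u, 'f) prism \<Rightarrow>
     ('f fps \<Rightarrow> 'u bdr) \<Rightarrow> ((nat \<Rightarrow> 'f fps) \<Rightarrow> 'u bdr) \<Rightarrow> ('u \<Rightarrow> 'u) \<Rightarrow> ('u \<Rightarrow> 'u) \<Rightarrow>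
     'm \<Rightarrow> ('m \<Rightarrow> nat \<Rightarrow> 'f fps) set" where
  "taylor_map p OK E R A \<sigma> \<tau> \<iota> \<theta> s =
     crystal_iso p OK E R A \<sigma> \<tau> \<iota> \<theta>
       (pullback_tensor p OK E R A \<sigma> \<tau> \<theta> \<one>\<^bsub>T_ring p OK\<^esub> s)"

text \<open>\<open>d k\<close> is the family of coefficients of the Taylor expansion with respect to the family \<open>b\<close>.\<close>

definition taylor_coefficients ::
    "nat \<Rightarrow> 'f::field_char_0 set \<Rightarrow> ('u, 'f, 'm) site_presheaf \<Rightarrow> ('u, 'f) prism \<Rightarrow> ('u, 'f) prism \<Rightarrow>
     ('f fps \<Rightarrow> 'u bdr) \<Rightarrow> ((nat \<Rightarrow> 'f fps) \<Rightarrow> 'u bdr) \<Rightarrow> ('u \<Rightarrow> 'u) \<Rightarrow> ('u \<Rightarrow> 'u) \<Rightarrow>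
     (nat \<Rightarrow> nat \<Rightarrow> 'f fps) \<Rightarrow> (nat \<Rightarrow> 'm \<Rightarrow> 'm) \<Rightarrow> bool" where
  "taylor_coefficients p OK E R A \<sigma> \<tau> \<iota> \<theta> b d \<longleftrightarrow>
     (\<forall>s\<in>carrier (crystal_module E R \<sigma>).
        (\<forall>k. d k s \<in> carrier (crystal_module E R \<sigma>)) \<and>
        module_sums (T_nbhds p OK) (pullback p OK E R A \<sigma> \<tau> \<iota>) 0
          (\<lambda>k. pullback_tensor p OK E R A \<sigma> \<tau> \<iota> (b k) (d k s))
          (taylor_map p OK E R A \<sigma> \<tau> \<iota> \<theta> s))"

end

theory Submission
  imports Defs
begin

text \<open>
  Write \<open>T\<close> for the completion of \<open>S\<langle>\<omega>\<rangle>\<close>. A basis of \<open>M\<close> turns a Taylor expansion into a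
  tuple of elements of \<open>T\<close>, and expanding \<open>\<Prod>\<^sub>k (\<omega> - (k) (q\<^sup>2 - q))\<close> with \<open>(k)\<close> the
  \<open>q\<^sup>p\<close>-number expresses \<open>omega_delta n\<close> as a finite combination of the \<open>omega_log k\<close> by Stirling
  numbers of the first kind. Taking the coefficient of \<open>omega_log k\<close>, which is continuous on \<open>T\<close>,
  gives the first formula.

  For the second formula one inverts the triangular matrix, by orthogonality of the two kinds of
  Stirling numbers. The coefficient of \<open>omega_delta k\<close> becomes the functional on \<open>T\<close> with matrix
  \<open>(k)! / n! S(n, k) (q - 1)\<^bsup>n - k\<^esup> q\<^bsup>n - k\<^esup>\<close>, and it is continuous because
  \<open>(\<zeta> - 1)\<^sup>n / n!\<close> lies in \<open>O\<^sub>K\<close>: modulo \<open>(q - \<zeta>)\<^sup>m\<close> these entries have bounded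
  denominators as \<open>n\<close> varies.
\<close>

section \<open>Subrings of a type-class ring\<close>

text \<open>The second formula is not a formal rearrangement of two infinite sums: the expansion in
  \<open>omega_delta\<close> converges only topologically, and a column of
  \<open>delta_of_log\<close> is infinite. The triangular inversion is applied to a finite partial
  sum, where it is exact, and the error is estimated. This works because a basic neighborhood in
  \<open>T\<close> imposes the same condition on all coefficients, so that one error bound meets
  infinitely many entries with common denominator \<open>p ^ (k + m)\<close>.

  Denominators are measured modulo a fixed \<open>(q - \<zeta>) ^ m\<close>, because the coefficient
  of \<open>(q - \<zeta>) ^ i\<close> in a power of \<open>q - 1\<close> loses i factors
  \<open>\<zeta> - 1\<close>. The bound on \<open>(\<zeta> - 1) ^ n / n!\<close> reflects that n!
  has p-adic valuation at most n / (p - 1), which is the valuation of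
  \<open>(\<zeta> - 1) ^ n\<close>.

  Limits also have to be unique. As \<open>W\<close> is given only as a complete ring with a residue
  map, it has to be recognised as a discrete valuation ring; \<open>OK\<close> lies in a free
  \<open>W\<close>-module of finite rank, hence is p-adically separated, and \<open>S\<close> is
  Hausdorff.\<close>

lemma type_algebra_simps [simp]:
  "carrier ring_of_type_algebra = UNIV"
  "x \<otimes>\<^bsub>ring_of_type_algebra\<^esub> y = x * y"
  "\<one>\<^bsub>ring_of_type_algebra\<^esub> = 1"
  "\<zero>\<^bsub>ring_of_type_algebra\<^esub> = 0"
  "x \<oplus>\<^bsub>ring_of_type_algebra\<^esub> y = x + y"
  by (simp_all add: ring_of_type_algebra_def)

lemma type_algebra_a_inv [simp]:
  "\<ominus>\<^bsub>ring_of_type_algebra\<^esub> x = - (x :: 'a::comm_ring_1)"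
proof -
  interpret cring "ring_of_type_algebra :: 'a ring"
    by (rule cring_from_type_algebra)
  have "\<ominus>\<^bsub>ring_of_type_algebra\<^esub> x \<oplus>\<^bsub>ring_of_type_algebra\<^esub> x = \<zero>\<^bsub>ring_of_type_algebra\<^esub>"
    by (rule l_neg) simp
  then show ?thesis
    by (simp add: eq_neg_iff_add_eq_0)
qed

lemma type_algebra_inv:
  assumes "x \<noteq> 0"
  shows "inv\<^bsub>ring_of_type_algebra\<^esub> x = inverse (x :: 'a::Fields.field)"
proof -
  interpret Ring.field "ring_of_type_algebra :: 'a ring"
    by (rule field_from_type_algebra)
  have "inv\<^bsub>ring_of_type_algebra\<^esub> x \<otimes>\<^bsub>ring_of_type_algebra\<^esub> x = \<one>\<^bsub>ring_of_type_algebra\<^esub>"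
    using assms by (intro Units_l_inv) (auto simp: field_Units)
  then show ?thesis
    using assms by (simp add: field_simps)
qed

lemma subset_ring_simps [simp]:
  "carrier (subset_ring A) = A"
  "x \<otimes>\<^bsub>subset_ring A\<^esub> y = x * y"
  "\<one>\<^bsub>subset_ring A\<^esub> = 1"
  "\<zero>\<^bsub>subset_ring A\<^esub> = 0"
  "x \<oplus>\<^bsub>subset_ring A\<^esub> y = x + y"
  by (simp_all add: subset_ring_def)

context
  fixes A :: "'a::comm_ring_1 set"
  assumes A: "subring A ring_of_type_algebra"
begin

lemma subring_zero: "0 \<in> A"
  using subringE(2)[OF A] by simp

lemma subring_one: "1 \<in> A"
  using subringE(3)[OF A] by simp

lemma subring_add: "x \<in> A \<Longrightarrow> y \<in> A \<Longrightarrow> x + y \<in> A"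
  using subringE(7)[OF A] by simp

lemma subring_mult: "x \<in> A \<Longrightarrow> y \<in> A \<Longrightarrow> x * y \<in> A"
  using subringE(6)[OF A] by simp

lemma subring_minus: "x \<in> A \<Longrightarrow> - x \<in> A"
  using subringE(5)[OF A] by simp

lemma subring_diff: "x \<in> A \<Longrightarrow> y \<in> A \<Longrightarrow> x - y \<in> A"
  using subring_add[of x "- y"] subring_minus by simp

lemma subring_power: "x \<in> A \<Longrightarrow> x ^ n \<in> A"
  by (induction n) (auto intro: subring_one subring_mult)

lemma subring_of_nat: "of_nat n \<in> A"
  by (induction n) (auto intro: subring_zero subring_one subring_add)

lemma subring_sum: "(\<And>i. i \<in> I \<Longrightarrow> f i \<in> A) \<Longrightarrow> sum f I \<in> A"
  by (induction I rule: infinite_finite_induct) (auto intro: subring_zero subring_add)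

lemmas subring_closed =
  subring_zero subring_one subring_add subring_mult subring_minus subring_diff subring_power
  subring_of_nat subring_sum

section \<open>Principal ideals and adic completeness\<close>

lemma ideal_pow_principal:
  assumes "a \<in> A"
  shows "ideal_pow (subset_ring A) (PIdl\<^bsub>subset_ring A\<^esub> a) n = {a ^ n * x |x. x \<in> A}"
proof (induction n)
  case 0
  then show ?case by simp
next
  case (Suc n)
  have "y \<in> {a ^ Suc n * x |x. x \<in> A}"
    if "y \<in> ideal_prod (subset_ring A) (PIdl\<^bsub>subset_ring A\<^esub> a) {a ^ n * x |x. x \<in> A}" for y
    using that
  proof induction
    case (prod i j)
    then obtain u v where "i = u * a" "u \<in> A" "j = a ^ n * v" "v \<in> A"
      by (auto simp: cgenideal_def)
    then show ?case
      by (auto simp: mult_ac intro!: exI[of _ "u * v"] subring_mult)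
  next
    case (sum s t)
    then obtain u v where "s = a ^ Suc n * u" "u \<in> A" "t = a ^ Suc n * v" "v \<in> A"
      by auto
    then show ?case
      by (auto simp: algebra_simps intro!: exI[of _ "u + v"] subring_add)
  qed
  moreover have "a ^ Suc n * x \<in> ideal_prod (subset_ring A) (PIdl\<^bsub>subset_ring A\<^esub> a) {a ^ n * x |x. x \<in> A}"
    if "x \<in> A" for x
  proof -
    have "(1 * a) \<otimes>\<^bsub>subset_ring A\<^esub> (a ^ n * x)
        \<in> ideal_prod (subset_ring A) (PIdl\<^bsub>subset_ring A\<^esub> a) {a ^ n * x |x. x \<in> A}"
      by (rule ideal_prod.prod)
        (use that in \<open>auto simp: cgenideal_def intro: subring_one exI[of _ 1]\<close>)
    then show ?thesis
      by (simp add: mult_ac)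
  qed
  ultimately show ?case
    unfolding ideal_pow.simps Suc.IH by blast
qed

lemma a_r_coset_principal:
  "{a ^ n * x |x. x \<in> A} +>\<^bsub>subset_ring A\<^esub> b = {a ^ n * x + b |x. x \<in> A}"
  by (auto simp: a_r_coset_def')

text \<open>This is injectivity of the map to the completion: \<open>x\<close> and 0 have the same
  coset modulo each \<open>a ^ n\<close>.\<close>

lemma adically_complete_separated:
  assumes "a \<in> A" "adically_complete (subset_ring A) (PIdl\<^bsub>subset_ring A\<^esub> a)"
    and x: "\<And>n. \<exists>y\<in>A. x = a ^ n * y"
  shows "x = 0"
proof -
  have "x \<in> A"
    using x[of 0] by auto
  have "{a ^ n * y + x |y. y \<in> A} = {a ^ n * y + 0 |y. y \<in> A}" for n
  proof -
    obtain z where z: "z \<in> A" "x = a ^ n * z"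
      using x by blast
    have "a ^ n * y + x = a ^ n * (y + z) + 0" "a ^ n * y + 0 = a ^ n * (y - z) + x" for y
      by (simp_all add: z algebra_simps)
    then show ?thesis
      using z(1) subring_add subring_diff by blast
  qed
  then have "to_completion (subset_ring A) (PIdl\<^bsub>subset_ring A\<^esub> a) x
      = to_completion (subset_ring A) (PIdl\<^bsub>subset_ring A\<^esub> a) 0"
    by (simp add: to_completion_def ideal_pow_principal[OF assms(1)] a_r_coset_principal)
  moreover have "inj_on (to_completion (subset_ring A) (PIdl\<^bsub>subset_ring A\<^esub> a)) A"
    using assms(2) by (simp add: adically_complete_def bij_betw_def)
  ultimately show ?thesis
    using \<open>x \<in> A\<close> subring_zero by (auto dest: inj_onD)
qed

text \<open>This is surjectivity of the map to the completion. The congruence between consecutive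
  terms makes the cosets of \<open>x n\<close> modulo \<open>a ^ n\<close> a decreasing sequence,
  that is, a point of the inverse limit.\<close>

lemma adically_complete_limit:
  assumes "a \<in> A" "adically_complete (subset_ring A) (PIdl\<^bsub>subset_ring A\<^esub> a)"
    and x: "\<And>n. x n \<in> A" "\<And>n. \<exists>y\<in>A. x (Suc n) = x n + a ^ n * y"
  shows "\<exists>b\<in>A. \<forall>n. \<exists>y\<in>A. b = x n + a ^ n * y"
proof -
  let ?I = "\<lambda>n. {a ^ n * y |y. y \<in> A}"
  have "{a ^ Suc n * y + x (Suc n) |y. y \<in> A} \<subseteq> {a ^ n * y + x n |y. y \<in> A}" for n
  proof -
    obtain z where z: "z \<in> A" "x (Suc n) = x n + a ^ n * z"
      using x(2) by blast
    have "a ^ Suc n * y + x (Suc n) = a ^ n * (a * y + z) + x n" for y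
      by (simp add: z algebra_simps)
    then show ?thesis
      using z(1) assms(1) subring_add subring_mult by blast
  qed
  then have "(\<lambda>n. {a ^ n * y + x n |y. y \<in> A})
      \<in> carrier (adic_completion (subset_ring A) (PIdl\<^bsub>subset_ring A\<^esub> a))"
    using x(1)
    by (auto simp: adic_completion_def FactRing_def A_RCOSETS_def' ideal_pow_principal[OF assms(1)]
        a_r_coset_principal)
  then obtain b where b: "b \<in> A"
    "(\<lambda>n. {a ^ n * y + x n |y. y \<in> A}) = to_completion (subset_ring A) (PIdl\<^bsub>subset_ring A\<^esub> a) b"
    using assms(2) by (auto simp: adically_complete_def bij_betw_def)
  have "\<exists>y\<in>A. b = x n + a ^ n * y" for n
  proof -
    have "{a ^ n * y + x n |y. y \<in> A} = {a ^ n * y + b |y. y \<in> A}"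
      using fun_cong[OF b(2), of n]
      by (simp add: to_completion_def ideal_pow_principal[OF assms(1)] a_r_coset_principal)
    moreover have "a ^ n * 0 + b \<in> {a ^ n * y + b |y. y \<in> A}"
      using subring_zero by blast
    ultimately have "b \<in> {a ^ n * y + x n |y. y \<in> A}"
      by simp
    then show ?thesis
      by (auto simp: add.commute)
  qed
  with b(1) show ?thesis
    by blast
qed

text \<open>The inverse is the limit of the partial sums of the geometric series. Its product with
  \<open>1 - a * t\<close> is seen to be 1 modulo each \<open>a ^ n\<close>, and separatedness turns
  this into an equality.\<close>

lemma adically_complete_geometric_series:
  assumes "a \<in> A" "adically_complete (subset_ring A) (PIdl\<^bsub>subset_ring A\<^esub> a)" "t \<in> A"
  shows "\<exists>b\<in>A. (1 - a * t) * b = 1"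
proof -
  have "\<exists>b\<in>A. \<forall>n. \<exists>y\<in>A. b = (\<Sum>i<n. (a * t) ^ i) + a ^ n * y"
  proof (rule adically_complete_limit[OF assms(1,2)])
    show "(\<Sum>i<n. (a * t) ^ i) \<in> A" for n
      using assms by (intro subring_sum subring_power subring_mult)
    show "\<exists>y\<in>A. (\<Sum>i<Suc n. (a * t) ^ i) = (\<Sum>i<n. (a * t) ^ i) + a ^ n * y" for n
      by (rule bexI[of _ "t ^ n"]) (use assms in \<open>auto simp: power_mult_distrib intro: subring_power\<close>)
  qed
  then obtain b where b: "b \<in> A" "\<And>n. \<exists>y\<in>A. b = (\<Sum>i<n. (a * t) ^ i) + a ^ n * y"
    by blast
  have "(1 - a * t) * b - 1 = 0"
  proof (rule adically_complete_separated[OF assms(1,2)])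
    fix n
    obtain y where y: "y \<in> A" "b = (\<Sum>i<n. (a * t) ^ i) + a ^ n * y"
      using b(2) by blast
    have "(1 - a * t) * b - 1 = (1 - a * t) * (\<Sum>i<n. (a * t) ^ i) - 1 + (1 - a * t) * a ^ n * y"
      by (simp add: y algebra_simps)
    also have "(1 - a * t) * (\<Sum>i<n. (a * t) ^ i) = 1 - (a * t) ^ n"
      by (rule one_diff_power_eq[symmetric])
    also have "1 - (a * t) ^ n - 1 + (1 - a * t) * a ^ n * y = a ^ n * ((1 - a * t) * y - t ^ n)"
      by (simp add: algebra_simps power_mult_distrib)
    finally show "\<exists>y\<in>A. (1 - a * t) * b - 1 = a ^ n * y"
      using y(1) assms by (blast intro: subring_closed)
  qed
  with b(1) show ?thesis
    by auto
qed

end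

section \<open>The rings \<open>W\<close> and \<open>O\<^sub>K\<close>\<close>

lemma type_algebra_nat_pow [simp]: "x [^]\<^bsub>ring_of_type_algebra\<^esub> (n::nat) = x ^ n"
  by (induction n) (simp_all add: nat_pow_def power_commutes)

text \<open>The generating set indexes its own coefficients, so that dropping a generator, as in
  \<open>OK_basis\<close>, is just removing an element of \<open>G\<close>.\<close>

definition lin_span :: "'a::comm_ring_1 set \<Rightarrow> 'a set \<Rightarrow> 'a set" where
  "lin_span A G = {\<Sum>g\<in>G. c g * g |c. \<forall>g. c g \<in> A}"

lemma lin_span_add:
  assumes "subring A ring_of_type_algebra" "x \<in> lin_span A G" "y \<in> lin_span A G"
  shows "x + y \<in> lin_span A G"
proof -
  obtain c d where "x = (\<Sum>g\<in>G. c g * g)" "\<forall>g. c g \<in> A" "y = (\<Sum>g\<in>G. d g * g)" "\<forall>g. d g \<in> A"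
    using assms by (auto simp: lin_span_def)
  then have "x + y = (\<Sum>g\<in>G. (c g + d g) * g)" "\<forall>g. c g + d g \<in> A"
    by (simp_all add: distrib_right sum.distrib subring_add[OF assms(1)])
  then show ?thesis
    unfolding lin_span_def mem_Collect_eq by (intro exI[of _ "\<lambda>g. c g + d g"] conjI)
qed

lemma lin_span_smult:
  assumes "subring A ring_of_type_algebra" "a \<in> A" "x \<in> lin_span A G"
  shows "a * x \<in> lin_span A G"
proof -
  obtain c where "x = (\<Sum>g\<in>G. c g * g)" "\<forall>g. c g \<in> A"
    using assms by (auto simp: lin_span_def)
  then have "a * x = (\<Sum>g\<in>G. (a * c g) * g)" "\<forall>g. a * c g \<in> A"
    by (simp_all add: sum_distrib_left mult.assoc assms subring_mult[OF assms(1)])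
  then show ?thesis
    unfolding lin_span_def mem_Collect_eq by (intro exI[of _ "\<lambda>g. a * c g"] conjI)
qed

lemma lin_span_base:
  assumes "subring A ring_of_type_algebra" "finite G" "g \<in> G"
  shows "g \<in> lin_span A G"
proof -
  have "g = (\<Sum>h\<in>G. (if h = g then 1 else 0) * h)"
    using assms by (simp add: if_distrib[of "\<lambda>t. t * _"] cong: if_cong)
  moreover have "\<forall>h. (if h = g then 1 else 0) \<in> A"
    using assms by (auto intro: subring_one subring_zero)
  ultimately show ?thesis
    unfolding lin_span_def mem_Collect_eq by (intro exI[of _ "\<lambda>h. if h = g then 1 else 0"] conjI)
qed

lemma lin_span_zero:
  assumes "subring A ring_of_type_algebra"
  shows "0 \<in> lin_span A G"
  unfolding lin_span_def using subring_zero[OF assms] by (auto intro!: exI[of _ "\<lambda>_. 0"])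

lemma lin_span_sum:
  assumes "subring A ring_of_type_algebra" "\<And>i. i \<in> I \<Longrightarrow> f i \<in> lin_span A G"
  shows "sum f I \<in> lin_span A G"
  using assms(2)
  by (induction I rule: infinite_finite_induct)
    (auto intro: lin_span_add[OF assms(1)] lin_span_zero[OF assms(1)])

lemma lin_span_subset:
  assumes "subring A ring_of_type_algebra" "G \<subseteq> lin_span A H"
  shows "lin_span A G \<subseteq> lin_span A H"
proof
  fix x assume "x \<in> lin_span A G"
  then obtain c where "x = (\<Sum>g\<in>G. c g * g)" "\<forall>g. c g \<in> A"
    by (auto simp: lin_span_def)
  then show "x \<in> lin_span A H"
    using assms(2) by (auto intro!: lin_span_sum lin_span_smult assms(1))
qed

section \<open>Factorials and their prime factors p\<close>

lemma fact_add: "fact (a + r) = fact a * (\<Prod>i=1..r. a + i :: nat)"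
  by (induction r) (auto simp: algebra_simps)

text \<open>The factors lie strictly between the consecutive multiples \<open>p * k\<close> and
  \<open>p * (k + 1)\<close>.\<close>

lemma prime_not_dvd_prod:
  assumes "Factorial_Ring.prime (p::nat)" "r < p"
  shows "\<not> p dvd (\<Prod>i=1..r. p * k + i)"
proof
  assume "p dvd (\<Prod>i=1..r. p * k + i)"
  then obtain i where "1 \<le> i" "i \<le> r" "p dvd p * k + i"
    using assms(1) by (auto simp: prime_dvd_prod_iff)
  then have "p dvd i"
    by (metis dvd_add_right_iff dvd_triv_left)
  then show False
    using \<open>1 \<le> i\<close> \<open>i \<le> r\<close> assms(2) by (auto dest: dvd_imp_le)
qed

text \<open>One step of Legendre's formula: the multiples of p among the factors contribute
  \<open>p ^ k * fact k\<close>, and the others come in blocks of length \<open>p - 1\<close> prime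
  to p.\<close>

lemma fact_prime_mult:
  assumes "Factorial_Ring.prime (p::nat)"
  shows "\<exists>u. \<not> p dvd u \<and> fact (p * k) = p ^ k * fact k * u"
proof (induction k)
  case 0
  have "\<not> p dvd 1"
    using assms by auto
  then show ?case
    by auto
next
  case (Suc k)
  then obtain u where u: "\<not> p dvd u" "fact (p * k) = p ^ k * fact k * u"
    by auto
  let ?v = "\<Prod>i=1..p-1. p * k + i"
  have "p > 0"
    using assms by (simp add: prime_gt_0_nat)
  have "fact (p * Suc k) = fact (p * k + Suc (p - 1))"
    using \<open>p > 0\<close> by (simp add: algebra_simps)
  also have "\<dots> = fact (p * k) * ?v * (p * k + Suc (p - 1))"
    unfolding fact_add prod.cl_ivl_Suc by (simp add: algebra_simps)
  also have "p * k + Suc (p - 1) = p * Suc k"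
    using \<open>p > 0\<close> by simp
  also have "fact (p * k) * ?v * (p * Suc k) = p ^ Suc k * fact (Suc k) * (u * ?v)"
    unfolding u(2) by (simp add: algebra_simps)
  finally have "fact (p * Suc k) = p ^ Suc k * fact (Suc k) * (u * ?v)" .
  moreover have "\<not> p dvd u * ?v"
    using u(1) prime_not_dvd_prod[OF assms, of "p - 1" k] \<open>p > 0\<close> prime_dvd_mult_iff[OF assms]
    by auto
  ultimately show ?case
    by blast
qed

section \<open>\<open>W\<close> as a discrete valuation ring, and \<open>OK\<close> over
  \<open>W\<close>\<close>

context cyclotomic_base
begin

abbreviation OK :: "'f set" where
  "OK \<equiv> ring_of_integers W \<zeta>"

abbreviation pp :: 'f where
  "pp \<equiv> of_nat p"

lemma pp_nonzero: "pp \<noteq> 0"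
  using prime_p by (simp add: prime_gt_0_nat)

lemma OK_subring: "subring OK ring_of_type_algebra"
  unfolding ring_of_integers_def
  by (rule ring.generate_ring_is_subring[OF ring_from_type_algebra]) simp

lemmas W_closed = subring_closed[OF W_subring]
lemmas OK_closed = subring_closed[OF OK_subring]

lemma W_subset_OK: "W \<subseteq> OK"
  by (auto simp: ring_of_integers_def intro: generate_ring.incl)

lemma zeta_in_OK: "\<zeta> \<in> OK"
  by (auto simp: ring_of_integers_def intro: generate_ring.incl)

lemma W_separated:
  assumes "\<And>n. \<exists>y\<in>W. x = pp ^ n * y"
  shows "x = 0"
  by (rule adically_complete_separated[OF W_subring W_closed(8) W_complete assms])

lemma res_simps:
  "x \<in> W \<Longrightarrow> y \<in> W \<Longrightarrow> res (x + y) = res x + res y"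
  "x \<in> W \<Longrightarrow> y \<in> W \<Longrightarrow> res (x * y) = res x * res y"
  "res 1 = 1"
  "res 0 = 0"
proof -
  show add: "res (x + y) = res x + res y" if "x \<in> W" "y \<in> W" for x y
    using ring_hom_add[OF res_hom, of x y] that by simp
  show "res (x * y) = res x * res y" if "x \<in> W" "y \<in> W" for x y
    using ring_hom_mult[OF res_hom, of x y] that by simp
  show "res 1 = 1"
    using ring_hom_one[OF res_hom] by simp
  show "res 0 = 0"
    using add[of 0 0] W_closed(1) add_cancel_right_right[of "res 0" "res 0"] by simp
qed

lemma res_of_nat: "res (of_nat n) = of_nat n"
  by (induction n) (simp_all add: res_simps W_closed)

text \<open>A lift \<open>v\<close> of the inverse residue is an inverse only modulo p; the
  remaining factor \<open>1 - pp * t\<close> is inverted by a geometric series.\<close>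

lemma W_unit:
  assumes "w \<in> W" "res w \<noteq> 0"
  shows "inverse w \<in> W"
proof -
  obtain v where v: "v \<in> W" "res v = inverse (res w)"
    using res_surj by (metis UNIV_I imageE)
  have "res (w * v) = 1"
    using assms v by (simp add: res_simps)
  then have "res (1 - w * v) = 0"
    using res_simps(1)[of "1 - w * v" "w * v"] assms v by (simp add: res_simps W_closed)
  then have "1 - w * v \<in> {w \<in> W. res w = 0}"
    using assms v by (auto intro: W_closed)
  then obtain t where t: "t \<in> W" "1 - w * v = pp * t"
    unfolding res_kernel by auto
  obtain b where b: "b \<in> W" "(1 - pp * t) * b = 1"
    using adically_complete_geometric_series[OF W_subring W_closed(8) W_complete t(1)] by auto
  have "w * (v * b) = 1"
    using b(2) unfolding t(2)[symmetric] by (simp add: algebra_simps)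
  then have "inverse w = v * b"
    by (simp add: inverse_unique)
  then show ?thesis
    using v b by (simp add: W_closed)
qed

lemma of_nat_unit:
  assumes "\<not> p dvd n"
  shows "inverse (of_nat n) \<in> W"
  using assms char_k by (intro W_unit) (auto simp: W_closed res_of_nat of_nat_eq_0_iff_char_dvd)

text \<open>This makes p a uniformizer of \<open>W\<close>, with \<open>n\<close> the valuation of
  \<open>w\<close>. Separatedness makes the valuation finite.\<close>

lemma W_nonzeroE:
  assumes "w \<in> W" "w \<noteq> 0"
  obtains n u where "u \<in> W" "inverse u \<in> W" "w = pp ^ n * u"
proof -
  \<comment> \<open>\<open>P n\<close> says that \<open>pp ^ n\<close> does not divide
    \<open>w\<close>. The least such exponent is nonzero, and its predecessor \<open>m\<close> is
    the valuation.\<close>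
  define P where "P = (\<lambda>n. \<forall>y\<in>W. w \<noteq> pp ^ n * y)"
  have "\<exists>n. P n"
    using W_separated[of w] assms(2) unfolding P_def by blast
  then have P: "P (LEAST n. P n)"
    by (rule LeastI_ex)
  have "\<not> P 0"
    using assms(1) by (auto simp: P_def)
  then obtain m where m: "(LEAST n. P n) = Suc m"
    using P by (metis not0_implies_Suc)
  then have "\<not> P m"
    by (metis lessI not_less_Least)
  then obtain u where u: "u \<in> W" "w = pp ^ m * u"
    by (auto simp: P_def)
  have "res u \<noteq> 0"
  proof
    assume "res u = 0"
    then obtain v where "v \<in> W" "u = pp * v"
      using res_kernel u(1) by blast
    then have "\<not> P (Suc m)"
      using u(2) by (auto simp: P_def mult_ac)
    then show False
      using P m by simp
  qed
  then show ?thesis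
    using that u W_unit by blast
qed

text \<open>Since \<open>\<zeta> ^ p = 1\<close>, products of these powers stay in the list. The
  powers are dependent, with sum zero, so independence has to be obtained separately.\<close>

lemma OK_lin_span: "OK \<subseteq> lin_span W ((\<lambda>i. \<zeta> ^ i) ` {..<p})"
proof
  let ?G = "(\<lambda>i. \<zeta> ^ i) ` {..<p}"
  have power: "\<zeta> ^ i \<in> ?G" for i
  proof -
    have "\<zeta> ^ i = \<zeta> ^ (p * (i div p) + i mod p)"
      by simp
    also have "\<dots> = \<zeta> ^ (i mod p)"
      unfolding power_add power_mult by (simp add: zeta_primitive)
    finally show ?thesis
      using prime_p by (auto simp: prime_gt_0_nat)
  qed
  have base: "\<zeta> ^ i \<in> lin_span W ?G" for i
    by (intro lin_span_base W_subring power) simp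
  fix x
  assume "x \<in> OK"
  then show "x \<in> lin_span W ?G"
    unfolding ring_of_integers_def
  proof induction
    case one
    then show ?case
      using base[of 0] by simp
  next
    case (incl h)
    then show ?case
      using base[of 1] lin_span_smult[OF W_subring _ base[of 0], of h] by auto
  next
    case (a_inv h)
    then show ?case
      using lin_span_smult[OF W_subring W_closed(5)[OF W_closed(2)]] by fastforce
  next
    case (eng_add x y)
    then show ?case
      by (simp add: lin_span_add W_subring)
  next
    case (eng_mult x y)
    then obtain c d where c: "x = (\<Sum>g\<in>?G. c g * g)" "\<forall>g. c g \<in> W"
      and d: "y = (\<Sum>g\<in>?G. d g * g)" "\<forall>g. d g \<in> W"
      unfolding lin_span_def by blast
    have "x * y = (\<Sum>g\<in>?G. \<Sum>h\<in>?G. c g * (d h * (g * h)))"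
      by (simp add: c(1) d(1) sum_product mult_ac)
    also have "\<dots> \<in> lin_span W ?G"
    proof (intro lin_span_sum W_subring)
      fix g h
      assume "g \<in> ?G" "h \<in> ?G"
      then obtain i k where "g = \<zeta> ^ i" "h = \<zeta> ^ k"
        by auto
      then have "g * h \<in> lin_span W ?G"
        using base[of "i + k"] by (simp add: power_add)
      then show "c g * (d h * (g * h)) \<in> lin_span W ?G"
        using c(2) d(2) by (simp add: lin_span_smult W_subring)
    qed
    finally show ?case
      by simp
  qed
qed

text \<open>A generating set of minimal cardinality is a basis: in a relation with a coefficient outside
  \<open>p W\<close>, this coefficient is a unit, and a generator can be removed.\<close>

lemma OK_basis:
  "\<exists>G. finite G \<and> OK \<subseteq> lin_span W G \<and>
     (\<forall>c. (\<forall>g. c g \<in> W) \<longrightarrow> (\<Sum>g\<in>G. c g * g) = 0 \<longrightarrow> (\<forall>g\<in>G. c g = 0))"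
proof -
  define P where "P = (\<lambda>G. finite G \<and> OK \<subseteq> lin_span W G)"
  have "P ((\<lambda>i. \<zeta> ^ i) ` {..<p})"
    using OK_lin_span by (simp add: P_def)
  then obtain G where G: "P G" "\<And>H. P H \<Longrightarrow> card G \<le> card H"
    using ex_has_least_nat[of P _ card] by blast
  have fin: "finite G"
    using G(1) by (simp add: P_def)
  have nonunit: "res (c g) = 0"
    if c: "\<And>g. c g \<in> W" "(\<Sum>g\<in>G. c g * g) = 0" and g: "g \<in> G" for c g
  proof (rule ccontr)
    assume nz: "res (c g) \<noteq> 0"
    then have inv: "inverse (c g) \<in> W" and "c g \<noteq> 0"
      using W_unit c(1) res_simps(4) by auto
    have "c g * g + (\<Sum>h\<in>G - {g}. c h * h) = 0"
      using c(2) g fin by (simp add: sum.remove)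
    then have "c g * g = - (\<Sum>h\<in>G - {g}. c h * h)"
      by (simp add: eq_neg_iff_add_eq_0)
    then have "g = - inverse (c g) * (\<Sum>h\<in>G - {g}. c h * h)"
      using \<open>c g \<noteq> 0\<close> by (simp add: field_simps)
    moreover have "(\<Sum>h\<in>G - {g}. c h * h) \<in> lin_span W (G - {g})"
      using c(1) by (auto simp: lin_span_def)
    ultimately have "g \<in> lin_span W (G - {g})"
      using lin_span_smult[OF W_subring W_closed(5)[OF inv]] by metis
    moreover have "h \<in> lin_span W (G - {g})" if "h \<in> G" "h \<noteq> g" for h
      using that fin by (intro lin_span_base W_subring) auto
    ultimately have "lin_span W G \<subseteq> lin_span W (G - {g})"
      by (intro lin_span_subset W_subring) blast
    then have "P (G - {g})"
      using G(1) by (auto simp: P_def)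
    then have "card G \<le> card (G - {g})"
      by (rule G(2))
    then show False
      using fin g by (metis card_Diff1_less not_le)
  qed
  \<comment> \<open>By \<open>nonunit\<close> all coefficients of a relation are multiples of p, and
    dividing by p leaves a relation because K has characteristic zero. Iterating makes every
    coefficient divisible by all powers of p, hence zero.\<close>
  have divisible: "\<exists>d. (\<forall>g. d g \<in> W) \<and> (\<forall>g\<in>G. c g = pp ^ n * d g) \<and> (\<Sum>g\<in>G. d g * g) = 0"
    if "\<And>g. c g \<in> W" "(\<Sum>g\<in>G. c g * g) = 0" for n c
  proof (induction n)
    case 0
    then show ?case
      using that by auto
  next
    case (Suc n)
    then obtain d where d: "\<And>g. d g \<in> W" "\<And>g. g \<in> G \<Longrightarrow> c g = pp ^ n * d g" "(\<Sum>g\<in>G. d g * g) = 0"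
      by blast
    have "\<exists>t. t \<in> W \<and> (g \<in> G \<longrightarrow> d g = pp * t)" for g
    proof (cases "g \<in> G")
      case True
      then have "d g \<in> {w \<in> W. res w = 0}"
        using nonunit[OF d(1,3)] d(1) by simp
      then show ?thesis
        unfolding res_kernel by auto
    qed (auto intro: W_closed(1))
    then obtain e where e: "\<And>g. e g \<in> W" "\<And>g. g \<in> G \<Longrightarrow> d g = pp * e g"
      by metis
    have "pp * (\<Sum>g\<in>G. e g * g) = (\<Sum>g\<in>G. d g * g)"
      by (simp add: sum_distrib_left e(2) mult.assoc)
    then have "(\<Sum>g\<in>G. e g * g) = 0"
      using d(3) pp_nonzero by simp
    then show ?case
      using e d(2) by (intro exI[of _ e]) (auto simp: mult_ac)
  qed
  have "\<forall>g\<in>G. c g = 0" if "\<And>g. c g \<in> W" "(\<Sum>g\<in>G. c g * g) = 0" for c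
    using divisible[OF that] W_separated by metis
  then show ?thesis
    using G(1) unfolding P_def by blast
qed

text \<open>Coordinates in an independent family over \<open>W\<close> are unique, so divisibility
  of \<open>x\<close> by all powers of p passes to each coordinate, where \<open>W_separated\<close>
  applies.\<close>

lemma OK_separated:
  assumes "\<And>n. \<exists>y\<in>OK. x = pp ^ n * y"
  shows "x = 0"
proof -
  obtain G where G: "finite G" "OK \<subseteq> lin_span W G"
    "\<And>c. (\<And>g. c g \<in> W) \<Longrightarrow> (\<Sum>g\<in>G. c g * g) = 0 \<Longrightarrow> \<forall>g\<in>G. c g = 0"
    using OK_basis by metis
  have "x \<in> lin_span W G"
    using assms[of 0] G(2) by auto
  then obtain a where a: "x = (\<Sum>g\<in>G. a g * g)" "\<And>g. a g \<in> W"
    by (auto simp: lin_span_def)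
  have "a g = 0" if "g \<in> G" for g
  proof (rule W_separated)
    fix n
    obtain y where y: "y \<in> OK" "x = pp ^ n * y"
      using assms by blast
    then have "y \<in> lin_span W G"
      using G(2) by blast
    then obtain b where b: "y = (\<Sum>g\<in>G. b g * g)" "\<And>g. b g \<in> W"
      by (auto simp: lin_span_def)
    have "(\<Sum>g\<in>G. (a g - pp ^ n * b g) * g) = x - pp ^ n * y"
      unfolding a(1) b(1) by (simp add: left_diff_distrib sum_subtractf sum_distrib_left mult.assoc)
    then have "(\<Sum>g\<in>G. (a g - pp ^ n * b g) * g) = 0"
      by (simp only: y(2)[symmetric] diff_self)
    then have "a g - pp ^ n * b g = 0"
      by (rule G(3)[THEN bspec, OF _ _ that, rotated]) (intro W_closed a(2) b(2))
    then show "\<exists>y\<in>W. a g = pp ^ n * y"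
      using b(2) by auto
  qed
  then show ?thesis
    by (simp add: a(1))
qed

text \<open>The field K is \<open>OK\<close> with p inverted. Nonzero elements of \<open>W\<close>
  being powers of p times units, \<open>F\<close>, which is \<open>W\<close> with p inverted, is
  already a field. Adjoining the algebraic element \<open>\<zeta>\<close> then takes only
  polynomials in \<open>\<zeta>\<close> over \<open>F\<close>, with powers of p as
  denominators.\<close>

lemma OK_fraction: "\<exists>n. pp ^ n * x \<in> OK"
proof -
  interpret K: Ring.field "ring_of_type_algebra :: 'f ring"
    by (rule field_from_type_algebra)
  define F where "F = {x. \<exists>n. pp ^ n * x \<in> W}"
  have "subfield F ring_of_type_algebra"
  proof (rule K.subfieldI')
    show "subring F ring_of_type_algebra"
    proof (rule K.subringI)
      show "\<one>\<^bsub>ring_of_type_algebra\<^esub> \<in> F"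
        by (auto simp: F_def intro!: exI[of _ 0] W_closed)
      fix x y
      assume "x \<in> F" "y \<in> F"
      then obtain n m where nm: "pp ^ n * x \<in> W" "pp ^ m * y \<in> W"
        by (auto simp: F_def)
      show "\<ominus>\<^bsub>ring_of_type_algebra\<^esub> x \<in> F"
        using W_closed(5)[OF nm(1)] by (auto simp: F_def)
      show "x \<otimes>\<^bsub>ring_of_type_algebra\<^esub> y \<in> F"
        using W_closed(4)[OF nm] by (auto simp del: mult_eq_0_iff simp: F_def power_add ac_simps intro!: exI[of _ "n + m"])
      have "pp ^ m * (pp ^ n * x) + pp ^ n * (pp ^ m * y) \<in> W"
        using nm by (simp add: W_closed)
      then show "x \<oplus>\<^bsub>ring_of_type_algebra\<^esub> y \<in> F"
        by (auto simp: F_def power_add algebra_simps intro!: exI[of _ "n + m"])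
    qed auto
    fix x
    assume "x \<in> F - {\<zero>\<^bsub>ring_of_type_algebra\<^esub>}"
    then obtain n where n: "pp ^ n * x \<in> W" "x \<noteq> 0"
      by (auto simp: F_def)
    then have "pp ^ n * x \<noteq> 0"
      using pp_nonzero by simp
    with n(1) obtain m u where u: "u \<in> W" "inverse u \<in> W" "pp ^ n * x = pp ^ m * u"
      by (rule W_nonzeroE)
    then have "pp ^ m * inverse x = pp ^ n * inverse u"
      using n(2) pp_nonzero by (auto simp: field_simps)
    also have "\<dots> \<in> W"
      using u by (intro W_closed)
    finally show "inv\<^bsub>ring_of_type_algebra\<^esub> x \<in> F"
      using n(2) by (auto simp: F_def type_algebra_inv)
  qed
  note F = this subfieldE(1)[OF this]
  \<comment> \<open>Coefficient lists start with the leading term: this is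
    \<open>X ^ p - 1\<close>.\<close>
  let ?f = "1 # replicate (p - 1) 0 @ [- 1 :: 'f]"
  have "(K.algebraic over F) \<zeta>"
  proof (rule K.algebraicI)
    show "?f \<in> carrier (F[X]\<^bsub>ring_of_type_algebra\<^esub>)"
      using subring_closed[OF F(2)] by (auto simp: univ_poly_def polynomial_def)
    have "p > 0"
      using prime_p by (simp add: prime_gt_0_nat)
    have "K.eval (replicate n 0 @ [- 1]) \<zeta> = - 1" for n
      by (induction n) auto
    then show "K.eval ?f \<zeta> = \<zero>\<^bsub>ring_of_type_algebra\<^esub>"
      using \<open>p > 0\<close> by (simp add: zeta_primitive)
  qed simp
  then have "subfield (K.simple_extension F \<zeta>) ring_of_type_algebra"
    using K.simple_extension_is_subfield[OF F(1)] by simp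
  moreover have "W \<subseteq> F"
    by (auto simp: F_def intro!: exI[of _ 0])
  then have "W \<union> {\<zeta>} \<subseteq> K.simple_extension F \<zeta>"
    using K.simple_extension_incl[of F \<zeta>] K.simple_extension_mem[OF F(2), of \<zeta>] by auto
  ultimately have "UNIV \<subseteq> K.simple_extension F \<zeta>"
    unfolding K_generated[symmetric] by (intro K.generate_field_min_subfield1) auto
  then have "x \<in> K.simple_extension F \<zeta>"
    by blast
  then show ?thesis
  proof induction
    case zero
    then show ?case
      by (simp add: OK_closed)
  next
    case (lin x y)
    then obtain n m where nm: "pp ^ n * x \<in> OK" "pp ^ m * y \<in> OK"
      using W_subset_OK by (auto simp: F_def)
    have "pp ^ m * (pp ^ n * x * \<zeta>) + pp ^ n * (pp ^ m * y) \<in> OK"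
      using nm zeta_in_OK by (simp add: OK_closed)
    then show ?case
      by (auto simp: power_add algebra_simps intro!: exI[of _ "n + m"])
  qed
qed

section \<open>The p-adic size of the powers of \<open>\<zeta> - 1\<close>\<close>

lemma sum_zeta_powers: "(\<Sum>i<p. \<zeta> ^ i) = 0"
  using power_diff_1_eq[of \<zeta> p] zeta_primitive by simp

text \<open>Subtracting the relation \<open>sum_zeta_powers\<close> from p leaves a sum of terms
  \<open>1 - \<zeta> ^ i\<close>, each a multiple of \<open>\<zeta> - 1\<close>.\<close>

lemma p_multiple: "\<exists>a\<in>OK. pp = (\<zeta> - 1) * a"
proof
  have "pp = (\<Sum>i<p. 1 - \<zeta> ^ i)"
    by (simp add: sum_subtractf sum_zeta_powers)
  also have "\<dots> = (\<Sum>i<p. (\<zeta> - 1) * - (\<Sum>k<i. \<zeta> ^ k))"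
    by (intro sum.cong refl) (simp add: one_diff_power_eq algebra_simps)
  also have "\<dots> = (\<zeta> - 1) * (\<Sum>i<p. - (\<Sum>k<i. \<zeta> ^ k))"
    by (simp only: sum_distrib_left)
  finally show "pp = (\<zeta> - 1) * (\<Sum>i<p. - (\<Sum>k<i. \<zeta> ^ k))" .
  show "(\<Sum>i<p. - (\<Sum>k<i. \<zeta> ^ k)) \<in> OK"
    by (intro OK_closed zeta_in_OK)
qed

text \<open>Expand \<open>((\<zeta> - 1) + 1) ^ p = 1\<close> and divide by
  \<open>\<zeta> - 1\<close>. Apart from the last term, which is the power in question, every term
  carries a binomial coefficient divisible by p.\<close>

lemma zeta_minus_one_power: "\<exists>a\<in>OK. (\<zeta> - 1) ^ (p - 1) = pp * a"
proof
  have "p > 0"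
    using prime_p by (simp add: prime_gt_0_nat)
  have "1 = (\<zeta> - 1 + 1) ^ p"
    by (simp add: zeta_primitive)
  also have "\<dots> = (\<Sum>i\<le>p. of_nat (p choose i) * (\<zeta> - 1) ^ i)"
    unfolding binomial_ring by simp
  also have "\<dots> = 1 + (\<Sum>i<p. of_nat (p choose Suc i) * (\<zeta> - 1) ^ Suc i)"
    by (simp add: sum.atMost_shift)
  finally have "(\<zeta> - 1) * (\<Sum>i<p. of_nat (p choose Suc i) * (\<zeta> - 1) ^ i) = 0"
    by (simp add: sum_distrib_left mult_ac)
  then have "(\<Sum>i<Suc (p - 1). of_nat (p choose Suc i) * (\<zeta> - 1) ^ i) = 0"
    using zeta_primitive \<open>p > 0\<close> by simp
  then have "(\<zeta> - 1) ^ (p - 1) = - (\<Sum>i<p - 1. of_nat (p choose Suc i) * (\<zeta> - 1) ^ i)"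
    unfolding sum.lessThan_Suc using \<open>p > 0\<close> by (simp add: eq_neg_iff_add_eq_0 add.commute)
  also have "(\<Sum>i<p - 1. of_nat (p choose Suc i) * (\<zeta> - 1) ^ i)
      = (\<Sum>i<p - 1. pp * (of_nat ((p choose Suc i) div p) * (\<zeta> - 1) ^ i))"
  proof (intro sum.cong refl)
    fix i
    assume "i \<in> {..<p - 1}"
    then have "p dvd (p choose Suc i)"
      using prime_p by (intro dvd_choose_prime) auto
    then have "of_nat (p choose Suc i) = pp * (of_nat ((p choose Suc i) div p) :: 'f)"
      by (metis dvd_mult_div_cancel of_nat_mult)
    then show "of_nat (p choose Suc i) * (\<zeta> - 1) ^ i
        = pp * (of_nat ((p choose Suc i) div p) * (\<zeta> - 1) ^ i)"
      by (simp add: mult.assoc)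
  qed
  finally show "(\<zeta> - 1) ^ (p - 1)
      = pp * - (\<Sum>i<p - 1. of_nat ((p choose Suc i) div p) * (\<zeta> - 1) ^ i)"
    by (simp add: sum_distrib_left)
  show "- (\<Sum>i<p - 1. of_nat ((p choose Suc i) div p) * (\<zeta> - 1) ^ i) \<in> OK"
    by (intro OK_closed zeta_in_OK)
qed

text \<open>Write \<open>n = p * k + r\<close>; up to a unit, \<open>fact n\<close> is
  \<open>pp ^ k * fact k\<close>. Of the \<open>(p - 1) * k + k + r\<close> factors
  \<open>\<zeta> - 1\<close>, the first group absorbs \<open>pp ^ k\<close> by
  \<open>zeta_minus_one_power\<close>, the second absorbs \<open>fact k\<close> by induction, and
  the last is left over.\<close>

lemma zeta_minus_one_power_div_fact: "(\<zeta> - 1) ^ n / fact n \<in> OK"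
proof (induction n rule: less_induct)
  case (less n)
  have "p > 1"
    by (rule prime_gt_1_nat[OF prime_p])
  show ?case
  proof (cases "n = 0")
    case False
    define k r where "k = n div p" and "r = n mod p"
    have n: "n = p * k + r" and "r < p"
      using \<open>p > 1\<close> by (auto simp: k_def r_def)
    have "k < n"
      using False \<open>p > 1\<close> by (simp add: k_def)
    obtain u where u: "\<not> p dvd u" "fact (p * k) = p ^ k * fact k * u"
      using fact_prime_mult[OF prime_p] by blast
    let ?v = "\<Prod>i=1..r. p * k + i"
    have "(fact n :: nat) = p ^ k * fact k * (u * ?v)"
      unfolding n fact_add u by simp
    then have "(of_nat (fact n) :: 'f) = of_nat (p ^ k * fact k * (u * ?v))"
      by (rule arg_cong)
    then have fact_n: "(fact n :: 'f) = pp ^ k * fact k * of_nat (u * ?v)"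
      by simp
    have "\<not> p dvd u * ?v"
      using u(1) prime_not_dvd_prod[OF prime_p \<open>r < p\<close>] prime_dvd_mult_iff[OF prime_p] by auto
    then have unit: "inverse (of_nat (u * ?v)) \<in> OK"
      using of_nat_unit W_subset_OK by blast
    obtain a where a: "a \<in> OK" "(\<zeta> - 1) ^ (p - 1) = pp * a"
      using zeta_minus_one_power by blast
    have "n = (p - 1) * k + k + r"
      using \<open>p > 1\<close> n by (cases p) auto
    then have "(\<zeta> - 1) ^ n = ((\<zeta> - 1) ^ (p - 1)) ^ k * (\<zeta> - 1) ^ k * (\<zeta> - 1) ^ r"
      by (simp only: power_add power_mult)
    then have "(\<zeta> - 1) ^ n = (pp * a) ^ k * (\<zeta> - 1) ^ k * (\<zeta> - 1) ^ r"
      unfolding a(2) .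
    then have "(\<zeta> - 1) ^ n / fact n
        = a ^ k * ((\<zeta> - 1) ^ k / fact k) * (\<zeta> - 1) ^ r * inverse (of_nat (u * ?v))"
      unfolding fact_n using pp_nonzero by (simp add: divide_simps power_mult_distrib)
    also have "\<dots> \<in> OK"
      using less.IH[OF \<open>k < n\<close>] a(1) unit zeta_in_OK by (intro OK_closed)
    finally show ?thesis .
  qed (simp add: OK_closed)
qed

text \<open>As p is a multiple of \<open>\<zeta> - 1\<close>, the factor \<open>pp ^ t\<close>
  restores the factors missing from the numerator. Subtraction is truncated, so for
  \<open>n < t\<close> an integral excess \<open>(\<zeta> - 1) ^ (t - n)\<close> remains.\<close>

lemma p_power_zeta_minus_one_power_div_fact:
  "pp ^ t * (\<zeta> - 1) ^ (n - t) / fact n \<in> OK"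
proof -
  obtain a where a: "a \<in> OK" "pp = (\<zeta> - 1) * a"
    using p_multiple by blast
  have "t + (n - t) = n + (t - n)"
    by simp
  then have "(\<zeta> - 1) ^ t * (\<zeta> - 1) ^ (n - t) = (\<zeta> - 1) ^ n * (\<zeta> - 1) ^ (t - n)"
    by (simp only: power_add[symmetric])
  then have "pp ^ t * (\<zeta> - 1) ^ (n - t) / fact n
      = a ^ t * ((\<zeta> - 1) ^ n / fact n) * (\<zeta> - 1) ^ (t - n)"
    by (simp add: a(2) power_mult_distrib)
  also have "\<dots> \<in> OK"
    using a(1) by (intro OK_closed zeta_minus_one_power_div_fact zeta_in_OK)
  finally show ?thesis .
qed

end

section \<open>The topological rings \<open>S\<close> and \<open>T\<close>\<close>

lemma fps_nth_of_nat_power_mult [simp]: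
  "fps_nth (of_nat p ^ N * f) i = of_nat p ^ N * (fps_nth f i :: 'a::comm_ring_1)"
proof -
  have "of_nat p ^ N * f = fps_const (of_nat p ^ N) * f"
    by (simp only: fps_of_nat fps_const_power[symmetric])
  then show ?thesis
    by simp
qed

text \<open>The product of \<open>T_ring\<close> is the product of exponential generating functions.\<close>

definition egf :: "(nat \<Rightarrow> 'f::field_char_0 fps) \<Rightarrow> 'f fps fps" where
  "egf f = Abs_fps (\<lambda>n. fps_const (inverse (fact n)) * f n)"

lemma egf_inject: "egf f = egf g \<longleftrightarrow> f = g"
proof
  assume *: "egf f = egf g"
  show "f = g"
  proof
    fix n
    have "fps_const (fact n) * fps_nth (egf f) n = fps_const (fact n) * fps_nth (egf g) n"
      using * by simp
    moreover have "fps_const (fact n) * (fps_const (inverse (fact n)) * h) = h" for h :: "'a fps"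
      by (simp add: mult.assoc[symmetric])
    ultimately show "f n = g n"
      by (simp add: egf_def)
  qed
qed simp

lemma egf_binomial_convolution:
  "egf (\<lambda>n. \<Sum>i\<le>n. of_nat (n choose i) * f i * g (n - i)) = egf f * egf g"
proof (rule fps_ext)
  fix n
  have "fps_const (inverse (fact n)) * (of_nat (n choose i) * f i * g (n - i))
      = fps_const (inverse (fact i)) * f i * (fps_const (inverse (fact (n - i))) * g (n - i))"
    if "i \<le> n" for i
  proof -
    have "inverse (fact n) * of_nat (n choose i) = (inverse (fact i) * inverse (fact (n - i)) :: 'a)"
      using that by (simp add: binomial_fact field_simps)
    then have "fps_const (inverse (fact n)) * of_nat (n choose i)
        = fps_const (inverse (fact i)) * (fps_const (inverse (fact (n - i))) :: 'a fps)"
      by (simp add: fps_of_nat[symmetric])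
    then show ?thesis
      by (metis (no_types, opaque_lifting) mult.assoc mult.commute)
  qed
  then show "fps_nth (egf (\<lambda>n. \<Sum>i\<le>n. of_nat (n choose i) * f i * g (n - i))) n
      = fps_nth (egf f * egf g) n"
    unfolding egf_def fps_mult_nth fps_nth_Abs_fps sum_distrib_left atMost_atLeast0
    by (intro sum.cong) auto
qed

lemma T_ring_simps [simp]:
  "\<one>\<^bsub>T_ring p OK\<^esub> = (\<lambda>n. if n = 0 then 1 else 0)"
  "\<zero>\<^bsub>T_ring p OK\<^esub> = (\<lambda>n. 0)"
  "f \<oplus>\<^bsub>T_ring p OK\<^esub> g = (\<lambda>n. f n + g n)"
  by (simp_all add: T_ring_def)

lemma T_ring_mult:
  "f \<otimes>\<^bsub>T_ring p OK\<^esub> g = (\<lambda>n. \<Sum>i\<le>n. of_nat (n choose i) * f i * g (n - i))"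
  by (simp add: T_ring_def)

lemma egf_T_ring:
  "egf (f \<otimes>\<^bsub>T_ring p OK\<^esub> g) = egf f * egf g"
  "egf (f \<oplus>\<^bsub>T_ring p OK\<^esub> g) = egf f + egf g"
  "egf \<one>\<^bsub>T_ring p OK\<^esub> = 1"
  unfolding T_ring_mult egf_binomial_convolution
  by (auto simp: egf_def fps_eq_iff algebra_simps)

lemma S_to_T_mult [simp]: "S_to_T s \<otimes>\<^bsub>T_ring p OK\<^esub> f = (\<lambda>n. s * f n)"
proof
  fix n
  have "(\<Sum>i\<le>n. of_nat (n choose i) * S_to_T s i * f (n - i))
      = (\<Sum>i\<le>n. if i = 0 then s * f n else 0)"
    by (intro sum.cong) (auto simp: S_to_T_def)
  then show "(S_to_T s \<otimes>\<^bsub>T_ring p OK\<^esub> f) n = s * f n"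
    by (simp add: T_ring_mult)
qed

section \<open>The topology of \<open>S\<close>, coefficient by coefficient\<close>

context cyclotomic_base
begin

abbreviation OK_multiples :: "nat \<Rightarrow> 'f set" where
  "OK_multiples a \<equiv> {pp ^ a * c |c. c \<in> OK}"

lemma OK_multiples_closed:
  "0 \<in> OK_multiples a"
  "x \<in> OK_multiples a \<Longrightarrow> y \<in> OK_multiples a \<Longrightarrow> x + y \<in> OK_multiples a"
  "x \<in> OK_multiples a \<Longrightarrow> y \<in> OK_multiples a \<Longrightarrow> x - y \<in> OK_multiples a"
  "x \<in> OK_multiples a \<Longrightarrow> y \<in> OK_multiples b \<Longrightarrow> x * y \<in> OK_multiples (a + b)"
proof -
  show "0 \<in> OK_multiples a"
    using OK_closed(1) by (metis (mono_tags, lifting) mem_Collect_eq mult_zero_right)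
  show "x + y \<in> OK_multiples a" if "x \<in> OK_multiples a" "y \<in> OK_multiples a"
    using that OK_closed(3) by (auto simp: distrib_left[symmetric])
  show "x - y \<in> OK_multiples a" if "x \<in> OK_multiples a" "y \<in> OK_multiples a"
    using that OK_closed(6) by (auto simp: right_diff_distrib[symmetric])
  assume "x \<in> OK_multiples a" "y \<in> OK_multiples b"
  then obtain c d where "x = pp ^ a * c" "y = pp ^ b * d" "c \<in> OK" "d \<in> OK"
    by blast
  then have "x * y = pp ^ (a + b) * (c * d)" "c * d \<in> OK"
    by (simp_all add: power_add OK_closed)
  then show "x * y \<in> OK_multiples (a + b)"
    by blast
qed

lemma OK_multiples_sum:
  "(\<And>i. i \<in> I \<Longrightarrow> f i \<in> OK_multiples a) \<Longrightarrow> sum f I \<in> OK_multiples a"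
  by (induction I rule: infinite_finite_induct) (simp_all only: sum.infinite sum.empty sum.insert
      OK_multiples_closed insert_iff simp_thms)

text \<open>This is the basic neighborhood \<open>p ^ a OK[[X]] + X ^ m S\<close>: the coefficients
  from index \<open>m\<close> on are free.\<close>

definition nbhd :: "nat \<Rightarrow> nat \<Rightarrow> 'f fps set" where
  "nbhd a m = {f. \<forall>i<m. fps_nth f i \<in> OK_multiples a}"

lemma nbhdI: "(\<And>i. i < m \<Longrightarrow> \<exists>c\<in>OK. fps_nth f i = pp ^ a * c) \<Longrightarrow> f \<in> nbhd a m"
  by (auto simp: nbhd_def)

lemma nbhdD: "f \<in> nbhd a m \<Longrightarrow> i < m \<Longrightarrow> \<exists>c\<in>OK. fps_nth f i = pp ^ a * c"
  by (auto simp: nbhd_def)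

lemma S_nbhds_eq: "S_nbhds p OK = {nbhd a m |a m. True}"
proof -
  have "{of_nat p ^ n * a + fps_X ^ m * b |a b. \<forall>i. fps_nth a i \<in> OK} = nbhd n m"
    (is "?L n m = _") for n m
  proof (rule subset_antisym; rule subsetI)
    fix f
    assume "f \<in> ?L n m"
    then show "f \<in> nbhd n m"
      by (auto simp: nbhd_def fps_X_power_mult_nth)
  next
    fix f
    assume "f \<in> nbhd n m"
    then have "\<forall>i. \<exists>c. c \<in> OK \<and> (i < m \<longrightarrow> fps_nth f i = pp ^ n * c)"
      using OK_closed(1) by (auto simp: nbhd_def)
    then obtain c where c: "\<And>i. c i \<in> OK" "\<And>i. i < m \<Longrightarrow> fps_nth f i = pp ^ n * c i"
      by metis
    let ?a = "Abs_fps (\<lambda>i. if i < m then c i else 0)"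
    have "f = of_nat p ^ n * ?a + fps_X ^ m * fps_shift m f"
      by (auto simp: fps_eq_iff fps_X_power_mult_nth c(2))
    moreover have "\<forall>i. fps_nth ?a i \<in> OK"
      by (simp add: c(1) OK_closed)
    ultimately show "f \<in> ?L n m"
      by blast
  qed
  then show ?thesis
    unfolding S_nbhds_def by auto
qed

lemma nbhd_closed:
  "0 \<in> nbhd a m"
  "f \<in> nbhd a m \<Longrightarrow> g \<in> nbhd a m \<Longrightarrow> f + g \<in> nbhd a m"
  "f \<in> nbhd a m \<Longrightarrow> g \<in> nbhd a m \<Longrightarrow> f - g \<in> nbhd a m"
  "f \<in> nbhd a m \<Longrightarrow> g \<in> nbhd b m \<Longrightarrow> f * g \<in> nbhd (a + b) m"
proof -
  have nbhd_iff: "f \<in> nbhd a m \<longleftrightarrow> (\<forall>i<m. fps_nth f i \<in> OK_multiples a)" for f a m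
    by (simp add: nbhd_def)
  show "0 \<in> nbhd a m"
    unfolding nbhd_iff fps_zero_nth using OK_multiples_closed(1) by (intro allI impI)
  show "f + g \<in> nbhd a m" if "f \<in> nbhd a m" "g \<in> nbhd a m"
    using that unfolding nbhd_iff fps_add_nth
    by (intro allI impI OK_multiples_closed(2)) (simp_all only:)
  show "f - g \<in> nbhd a m" if "f \<in> nbhd a m" "g \<in> nbhd a m"
    using that unfolding nbhd_iff fps_sub_nth
    by (intro allI impI OK_multiples_closed(3)) (simp_all only:)
  show "f * g \<in> nbhd (a + b) m" if "f \<in> nbhd a m" "g \<in> nbhd b m"
    unfolding nbhd_iff fps_mult_nth
  proof (intro allI impI OK_multiples_sum OK_multiples_closed(4))
    fix i k
    assume "i < m" "k \<in> {0..i}"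
    then have "k < m" "i - k < m"
      by auto
    then show "fps_nth f k \<in> OK_multiples a" "fps_nth g (i - k) \<in> OK_multiples b"
      using that unfolding nbhd_iff by (simp_all only:)
  qed
qed

lemma nbhd_minus: "f \<in> nbhd a m \<Longrightarrow> - f \<in> nbhd a m"
  using nbhd_closed(3)[OF nbhd_closed(1), of f] by simp

lemma nbhd_sum: "(\<And>i. i \<in> I \<Longrightarrow> f i \<in> nbhd a m) \<Longrightarrow> sum f I \<in> nbhd a m"
  by (induction I rule: infinite_finite_induct) (auto intro: nbhd_closed)

text \<open>Each coefficient is divisible by all powers of p, so \<open>OK_separated\<close>
  applies; limits in \<open>S\<close> are thus unique.\<close>

lemma nbhd_separated:
  assumes "\<And>a m. f \<in> nbhd a m"
  shows "f = 0"
proof (rule fps_ext)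
  fix i
  have "fps_nth f i \<in> OK_multiples a" for a
    using assms[of a "Suc i"] by (simp add: nbhd_def)
  then have "fps_nth f i = 0"
    by (intro OK_separated) blast
  then show "fps_nth f i = fps_nth 0 i"
    by simp
qed

lemma integral_in_nbhd: "(\<And>i. fps_nth f i \<in> OK) \<Longrightarrow> f \<in> nbhd 0 m"
  by (simp add: nbhd_def)

lemma of_nat_in_nbhd: "of_nat n \<in> nbhd 0 m"
  by (intro integral_in_nbhd) (simp add: fps_of_nat[symmetric] OK_closed)

text \<open>In the following, \<open>of_nat p ^ N * f \<in> nbhd 0 m\<close> says that \<open>f\<close> is integral
  up to a denominator \<open>p ^ N\<close> modulo \<open>fps_X ^ m\<close>.\<close>

lemma nbhd_mult_bounded:
  assumes "of_nat p ^ N * f \<in> nbhd 0 m" "g \<in> nbhd (a + N) m"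
  shows "f * g \<in> nbhd a m"
proof -
  have "of_nat p ^ N * (f * g) \<in> nbhd (a + N) m"
    using nbhd_closed(4)[OF assms] by (simp add: mult.assoc)
  note * = nbhdD[OF this, unfolded fps_nth_of_nat_power_mult]
  show ?thesis
  proof (rule nbhdI)
    fix i
    assume "i < m"
    then obtain c where c: "c \<in> OK" "pp ^ N * fps_nth (f * g) i = pp ^ (a + N) * c"
      using * by blast
    have "pp ^ N * fps_nth (f * g) i = pp ^ N * (pp ^ a * c)"
      unfolding c(2) by (simp add: power_add)
    then have "fps_nth (f * g) i = pp ^ a * c"
      using pp_nonzero by (simp only: mult_cancel_left power_eq_0_iff) simp
    with c(1) show "\<exists>c\<in>OK. fps_nth (f * g) i = pp ^ a * c"
      by blast
  qed
qed

lemma bounded_mono: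
  assumes "of_nat p ^ N * f \<in> nbhd 0 m" "N \<le> N'"
  shows "of_nat p ^ N' * f \<in> nbhd 0 m"
proof -
  have "of_nat p ^ (N' - N) * (of_nat p ^ N * f) \<in> nbhd (0 + 0) m"
    by (intro nbhd_closed(4) assms(1))
      (simp only: of_nat_power[symmetric] of_nat_in_nbhd)
  then show ?thesis
    using assms(2) by (simp add: mult.assoc[symmetric] power_add[symmetric])
qed

text \<open>Each coefficient has a power of p as denominator, and only \<open>m\<close> of them
  count; the exponent may grow with \<open>m\<close>.\<close>

lemma ex_bounded: "\<exists>N. of_nat p ^ N * f \<in> nbhd 0 m"
proof (induction m)
  case 0
  then show ?case
    by (simp add: nbhd_def)
next
  case (Suc m)
  then obtain N where "of_nat p ^ N * f \<in> nbhd 0 m"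
    by blast
  moreover obtain N' where "pp ^ N' * fps_nth f m \<in> OK"
    using OK_fraction by blast
  ultimately have "pp ^ (N + N') * fps_nth f i \<in> OK" if "i < Suc m" for i
  proof (cases "i = m")
    case True
    have "pp ^ N * (pp ^ N' * fps_nth f m) \<in> OK"
      using \<open>pp ^ N' * fps_nth f m \<in> OK\<close> by (simp add: OK_closed)
    then show ?thesis
      by (simp add: True power_add mult.assoc)
  next
    case False
    then have "pp ^ N * fps_nth f i \<in> OK"
      using \<open>of_nat p ^ N * f \<in> nbhd 0 m\<close> that by (simp add: nbhd_def)
    then have "pp ^ N' * (pp ^ N * fps_nth f i) \<in> OK"
      by (simp add: OK_closed)
    then show ?thesis
      by (simp add: power_add mult_ac)
  qed
  then show ?case
    by (intro exI[of _ "N + N'"]) (simp add: nbhd_def)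
qed

section \<open>The ring \<open>T\<close>: convergence and multiplication\<close>

abbreviation T :: "(nat \<Rightarrow> 'f fps) ring" where
  "T \<equiv> T_ring p OK"

lemma T_carrier: "f \<in> carrier T \<longleftrightarrow> (\<forall>a m. \<exists>n0. \<forall>n\<ge>n0. f n \<in> nbhd a m)"
  by (auto simp: T_ring_def S_nbhds_eq)

lemma T_carrierI: "(\<And>n. n \<ge> n0 \<Longrightarrow> f n = 0) \<Longrightarrow> f \<in> carrier T"
  by (auto simp: T_carrier nbhd_closed intro!: exI[of _ n0])

text \<open>The tail of a null sequence is integral modulo \<open>fps_X ^ m\<close>, and each of the
  finitely many remaining terms has its own denominator.\<close>

lemma T_bounded:
  assumes "f \<in> carrier T"
  shows "\<exists>N. \<forall>n. of_nat p ^ N * f n \<in> nbhd 0 m"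
proof -
  obtain n0 where n0: "\<And>n. n \<ge> n0 \<Longrightarrow> f n \<in> nbhd 0 m"
    using assms unfolding T_carrier by blast
  have "\<forall>n. \<exists>N. of_nat p ^ N * f n \<in> nbhd 0 m"
    using ex_bounded by blast
  then obtain N where N: "\<And>n. of_nat p ^ N n * f n \<in> nbhd 0 m"
    unfolding choice_iff by blast
  \<comment> \<open>The sum of the exponents serves as a common upper bound.\<close>
  have "of_nat p ^ (\<Sum>i<n0. N i) * f n \<in> nbhd 0 m" for n
  proof (cases "n < n0")
    case True
    then show ?thesis
      by (intro bounded_mono[OF N]) (simp add: member_le_sum)
  next
    case False
    then have "of_nat p ^ 0 * f n \<in> nbhd 0 m"
      using n0 by simp
    then show ?thesis
      by (rule bounded_mono) simp
  qed
  then show ?thesis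
    by blast
qed

text \<open>Binomial coefficients are integral, so only the bounded denominators of the fixed factor
  \<open>f\<close> have to be compensated, uniformly in \<open>n\<close>.\<close>

lemma T_mult_continuous:
  assumes "f \<in> carrier T"
  shows "\<exists>b. \<forall>g. (\<forall>n. g n \<in> nbhd b m) \<longrightarrow> (\<forall>n. (g \<otimes>\<^bsub>T\<^esub> f) n \<in> nbhd a m)"
proof -
  obtain N where N: "\<And>n. of_nat p ^ N * f n \<in> nbhd 0 m"
    using T_bounded[OF assms] by blast
  have "(g \<otimes>\<^bsub>T\<^esub> f) n \<in> nbhd a m" if g: "\<And>n. g n \<in> nbhd (a + N) m" for g n
    unfolding T_ring_mult
  proof (rule nbhd_sum)
    fix i
    have "of_nat (n choose i) * (f (n - i) * g i) \<in> nbhd (0 + a) m"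
      by (intro nbhd_closed(4) of_nat_in_nbhd nbhd_mult_bounded[OF N] g)
    then show "of_nat (n choose i) * g i * f (n - i) \<in> nbhd a m"
      by (simp add: mult_ac)
  qed
  then show ?thesis
    by blast
qed

text \<open>Once \<open>n \<ge> n0 + n1\<close>, each term of the convolution has a factor far out
  in its sequence, small enough to absorb the bounded denominators of the other.\<close>

lemma T_mult_closed:
  assumes "f \<in> carrier T" "g \<in> carrier T"
  shows "f \<otimes>\<^bsub>T\<^esub> g \<in> carrier T"
  unfolding T_carrier
proof (intro allI)
  fix a m
  obtain N where N: "\<And>n. of_nat p ^ N * f n \<in> nbhd 0 m"
    using T_bounded[OF assms(1)] by blast
  obtain N' where N': "\<And>n. of_nat p ^ N' * g n \<in> nbhd 0 m"
    using T_bounded[OF assms(2)] by blast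
  obtain n0 where n0: "\<And>n. n \<ge> n0 \<Longrightarrow> f n \<in> nbhd (a + N') m"
    using assms(1) unfolding T_carrier by meson
  obtain n1 where n1: "\<And>n. n \<ge> n1 \<Longrightarrow> g n \<in> nbhd (a + N) m"
    using assms(2) unfolding T_carrier by meson
  have "(f \<otimes>\<^bsub>T\<^esub> g) n \<in> nbhd a m" if "n \<ge> n0 + n1" for n
    unfolding T_ring_mult
  proof (rule nbhd_sum)
    fix i
    assume "i \<in> {..n}"
    then have "i \<ge> n0 \<or> n - i \<ge> n1"
      using that by auto
    then have "f i * g (n - i) \<in> nbhd a m"
    proof
      assume "i \<ge> n0"
      then show ?thesis
        using nbhd_mult_bounded[OF N' n0, of i "n - i"] by (simp add: mult.commute)
    qed (auto intro: nbhd_mult_bounded N n1)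
    then have "of_nat (n choose i) * (f i * g (n - i)) \<in> nbhd (0 + a) m"
      by (intro nbhd_closed(4) of_nat_in_nbhd)
    then show "of_nat (n choose i) * f i * g (n - i) \<in> nbhd a m"
      by (simp add: mult.assoc)
  qed
  then show "\<exists>n0. \<forall>n\<ge>n0. (f \<otimes>\<^bsub>T\<^esub> g) n \<in> nbhd a m"
    by blast
qed

lemma T_add_closed:
  assumes "f \<in> carrier T" "g \<in> carrier T"
  shows "(\<lambda>n. f n + g n) \<in> carrier T"
  unfolding T_carrier
proof (intro allI)
  fix a m
  obtain n0 n1 where "\<And>n. n \<ge> n0 \<Longrightarrow> f n \<in> nbhd a m" "\<And>n. n \<ge> n1 \<Longrightarrow> g n \<in> nbhd a m"
    using assms unfolding T_carrier by meson
  then show "\<exists>n0. \<forall>n\<ge>n0. f n + g n \<in> nbhd a m"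
    by (intro exI[of _ "n0 + n1"]) (simp add: nbhd_closed)
qed

lemma T_minus_closed: "f \<in> carrier T \<Longrightarrow> (\<lambda>n. - f n) \<in> carrier T"
  unfolding T_carrier using nbhd_minus by meson

text \<open>The product laws hold for arbitrary sequences, since \<open>egf\<close> is injective and
  turns them into laws of power series; convergence enters only through closure.\<close>

lemma T_cring: "cring T"
proof (rule cringI)
  show "abelian_group T"
  proof (rule abelian_groupI)
    fix f assume "f \<in> carrier T"
    then show "\<exists>g\<in>carrier T. g \<oplus>\<^bsub>T\<^esub> f = \<zero>\<^bsub>T\<^esub>"
      by (intro bexI[of _ "\<lambda>n. - f n"]) (auto simp: T_minus_closed)
  qed (auto simp: T_add_closed algebra_simps intro: T_carrierI)
  show "comm_monoid T"
  proof (rule comm_monoidI)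
    show "\<one>\<^bsub>T\<^esub> \<in> carrier T"
      by (rule T_carrierI[of 1]) simp
    fix f g h :: "nat \<Rightarrow> 'f fps"
    show "f \<otimes>\<^bsub>T\<^esub> g \<otimes>\<^bsub>T\<^esub> h = f \<otimes>\<^bsub>T\<^esub> (g \<otimes>\<^bsub>T\<^esub> h)"
      by (simp only: egf_inject[symmetric] egf_T_ring mult.assoc)
    show "f \<otimes>\<^bsub>T\<^esub> g = g \<otimes>\<^bsub>T\<^esub> f"
      by (simp only: egf_inject[symmetric] egf_T_ring mult.commute)
    show "\<one>\<^bsub>T\<^esub> \<otimes>\<^bsub>T\<^esub> f = f"
      by (simp only: egf_inject[symmetric] egf_T_ring mult_1)
  qed (rule T_mult_closed)
  fix f g h :: "nat \<Rightarrow> 'f fps"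
  show "(f \<oplus>\<^bsub>T\<^esub> g) \<otimes>\<^bsub>T\<^esub> h = f \<otimes>\<^bsub>T\<^esub> h \<oplus>\<^bsub>T\<^esub> g \<otimes>\<^bsub>T\<^esub> h"
    by (simp only: egf_inject[symmetric] egf_T_ring distrib_right)
qed

sublocale T: cring T
  by (rule T_cring)

lemma T_a_inv: "f \<in> carrier T \<Longrightarrow> \<ominus>\<^bsub>T\<^esub> f = (\<lambda>n. - f n)"
  by (intro T.minus_equality) (auto simp: T_minus_closed)

lemma T_minus:
  "f \<in> carrier T \<Longrightarrow> g \<in> carrier T \<Longrightarrow> f \<ominus>\<^bsub>T\<^esub> g = (\<lambda>n. f n - g n)"
  by (simp add: a_minus_def T_a_inv)

lemma S_to_T_carrier: "S_to_T s \<in> carrier T"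
  by (rule T_carrierI[of 1]) (simp add: S_to_T_def)

lemma omega_log_carrier: "omega_log k \<in> carrier T"
  by (rule T_carrierI[of "Suc k"]) (simp add: omega_log_def)

lemma T_nbhds_eq: "T_nbhds p OK = {{f \<in> carrier T. \<forall>n. f n \<in> nbhd a m} |a m. True}"
  unfolding T_nbhds_def S_nbhds_eq by auto

end

section \<open>Stirling numbers and the change of basis\<close>

lemma qstirling1_eq_0: "n < k \<Longrightarrow> qstirling1 q n k = 0"
  by (induction q n k rule: qstirling1.induct) auto

lemma qstirling2_eq_0: "n < k \<Longrightarrow> qstirling2 q n k = 0"
  by (induction q n k rule: qstirling2.induct) auto

text \<open>Both recursions are used. Besides the induction hypothesis at \<open>l\<close>, they
  produce the one at \<open>Suc l\<close> with coefficient \<open>qnum q (Suc l) - qnum q j\<close>,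
  which is zero in the only case \<open>j = Suc l\<close> where it would contribute.\<close>

lemma qstirling_orthogonal:
  "(\<Sum>n\<le>j. qstirling1 q j n * qstirling2 q n k) = (if j = k then 1 else 0)"
proof (induction j arbitrary: k)
  case 0
  then show ?case
    by (cases k) auto
next
  case (Suc j)
  show ?case
  proof (cases k)
    case 0
    have "qstirling1 q (Suc j) n * qstirling2 q n 0 = 0" for n
      by (cases n) auto
    then show ?thesis
      using 0 by simp
  next
    case (Suc l)
    \<comment> \<open>The reindexed sum loses the term at 0, where
      \<open>qstirling2 q 0 (Suc l)\<close> vanishes, and gains the one at \<open>Suc j\<close>,
      where \<open>qstirling1 q j (Suc j)\<close> vanishes.\<close>
    have shift: "(\<Sum>n\<le>j. qstirling1 q j (Suc n) * qstirling2 q (Suc n) (Suc l))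
        = (\<Sum>n\<le>j. qstirling1 q j n * qstirling2 q n (Suc l))"
    proof -
      have "(\<Sum>n\<le>Suc j. qstirling1 q j n * qstirling2 q n (Suc l))
          = (\<Sum>n\<le>j. qstirling1 q j (Suc n) * qstirling2 q (Suc n) (Suc l))"
        by (subst sum.atMost_Suc_shift) simp
      then show ?thesis
        by (simp add: qstirling1_eq_0)
    qed
    have "(\<Sum>n\<le>Suc j. qstirling1 q (Suc j) n * qstirling2 q n (Suc l))
        = (\<Sum>n\<le>j. (qstirling1 q j n - qnum q j * qstirling1 q j (Suc n))
              * qstirling2 q (Suc n) (Suc l))"
      by (subst sum.atMost_Suc_shift) simp
    also have "\<dots> = (\<Sum>n\<le>j. qstirling1 q j n * qstirling2 q n l
          + qnum q (Suc l) * (qstirling1 q j n * qstirling2 q n (Suc l))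
          - qnum q j * (qstirling1 q j (Suc n) * qstirling2 q (Suc n) (Suc l)))"
      by (intro sum.cong refl) (simp add: algebra_simps)
    also have "\<dots> = (if j = l then 1 else 0) + qnum q (Suc l) * (if j = Suc l then 1 else 0)
          - qnum q j * (if j = Suc l then 1 else 0)"
      by (simp only: sum.distrib sum_subtractf sum_distrib_left[symmetric] shift Suc.IH)
    finally show ?thesis
      using Suc by auto
  qed
qed

section \<open>Integrality of twisted numbers\<close>

lemma subring_qnum:
  assumes "subring A ring_of_type_algebra" "q \<in> A"
  shows "qnum q n \<in> A"
  unfolding qnum_def by (intro subring_sum subring_power assms)

lemma subring_qfact:
  assumes "subring A ring_of_type_algebra" "q \<in> A"
  shows "qfact q n \<in> A"
  by (induction n)
    (auto simp: qfact_def intro: subring_one subring_mult subring_qnum assms)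

lemma subring_qstirling2:
  assumes "subring A ring_of_type_algebra" "q \<in> A"
  shows "qstirling2 q n k \<in> A"
  using assms(2)
  by (induction q n k rule: qstirling2.induct)
    (auto intro: subring_zero subring_one subring_add subring_mult subring_qnum assms(1))

lemma fps_nth_power_const_plus_X:
  "fps_nth ((fps_const c + fps_X) ^ n) i = of_nat (n choose i) * (c :: 'a::comm_ring_1) ^ (n - i)"
proof -
  have "(fps_const c + fps_X) ^ n
      = (\<Sum>k\<le>n. fps_const (of_nat (n choose k) * c ^ (n - k)) * fps_X ^ k)"
    unfolding add.commute[of "fps_const c"] binomial_ring
    by (intro sum.cong refl) (simp add: fps_of_nat[symmetric] fps_const_mult[symmetric] mult_ac
        del: fps_const_mult)
  then have "fps_nth ((fps_const c + fps_X) ^ n) i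
      = (\<Sum>k\<le>n. if k = i then of_nat (n choose k) * c ^ (n - k) else 0)"
    by (simp add: fps_sum_nth fps_X_power_nth if_distrib cong: if_cong)
  then show ?thesis
    by (simp add: binomial_eq_0)
qed

lemma fps_divide_of_nat_fact:
  "f / of_nat (fact n) = f * fps_const (inverse (fact n :: 'a::field_char_0))"
proof -
  have "(of_nat (fact n) :: 'a fps) = fps_const (fact n)"
    unfolding fps_of_nat[symmetric] by (simp only: of_nat_fact)
  moreover have "inverse (fps_const (fact n :: 'a)) = fps_const (inverse (fact n))"
    by (rule fps_const_inverse) 
  ultimately show ?thesis
    by (simp add: fps_divide_unit)
qed

section \<open>The transition matrices between the two bases\<close>

context cyclotomic_base
begin

abbreviation q :: "'f fps" where
  "q \<equiv> qS \<zeta>"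

abbreviation qp :: "'f fps" where
  "qp \<equiv> q ^ p"

text \<open>The row index comes first: \<open>log_of_delta n k\<close> is the coefficient of
  \<open>omega_log k\<close> in \<open>omega_delta n\<close>, and \<open>delta_of_log n k\<close>
  that of \<open>omega_delta k\<close> in \<open>omega_log n\<close>.\<close>

definition log_of_delta :: "nat \<Rightarrow> nat \<Rightarrow> 'f fps" where
  "log_of_delta n k =
    of_nat (fact k) / qfact qp n * qstirling1 qp n k * (q - 1) ^ (n - k) * q ^ (n - k)"

definition delta_of_log :: "nat \<Rightarrow> nat \<Rightarrow> 'f fps" where
  "delta_of_log n k =
    qfact qp k / of_nat (fact n) * qstirling2 qp n k * (q - 1) ^ (n - k) * q ^ (n - k)"

text \<open>At \<open>q = \<zeta>\<close> the base \<open>qp\<close> becomes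
  \<open>\<zeta> ^ p = 1\<close>, so twisted numbers specialize to ordinary ones. In characteristic
  zero this makes the twisted factorials units of \<open>S\<close>.\<close>

lemma qnum_constant_coefficient: "fps_nth (qnum qp n) 0 = of_nat n"
proof -
  have "fps_nth qp 0 = 1"
    by (simp add: fps_power_zeroth qS_def zeta_primitive)
  then show ?thesis
    by (simp only: qnum_def fps_sum_nth fps_power_zeroth[of qp]) simp
qed

lemma qfact_constant_coefficient: "fps_nth (qfact qp n) 0 = fact n"
  by (induction n) (simp_all add: qfact_def qnum_constant_coefficient mult.commute)

lemma qfact_unit: "qfact qp n * inverse (qfact qp n) = 1"
  by (rule inverse_mult_eq_1') (simp add: qfact_constant_coefficient)

lemma log_of_delta_eq:
  "log_of_delta n k = inverse (qfact qp n)
    * (of_nat (fact k) * qstirling1 qp n k * (q ^ 2 - q) ^ (n - k))"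
proof -
  have "q ^ 2 - q = (q - 1) * q"
    by (simp add: algebra_simps power2_eq_square)
  then show ?thesis
    by (simp add: log_of_delta_def fps_divide_unit qfact_constant_coefficient power_mult_distrib mult_ac)
qed

lemma delta_of_log_eq:
  "delta_of_log n k = qfact qp k
    * (fps_const (inverse (fact n)) * (q - 1) ^ (n - k) * (qstirling2 qp n k * q ^ (n - k)))"
  by (simp only: delta_of_log_def fps_divide_of_nat_fact mult_ac)

lemma delta_of_log_eq_0: "n < k \<Longrightarrow> delta_of_log n k = 0"
  by (simp add: delta_of_log_def qstirling2_eq_0)

lemma log_of_delta_eq_0: "n < k \<Longrightarrow> log_of_delta n k = 0"
  by (simp add: log_of_delta_def qstirling1_eq_0)

text \<open>The factorials of \<open>n\<close> cancel and the exponents \<open>j - n\<close> and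
  \<open>n - k\<close> add up to \<open>j - k\<close>, so everything except the Stirling numbers is
  independent of \<open>n\<close> and leaves the sum.\<close>

lemma log_of_delta_inverse:
  "(\<Sum>n\<le>j. log_of_delta j n * delta_of_log n k) = (if j = k then 1 else 0)"
proof -
  have "log_of_delta j n * delta_of_log n k
      = inverse (qfact qp j) * qfact qp k * ((q - 1) * q) ^ (j - k)
          * (qstirling1 qp j n * qstirling2 qp n k)"
    if "n \<le> j" for n
  proof (cases "k \<le> n")
    case True
    have fact: "of_nat (fact n) * fps_const (inverse (fact n)) = (1 :: 'f fps)"
      unfolding fps_of_nat[symmetric] by simp
    let ?u = "(q - 1) * q"
    have "(j - n) + (n - k) = j - k"
      using True that by simp
    then have power: "?u ^ (j - n) * ?u ^ (n - k) = ?u ^ (j - k)"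
      by (simp only: power_add[symmetric])
    have "q ^ 2 - q = ?u"
      by (simp add: algebra_simps power2_eq_square)
    then have "log_of_delta j n
        = inverse (qfact qp j) * (of_nat (fact n) * qstirling1 qp j n * ?u ^ (j - n))"
      by (simp only: log_of_delta_eq)
    moreover have "delta_of_log n k
        = qfact qp k * fps_const (inverse (fact n)) * qstirling2 qp n k * ?u ^ (n - k)"
      by (simp only: delta_of_log_eq power_mult_distrib mult_ac)
    ultimately have "log_of_delta j n * delta_of_log n k
      = (of_nat (fact n) * fps_const (inverse (fact n))) * (inverse (qfact qp j) * qfact qp k
          * (?u ^ (j - n) * ?u ^ (n - k)) * (qstirling1 qp j n * qstirling2 qp n k))"
      by (simp only: mult_ac)
    then have "log_of_delta j n * delta_of_log n k
      = (of_nat (fact n) * fps_const (inverse (fact n))) * (inverse (qfact qp j) * qfact qp k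
          * ?u ^ (j - k) * (qstirling1 qp j n * qstirling2 qp n k))"
      by (simp only: power)
    then show ?thesis
      unfolding fact by simp
  qed (simp add: delta_of_log_def qstirling2_eq_0)
  then have "(\<Sum>n\<le>j. log_of_delta j n * delta_of_log n k)
      = inverse (qfact qp j) * qfact qp k * ((q - 1) * q) ^ (j - k)
          * (\<Sum>n\<le>j. qstirling1 qp j n * qstirling2 qp n k)"
    by (simp add: sum_distrib_left)
  also have "\<dots> = (if j = k then 1 else 0)"
    unfolding qstirling_orthogonal by (simp add: qfact_unit mult.commute[of "inverse _"])
  finally show ?thesis .
qed

text \<open>This settles the integrality of all factors of \<open>delta_of_log\<close> that are
  built from \<open>q\<close> without division.\<close>

lemma nbhd_0_subring: "subring (nbhd 0 m) ring_of_type_algebra"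
  by (rule ring.subringI[OF ring_from_type_algebra])
    (use of_nat_in_nbhd[of 1 m] nbhd_closed(4)[of _ 0 m _ 0] in
      \<open>auto intro: nbhd_closed(2) nbhd_minus\<close>)

lemma q_in_nbhd_0: "q \<in> nbhd 0 m"
  by (rule integral_in_nbhd)
    (simp add: qS_def fps_X_def OK_closed zeta_in_OK)

text \<open>The point is that the powers of \<open>\<zeta> - 1\<close> compensate the denominators \<open>n!\<close>.\<close>

lemma delta_of_log_bounded: "of_nat p ^ (k + m) * delta_of_log n k \<in> nbhd 0 m"
proof -
  have "of_nat p ^ (k + m) * (fps_const (inverse (fact n)) * (q - 1) ^ (n - k)) \<in> nbhd 0 m"
  proof (rule nbhdI)
    fix i
    assume "i < m"
    have "q - 1 = fps_const (\<zeta> - 1) + fps_X"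
      by (simp add: qS_def fps_const_sub[symmetric] del: fps_const_sub)
    then have "fps_nth (of_nat p ^ (k + m) * (fps_const (inverse (fact n)) * (q - 1) ^ (n - k))) i
        = pp ^ (k + m) * (inverse (fact n) * (of_nat (n - k choose i) * (\<zeta> - 1) ^ (n - k - i)))"
      by (simp only: fps_nth_of_nat_power_mult fps_mult_left_const_nth fps_nth_power_const_plus_X)
    \<comment> \<open>The coefficient at \<open>i\<close> has only \<open>n - k - i\<close> factors
      \<open>\<zeta> - 1\<close> to set against \<open>fact n\<close>; \<open>pp ^ (k + i)\<close>
      makes up for the missing ones, and \<open>k + m\<close> exceeds \<open>k + i\<close> for every
      \<open>i < m\<close>.\<close>
    also have "\<dots> = pp ^ (m - i) * of_nat (n - k choose i)
        * (pp ^ (k + i) * (\<zeta> - 1) ^ (n - (k + i)) / fact n)"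
    proof -
      have "k + m = (m - i) + (k + i)"
        using \<open>i < m\<close> by simp
      then have "pp ^ (k + m) = pp ^ (m - i) * pp ^ (k + i)"
        by (simp only: power_add)
      then show ?thesis
        by (simp add: field_simps)
    qed
    also have "\<dots> \<in> OK"
      by (intro OK_closed p_power_zeta_minus_one_power_div_fact)
    finally show "\<exists>c\<in>OK. fps_nth (of_nat p ^ (k + m)
        * (fps_const (inverse (fact n)) * (q - 1) ^ (n - k))) i = pp ^ 0 * c"
      by simp
  qed
  moreover have "qfact qp k \<in> nbhd 0 m" "qstirling2 qp n k * q ^ (n - k) \<in> nbhd 0 m"
    by (intro subring_mult[OF nbhd_0_subring] subring_power[OF nbhd_0_subring]
        subring_qfact[OF nbhd_0_subring] subring_qstirling2[OF nbhd_0_subring] q_in_nbhd_0)+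
  ultimately have "qfact qp k * (of_nat p ^ (k + m) * (fps_const (inverse (fact n)) * (q - 1) ^ (n - k))
      * (qstirling2 qp n k * q ^ (n - k))) \<in> nbhd 0 m"
    using subring_mult[OF nbhd_0_subring] by blast
  then show ?thesis
    unfolding delta_of_log_eq by (simp only: mult_ac)
qed

section \<open>Divided power expansion of the twisted basis\<close>

lemma omega_delta_factor_carrier: "omega_log 1 \<ominus>\<^bsub>T\<^esub> S_to_T c \<in> carrier T"
  by (intro T.minus_closed omega_log_carrier S_to_T_carrier)

text \<open>Multiplication by omega sends the divided power of degree n - 1 to n times that of
  degree n. At \<open>n = 0\<close> the truncated index \<open>n - 1\<close> is harmless because of
  the factor \<open>of_nat n\<close>.\<close>

lemma omega_delta_factor_mult:
  "(omega_log 1 \<ominus>\<^bsub>T\<^esub> S_to_T c) \<otimes>\<^bsub>T\<^esub> f = (\<lambda>n. of_nat n * f (n - 1) - c * f n)"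
proof
  fix n
  have "(omega_log 1 \<ominus>\<^bsub>T\<^esub> S_to_T c) = (\<lambda>i. (if i = 1 then 1 else 0) - (if i = 0 then c else 0))"
    unfolding T_minus[OF omega_log_carrier S_to_T_carrier]
    by (simp add: omega_log_def S_to_T_def)
  then have "((omega_log 1 \<ominus>\<^bsub>T\<^esub> S_to_T c) \<otimes>\<^bsub>T\<^esub> f) n
      = (\<Sum>i\<le>n. of_nat (n choose i) * ((if i = 1 then 1 else 0) - (if i = 0 then c else 0)) * f (n - i))"
    by (simp add: T_ring_mult)
  also have "\<dots> = (\<Sum>i\<le>n. (if i = 1 then of_nat n * f (n - 1) else 0) - (if i = 0 then c * f n else 0))"
    by (intro sum.cong) auto
  also have "\<dots> = of_nat n * f (n - 1) - c * f n"
    by (simp add: sum_subtractf)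
  finally show "((omega_log 1 \<ominus>\<^bsub>T\<^esub> S_to_T c) \<otimes>\<^bsub>T\<^esub> f) n = of_nat n * f (n - 1) - c * f n" .
qed

text \<open>One more factor reproduces the recursion of the Stirling numbers of the first kind:
  \<open>u\<close> collects the degree lost, and \<open>fact k\<close> comes from rewriting the k-th
  power of omega as a divided power.\<close>

lemma omega_delta_product:
  "(\<Otimes>\<^bsub>T\<^esub>k\<in>{..<n}. omega_log 1 \<ominus>\<^bsub>T\<^esub> S_to_T (qnum Q k * u))
    = (\<lambda>k. of_nat (fact k) * qstirling1 Q n k * u ^ (n - k))"
proof (induction n)
  case 0
  have "(\<lambda>k. of_nat (fact k) * qstirling1 Q 0 k * u ^ (0 - k)) = \<one>\<^bsub>T\<^esub>"
  proof
    fix k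
    show "of_nat (fact k) * qstirling1 Q 0 k * u ^ (0 - k) = \<one>\<^bsub>T\<^esub> k"
      by (cases k) auto
  qed
  then show ?case
    by simp
next
  case (Suc n)
  have "(\<Otimes>\<^bsub>T\<^esub>k\<in>{..<Suc n}. omega_log 1 \<ominus>\<^bsub>T\<^esub> S_to_T (qnum Q k * u))
      = (omega_log 1 \<ominus>\<^bsub>T\<^esub> S_to_T (qnum Q n * u))
          \<otimes>\<^bsub>T\<^esub> (\<Otimes>\<^bsub>T\<^esub>k\<in>{..<n}. omega_log 1 \<ominus>\<^bsub>T\<^esub> S_to_T (qnum Q k * u))"
    unfolding lessThan_Suc
    by (rule T.finprod_insert) (auto simp: omega_delta_factor_carrier simp del: One_nat_def)
  also have "\<dots> = (\<lambda>k. of_nat (fact k) * qstirling1 Q (Suc n) k * u ^ (Suc n - k))"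
  proof
    fix k
    have "of_nat k * (of_nat (fact (k - 1)) * qstirling1 Q n (k - 1) * u ^ (n - (k - 1)))
        - qnum Q n * u * (of_nat (fact k) * qstirling1 Q n k * u ^ (n - k))
        = of_nat (fact k) * qstirling1 Q (Suc n) k * u ^ (Suc n - k)"
    proof (cases k)
      case 0
      \<comment> \<open>Either \<open>n = 0\<close> and the twisted number is 0, or the Stirling
        number is.\<close>
      have "qnum Q n * qstirling1 Q n 0 = 0"
        by (cases n) (simp_all add: qnum_def)
      then show ?thesis
        using 0 by auto
    next
      case (Suc l)
      \<comment> \<open>Truncation of \<open>n - Suc l\<close> could spoil this only for
        \<open>n \<le> l\<close>, where the Stirling number vanishes.\<close>
      have "u * (qstirling1 Q n (Suc l) * u ^ (n - Suc l)) = qstirling1 Q n (Suc l) * u ^ (n - l)"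
      proof (cases "Suc l \<le> n")
        case True
        then have "n - l = Suc (n - Suc l)"
          by simp
        then show ?thesis
          by simp
      qed (simp add: qstirling1_eq_0)
      then have "qnum Q n * u * (of_nat (fact (Suc l)) * qstirling1 Q n (Suc l) * u ^ (n - Suc l))
          = qnum Q n * of_nat (fact (Suc l)) * (qstirling1 Q n (Suc l) * u ^ (n - l))"
        by (metis (no_types, opaque_lifting) mult.assoc mult.commute)
      then show ?thesis
        using Suc by (simp add: algebra_simps)
    qed
    then show "((omega_log 1 \<ominus>\<^bsub>T\<^esub> S_to_T (qnum Q n * u))
          \<otimes>\<^bsub>T\<^esub> (\<Otimes>\<^bsub>T\<^esub>k\<in>{..<n}. omega_log 1 \<ominus>\<^bsub>T\<^esub> S_to_T (qnum Q k * u))) k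
        = of_nat (fact k) * qstirling1 Q (Suc n) k * u ^ (Suc n - k)"
      unfolding Suc.IH omega_delta_factor_mult .
  qed
  finally show ?case .
qed

lemma omega_delta_eq: "omega_delta p OK \<zeta> n = log_of_delta n"
  unfolding omega_delta_def omega_delta_product S_to_T_mult log_of_delta_eq ..

lemma omega_delta_carrier: "omega_delta p OK \<zeta> n \<in> carrier T"
  unfolding omega_delta_eq by (rule T_carrierI[of "Suc n"]) (simp add: log_of_delta_eq_0)

end

section \<open>Extension of scalars\<close>

locale scalar_extension = D: cring D
  for C :: "('c, 'x) ring_scheme" and D :: "('d, 'y) ring_scheme" and h :: "'c \<Rightarrow> 'd"
    and N :: "('c, 'm, 'z) module_scheme" +
  assumes h_closed: "c \<in> carrier C \<Longrightarrow> h c \<in> carrier D"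
    and N_add_closed: "x \<in> carrier N \<Longrightarrow> y \<in> carrier N \<Longrightarrow> x \<oplus>\<^bsub>N\<^esub> y \<in> carrier N"
    and N_smult_closed: "c \<in> carrier C \<Longrightarrow> x \<in> carrier N \<Longrightarrow> c \<odot>\<^bsub>N\<^esub> x \<in> carrier N"
begin

abbreviation "free \<equiv> free_module_carrier D N"
abbreviation "rel \<equiv> tensor_relations C D h N"
abbreviation "cls \<equiv> tensor_class C D h N"
abbreviation "B \<equiv> base_change C D h N"

lemma free_closed: "z \<in> free \<Longrightarrow> z v \<in> carrier D"
  by (simp add: free_module_carrier_def)

lemma free_add:
  assumes "z \<in> free" "z' \<in> free"
  shows "(\<lambda>v. z v \<oplus>\<^bsub>D\<^esub> z' v) \<in> free"
proof -
  have "{x. z x \<oplus>\<^bsub>D\<^esub> z' x \<noteq> \<zero>\<^bsub>D\<^esub>} \<subseteq> {x. z x \<noteq> \<zero>\<^bsub>D\<^esub>} \<union> {x. z' x \<noteq> \<zero>\<^bsub>D\<^esub>}"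
    by auto
  then have "finite {x. z x \<oplus>\<^bsub>D\<^esub> z' x \<noteq> \<zero>\<^bsub>D\<^esub>}"
    by (rule finite_subset) (use assms in \<open>simp add: free_module_carrier_def\<close>)
  then show ?thesis
    using assms by (simp add: free_module_carrier_def)
qed

lemma free_smult:
  assumes "t \<in> carrier D" "z \<in> free"
  shows "(\<lambda>v. t \<otimes>\<^bsub>D\<^esub> z v) \<in> free"
proof -
  have "{x. t \<otimes>\<^bsub>D\<^esub> z x \<noteq> \<zero>\<^bsub>D\<^esub>} \<subseteq> {x. z x \<noteq> \<zero>\<^bsub>D\<^esub>}"
    using assms by auto
  then have "finite {x. t \<otimes>\<^bsub>D\<^esub> z x \<noteq> \<zero>\<^bsub>D\<^esub>}"
    by (rule finite_subset) (use assms in \<open>simp add: free_module_carrier_def\<close>)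
  then show ?thesis
    using assms by (simp add: free_module_carrier_def)
qed

lemma free_neg:
  assumes "z \<in> free"
  shows "(\<lambda>v. \<ominus>\<^bsub>D\<^esub> z v) \<in> free"
proof -
  have "{x. \<ominus>\<^bsub>D\<^esub> z x \<noteq> \<zero>\<^bsub>D\<^esub>} \<subseteq> {x. z x \<noteq> \<zero>\<^bsub>D\<^esub>}"
    using assms by auto
  then have "finite {x. \<ominus>\<^bsub>D\<^esub> z x \<noteq> \<zero>\<^bsub>D\<^esub>}"
    by (rule finite_subset) (use assms in \<open>simp add: free_module_carrier_def\<close>)
  then show ?thesis
    using assms by (simp add: free_module_carrier_def)
qed

lemma free_minus: "z \<in> free \<Longrightarrow> z' \<in> free \<Longrightarrow> (\<lambda>v. z v \<ominus>\<^bsub>D\<^esub> z' v) \<in> free"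
  unfolding a_minus_def by (intro free_add free_neg)

lemma free_zero: "(\<lambda>_. \<zero>\<^bsub>D\<^esub>) \<in> free"
  by (simp add: free_module_carrier_def)

lemma free_single:
  assumes "t \<in> carrier D" "x \<in> carrier N"
  shows "single D t x \<in> free"
proof -
  have "finite {y. single D t x y \<noteq> \<zero>\<^bsub>D\<^esub>}"
    by (rule finite_subset[of _ "{x}"]) (auto simp: single_def)
  then show ?thesis
    using assms by (auto simp: free_module_carrier_def single_def)
qed

lemma rel_free: "r \<in> rel \<Longrightarrow> r \<in> free"
  by (induction rule: tensor_relations.induct)
    (intro free_zero free_minus free_add free_neg free_single D.m_closed h_closed
      N_add_closed N_smult_closed; assumption)+

lemma smult_single:
  "t \<in> carrier D \<Longrightarrow> t \<otimes>\<^bsub>D\<^esub> single D s x v = single D (t \<otimes>\<^bsub>D\<^esub> s) x v"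
  by (simp add: single_def)

lemma rel_smult:
  assumes "t \<in> carrier D" "r \<in> rel"
  shows "(\<lambda>v. t \<otimes>\<^bsub>D\<^esub> r v) \<in> rel"
  using assms(2)
proof induction
  case zero
  then show ?case
    using tensor_relations.zero assms(1) by simp
next
  case (additive s x y)
  note single = free_closed[OF free_single]
  have "t \<otimes>\<^bsub>D\<^esub> (single D s (x \<oplus>\<^bsub>N\<^esub> y) v \<ominus>\<^bsub>D\<^esub> (single D s x v \<oplus>\<^bsub>D\<^esub> single D s y v))
      = single D (t \<otimes>\<^bsub>D\<^esub> s) (x \<oplus>\<^bsub>N\<^esub> y) v
        \<ominus>\<^bsub>D\<^esub> (single D (t \<otimes>\<^bsub>D\<^esub> s) x v \<oplus>\<^bsub>D\<^esub> single D (t \<otimes>\<^bsub>D\<^esub> s) y v)" for v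
    using additive assms(1)
    by (simp add: a_minus_def D.r_distr D.r_minus smult_single[symmetric] single N_add_closed)
  then show ?case
    using tensor_relations.additive[of "t \<otimes>\<^bsub>D\<^esub> s" D x N y C h] additive assms(1) by simp
next
  case (balanced s c x)
  note single = free_closed[OF free_single]
  have "t \<otimes>\<^bsub>D\<^esub> (single D s (c \<odot>\<^bsub>N\<^esub> x) v \<ominus>\<^bsub>D\<^esub> single D (s \<otimes>\<^bsub>D\<^esub> h c) x v)
      = single D (t \<otimes>\<^bsub>D\<^esub> s) (c \<odot>\<^bsub>N\<^esub> x) v \<ominus>\<^bsub>D\<^esub> single D (t \<otimes>\<^bsub>D\<^esub> s \<otimes>\<^bsub>D\<^esub> h c) x v" for v
    using balanced assms(1)
    by (simp add: a_minus_def D.r_distr D.r_minus D.m_assoc smult_single[symmetric] single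
        N_smult_closed h_closed)
  then show ?case
    using tensor_relations.balanced[of "t \<otimes>\<^bsub>D\<^esub> s" D c C x N h] balanced assms(1) by simp
next
  case (add z z')
  then show ?case
    using tensor_relations.add[OF add.IH] assms(1) by (simp add: D.r_distr free_closed rel_free)
next
  case (neg z)
  then show ?case
    using tensor_relations.neg[OF neg.IH] assms(1) by (simp add: D.r_minus free_closed rel_free)
qed

lemma mem_cls: "z \<in> free \<Longrightarrow> z \<in> cls z"
  unfolding tensor_class_def
  using tensor_relations.zero[of D C h N] by (auto simp: free_closed intro!: exI[of _ "\<lambda>_. \<zero>\<^bsub>D\<^esub>"])

lemma cls_add_rel:
  assumes "z \<in> free" "r \<in> rel"
  shows "cls (\<lambda>v. z v \<oplus>\<^bsub>D\<^esub> r v) = cls z"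
proof -
  note closed = free_closed[OF assms(1)] free_closed[OF rel_free]
  have "(\<lambda>v. z v \<oplus>\<^bsub>D\<^esub> r v \<oplus>\<^bsub>D\<^esub> s v) \<in> cls z" if "s \<in> rel" for s
  proof -
    have "(\<lambda>v. z v \<oplus>\<^bsub>D\<^esub> r v \<oplus>\<^bsub>D\<^esub> s v) = (\<lambda>v. z v \<oplus>\<^bsub>D\<^esub> (r v \<oplus>\<^bsub>D\<^esub> s v))"
      using that assms closed by (simp add: D.a_assoc)
    then show ?thesis
      using tensor_relations.add[OF assms(2) that] unfolding tensor_class_def
      by (intro CollectI exI[of _ "\<lambda>v. r v \<oplus>\<^bsub>D\<^esub> s v"] conjI)
  qed
  moreover have "(\<lambda>v. z v \<oplus>\<^bsub>D\<^esub> s v) \<in> cls (\<lambda>v. z v \<oplus>\<^bsub>D\<^esub> r v)" if "s \<in> rel" for s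
  proof -
    have "(\<lambda>v. z v \<oplus>\<^bsub>D\<^esub> s v) = (\<lambda>v. z v \<oplus>\<^bsub>D\<^esub> r v \<oplus>\<^bsub>D\<^esub> (\<ominus>\<^bsub>D\<^esub> r v \<oplus>\<^bsub>D\<^esub> s v))"
      using that assms closed by (simp add: D.a_assoc D.r_neg2)
    then show ?thesis
      using tensor_relations.add[OF tensor_relations.neg[OF assms(2)] that] unfolding tensor_class_def
      by (intro CollectI exI[of _ "\<lambda>v. \<ominus>\<^bsub>D\<^esub> r v \<oplus>\<^bsub>D\<^esub> s v"] conjI)
  qed
  ultimately show ?thesis
    unfolding tensor_class_def by blast
qed

lemma clsE:
  assumes "y \<in> cls z"
  obtains r where "r \<in> rel" "y = (\<lambda>v. z v \<oplus>\<^bsub>D\<^esub> r v)"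
  using assms by (auto simp: tensor_class_def)

lemma base_change_carrier: "carrier B = cls ` free"
  by (simp add: base_change_def)

lemma base_change_zero: "\<zero>\<^bsub>B\<^esub> = cls (\<lambda>_. \<zero>\<^bsub>D\<^esub>)"
  by (simp add: base_change_def)

lemma base_change_add:
  assumes "z \<in> free" "z' \<in> free"
  shows "cls z \<oplus>\<^bsub>B\<^esub> cls z' = cls (\<lambda>v. z v \<oplus>\<^bsub>D\<^esub> z' v)"
proof -
  have "cls (\<lambda>v. y v \<oplus>\<^bsub>D\<^esub> y' v) = cls (\<lambda>v. z v \<oplus>\<^bsub>D\<^esub> z' v)" if y: "y \<in> cls z" "y' \<in> cls z'" for y y'
  proof -
    obtain r r' where r: "r \<in> rel" "y = (\<lambda>v. z v \<oplus>\<^bsub>D\<^esub> r v)" "r' \<in> rel" "y' = (\<lambda>v. z' v \<oplus>\<^bsub>D\<^esub> r' v)"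
      using y by (elim clsE)
    have "(\<lambda>v. y v \<oplus>\<^bsub>D\<^esub> y' v) = (\<lambda>v. (z v \<oplus>\<^bsub>D\<^esub> z' v) \<oplus>\<^bsub>D\<^esub> (r v \<oplus>\<^bsub>D\<^esub> r' v))"
      using r assms by (simp add: D.a_ac free_closed rel_free)
    then show ?thesis
      using cls_add_rel[OF free_add[OF assms] tensor_relations.add[OF r(1,3)]] by simp
  qed
  \<comment> \<open>The definition takes a union over all pairs of representatives; the cosets in it
    are all equal.\<close>
  then have "(\<Union>y\<in>cls z. \<Union>y'\<in>cls z'. cls (\<lambda>v. y v \<oplus>\<^bsub>D\<^esub> y' v)) = cls (\<lambda>v. z v \<oplus>\<^bsub>D\<^esub> z' v)"
    using mem_cls assms by blast
  then show ?thesis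
    by (simp add: base_change_def)
qed

lemma base_change_smult:
  assumes "t \<in> carrier D" "z \<in> free"
  shows "t \<odot>\<^bsub>B\<^esub> cls z = cls (\<lambda>v. t \<otimes>\<^bsub>D\<^esub> z v)"
proof -
  have "cls (\<lambda>v. t \<otimes>\<^bsub>D\<^esub> y v) = cls (\<lambda>v. t \<otimes>\<^bsub>D\<^esub> z v)" if y: "y \<in> cls z" for y
  proof -
    obtain r where r: "r \<in> rel" "y = (\<lambda>v. z v \<oplus>\<^bsub>D\<^esub> r v)"
      using y by (elim clsE)
    have "(\<lambda>v. t \<otimes>\<^bsub>D\<^esub> y v) = (\<lambda>v. t \<otimes>\<^bsub>D\<^esub> z v \<oplus>\<^bsub>D\<^esub> t \<otimes>\<^bsub>D\<^esub> r v)"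
      using r assms by (simp add: D.r_distr free_closed rel_free)
    then show ?thesis
      using cls_add_rel[OF free_smult[OF assms] rel_smult[OF assms(1) r(1)]] by simp
  qed
  then have "(\<Union>y\<in>cls z. cls (\<lambda>v. t \<otimes>\<^bsub>D\<^esub> y v)) = cls (\<lambda>v. t \<otimes>\<^bsub>D\<^esub> z v)"
    using mem_cls assms by blast
  then show ?thesis
    by (simp add: base_change_def)
qed

lemma base_change_abelian_group: "abelian_group B"
proof (rule abelian_groupI)
  show "\<zero>\<^bsub>B\<^esub> \<in> carrier B"
    unfolding base_change_carrier base_change_zero by (intro imageI free_zero)
  fix V
  assume "V \<in> carrier B"
  then obtain x where x: "x \<in> free" "V = cls x"
    by (auto simp: base_change_carrier)
  show "\<zero>\<^bsub>B\<^esub> \<oplus>\<^bsub>B\<^esub> V = V"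
    using x by (simp add: base_change_zero base_change_add free_zero free_closed)
  show "\<exists>Y\<in>carrier B. Y \<oplus>\<^bsub>B\<^esub> V = \<zero>\<^bsub>B\<^esub>"
  proof
    show "cls (\<lambda>v. \<ominus>\<^bsub>D\<^esub> x v) \<oplus>\<^bsub>B\<^esub> V = \<zero>\<^bsub>B\<^esub>"
      using x by (simp add: base_change_zero base_change_add free_neg free_closed D.l_neg)
    show "cls (\<lambda>v. \<ominus>\<^bsub>D\<^esub> x v) \<in> carrier B"
      using x by (simp add: base_change_carrier free_neg)
  qed
  fix Y
  assume "Y \<in> carrier B"
  then obtain y where y: "y \<in> free" "Y = cls y"
    by (auto simp: base_change_carrier)
  show "V \<oplus>\<^bsub>B\<^esub> Y \<in> carrier B"
    using x y by (simp add: base_change_add base_change_carrier free_add)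
  show "V \<oplus>\<^bsub>B\<^esub> Y = Y \<oplus>\<^bsub>B\<^esub> V"
    using x y by (simp add: base_change_add D.a_comm free_closed)
  fix Z
  assume "Z \<in> carrier B"
  then obtain z where "z \<in> free" "Z = cls z"
    by (auto simp: base_change_carrier)
  then show "V \<oplus>\<^bsub>B\<^esub> Y \<oplus>\<^bsub>B\<^esub> Z = V \<oplus>\<^bsub>B\<^esub> (Y \<oplus>\<^bsub>B\<^esub> Z)"
    using x y by (simp add: base_change_add free_add D.a_assoc free_closed)
qed

lemma tensor_closed: "t \<in> carrier D \<Longrightarrow> x \<in> carrier N \<Longrightarrow> tensor C D h N t x \<in> carrier B"
  by (simp add: tensor_def base_change_carrier free_single)

end


section \<open>Coordinates in finite free modules\<close>

text \<open>Coordinates are chosen vector by vector; additivity and homogeneity follow from their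
  uniqueness.\<close>

lemma (in Module.module) basis_coordinates:
  assumes "is_basis R M r e"
  shows "\<exists>c. (\<forall>x\<in>carrier M. x = (\<Oplus>\<^bsub>M\<^esub>i\<in>{..<r}. c i x \<odot>\<^bsub>M\<^esub> e i)) \<and>
    (\<forall>i<r. \<forall>x\<in>carrier M. \<forall>y\<in>carrier M. c i (x \<oplus>\<^bsub>M\<^esub> y) = c i x \<oplus> c i y) \<and>
    (\<forall>i<r. \<forall>a\<in>carrier R. \<forall>x\<in>carrier M. c i (a \<odot>\<^bsub>M\<^esub> x) = a \<otimes> c i x)"
proof -
  have e: "\<And>i. i < r \<Longrightarrow> e i \<in> carrier M"
    and basis: "\<And>x. x \<in> carrier M \<Longrightarrow>
      \<exists>!c. c \<in> {..<r} \<rightarrow>\<^sub>E carrier R \<and> x = (\<Oplus>\<^bsub>M\<^esub>i\<in>{..<r}. c i \<odot>\<^bsub>M\<^esub> e i)"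
    using assms by (auto simp: is_basis_def)
  then have "\<forall>x\<in>carrier M. \<exists>c. c \<in> {..<r} \<rightarrow>\<^sub>E carrier R \<and> x = (\<Oplus>\<^bsub>M\<^esub>i\<in>{..<r}. c i \<odot>\<^bsub>M\<^esub> e i)"
    by blast
  then obtain c where c: "\<And>x. x \<in> carrier M \<Longrightarrow> c x \<in> {..<r} \<rightarrow>\<^sub>E carrier R"
      "\<And>x. x \<in> carrier M \<Longrightarrow> x = (\<Oplus>\<^bsub>M\<^esub>i\<in>{..<r}. c x i \<odot>\<^bsub>M\<^esub> e i)"
    unfolding bchoice_iff by blast
  have unique: "c x i = d i"
    if "x \<in> carrier M" "i < r" "\<And>i. i < r \<Longrightarrow> d i \<in> carrier R" "x = (\<Oplus>\<^bsub>M\<^esub>i\<in>{..<r}. d i \<odot>\<^bsub>M\<^esub> e i)"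
    for x i d
  proof -
    have "(\<Oplus>\<^bsub>M\<^esub>i\<in>{..<r}. restrict d {..<r} i \<odot>\<^bsub>M\<^esub> e i) = (\<Oplus>\<^bsub>M\<^esub>i\<in>{..<r}. d i \<odot>\<^bsub>M\<^esub> e i)"
      using that(3) e by (intro M.finsum_cong') auto
    \<comment> \<open>\<open>is_basis\<close> asserts uniqueness among extensional families, hence
      the restriction.\<close>
    moreover have "restrict d {..<r} \<in> {..<r} \<rightarrow>\<^sub>E carrier R"
      using that(3) by auto
    ultimately have "c x = restrict d {..<r}"
      using basis[OF that(1)] c[OF that(1)] that(4) by metis
    then show ?thesis
      using that(2) by simp
  qed
  have closed: "c x i \<in> carrier R" if "i < r" "x \<in> carrier M" for x i
    using c(1)[OF that(2)] that(1) by auto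
  show ?thesis
  proof (intro exI[of _ "\<lambda>i x. c x i"] conjI ballI allI impI)
    show "x = (\<Oplus>\<^bsub>M\<^esub>i\<in>{..<r}. c x i \<odot>\<^bsub>M\<^esub> e i)" if "x \<in> carrier M" for x
      using c(2)[OF that] .
    show "c (x \<oplus>\<^bsub>M\<^esub> y) i = c x i \<oplus> c y i" if "i < r" "x \<in> carrier M" "y \<in> carrier M" for i x y
    proof (rule unique)
      have "x \<oplus>\<^bsub>M\<^esub> y = (\<Oplus>\<^bsub>M\<^esub>i\<in>{..<r}. c x i \<odot>\<^bsub>M\<^esub> e i \<oplus>\<^bsub>M\<^esub> c y i \<odot>\<^bsub>M\<^esub> e i)"
        using that closed e by (subst M.finsum_addf) (auto simp: c(2)[symmetric])
      also have "\<dots> = (\<Oplus>\<^bsub>M\<^esub>i\<in>{..<r}. (c x i \<oplus> c y i) \<odot>\<^bsub>M\<^esub> e i)"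
        using that closed e by (intro M.finsum_cong') (auto simp: smult_l_distr)
      finally show "x \<oplus>\<^bsub>M\<^esub> y = (\<Oplus>\<^bsub>M\<^esub>i\<in>{..<r}. (c x i \<oplus> c y i) \<odot>\<^bsub>M\<^esub> e i)" .
    qed (use that closed in auto)
    show "c (a \<odot>\<^bsub>M\<^esub> x) i = a \<otimes> c x i" if "i < r" "a \<in> carrier R" "x \<in> carrier M" for i a x
    proof (rule unique)
      have "a \<odot>\<^bsub>M\<^esub> x = a \<odot>\<^bsub>M\<^esub> (\<Oplus>\<^bsub>M\<^esub>i\<in>{..<r}. c x i \<odot>\<^bsub>M\<^esub> e i)"
        using c(2)[OF that(3)] by simp
      also have "\<dots> = (\<Oplus>\<^bsub>M\<^esub>i\<in>{..<r}. a \<odot>\<^bsub>M\<^esub> (c x i \<odot>\<^bsub>M\<^esub> e i))"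
        using that closed e by (intro finsum_smult_ldistr) auto
      also have "\<dots> = (\<Oplus>\<^bsub>M\<^esub>i\<in>{..<r}. (a \<otimes> c x i) \<odot>\<^bsub>M\<^esub> e i)"
        using that closed e by (intro M.finsum_cong') (auto simp: smult_assoc1)
      finally show "a \<odot>\<^bsub>M\<^esub> x = (\<Oplus>\<^bsub>M\<^esub>i\<in>{..<r}. (a \<otimes> c x i) \<odot>\<^bsub>M\<^esub> e i)" .
    qed (use that closed in auto)
  qed
qed

section \<open>Coordinates of a Taylor expansion\<close>

text \<open>For a functional \<open>g\<close> from M to \<open>S\<close>, this is its T-linear
  extension to formal sums; \<open>S\<close> acts on \<open>T\<close> coefficientwise, hence the
  products index by index.\<close>

definition lin_ext :: "('m \<Rightarrow> 'f::field_char_0 fps) \<Rightarrow> ('m \<Rightarrow> nat \<Rightarrow> 'f fps) \<Rightarrow> nat \<Rightarrow> 'f fps" where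
  "lin_ext g z = (\<lambda>n. \<Sum>x | z x \<noteq> (\<lambda>_. 0). z x n * g x)"

text \<open>The map that \<open>g\<close> induces from the extension of scalars of M to
  \<open>T\<close>, evaluated on some representative; by \<open>coord_cls\<close> the choice does
  not matter.\<close>

definition coord :: "('m \<Rightarrow> 'f::field_char_0 fps) \<Rightarrow> ('m \<Rightarrow> nat \<Rightarrow> 'f fps) set \<Rightarrow> nat \<Rightarrow> 'f fps" where
  "coord g V = lin_ext g (SOME z. z \<in> V)"

lemma lin_ext_superset:
  assumes "finite I" "{x. z x \<noteq> (\<lambda>_. 0)} \<subseteq> I"
  shows "lin_ext g z n = (\<Sum>x\<in>I. z x n * g x)"
  unfolding lin_ext_def using assms by (intro sum.mono_neutral_left) auto

locale linear_functional = cyclotomic_base p W res \<zeta> + M: Module.module S_ring M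
  for p and W :: "'f::field_char_0 set" and res :: "'f \<Rightarrow> 'k::field" and \<zeta>
    and M :: "('f fps, 'm) module" +
  fixes g :: "'m \<Rightarrow> 'f fps"
  assumes g_add: "x \<in> carrier M \<Longrightarrow> y \<in> carrier M \<Longrightarrow> g (x \<oplus>\<^bsub>M\<^esub> y) = g x + g y"
    and g_smult: "x \<in> carrier M \<Longrightarrow> g (s \<odot>\<^bsub>M\<^esub> x) = s * g x"
begin

sublocale scalar_extension S_ring T S_to_T M
  by unfold_locales (auto intro: S_to_T_carrier M.smult_closed)

lemma finite_support: "z \<in> free \<Longrightarrow> finite {x. z x \<noteq> (\<lambda>_. 0)}"
  by (simp add: free_module_carrier_def)

lemma lin_ext_add:
  assumes "z \<in> free" "z' \<in> free"
  shows "lin_ext g (\<lambda>v. z v \<oplus>\<^bsub>T\<^esub> z' v) = (\<lambda>n. lin_ext g z n + lin_ext g z' n)"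
proof
  fix n
  let ?X = "{x. z x \<noteq> (\<lambda>_. 0)} \<union> {x. z' x \<noteq> (\<lambda>_. 0)}"
  have "finite ?X"
    using assms by (simp add: finite_support)
  moreover have "{x. (z x \<oplus>\<^bsub>T\<^esub> z' x) \<noteq> (\<lambda>_. 0)} \<subseteq> ?X"
    by auto
  ultimately show "lin_ext g (\<lambda>v. z v \<oplus>\<^bsub>T\<^esub> z' v) n = lin_ext g z n + lin_ext g z' n"
    using lin_ext_superset[of ?X "\<lambda>v. z v \<oplus>\<^bsub>T\<^esub> z' v"] lin_ext_superset[of ?X z]
      lin_ext_superset[of ?X z']
    by (simp add: distrib_right sum.distrib)
qed

lemma lin_ext_neg:
  assumes "z \<in> free"
  shows "lin_ext g (\<lambda>v. \<ominus>\<^bsub>T\<^esub> z v) = (\<lambda>n. - lin_ext g z n)"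
proof -
  have "(\<lambda>v. \<ominus>\<^bsub>T\<^esub> z v) = (\<lambda>v n. - z v n)"
    using assms by (simp add: T_a_inv free_closed)
  moreover have "(\<lambda>n. - z x n) \<noteq> (\<lambda>_. 0) \<longleftrightarrow> z x \<noteq> (\<lambda>_. 0)" for x
    by (auto simp: fun_eq_iff)
  ultimately show ?thesis
    by (simp add: lin_ext_def sum_negf)
qed

lemma lin_ext_minus:
  assumes "z \<in> free" "z' \<in> free"
  shows "lin_ext g (\<lambda>v. z v \<ominus>\<^bsub>T\<^esub> z' v) = (\<lambda>n. lin_ext g z n - lin_ext g z' n)"
  unfolding a_minus_def using assms by (simp only: lin_ext_add lin_ext_neg free_neg) simp

lemma lin_ext_single: "lin_ext g (single T t x) = (\<lambda>n. t n * g x)"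
proof
  fix n
  have "{y. single T t x y \<noteq> (\<lambda>_. 0)} \<subseteq> {x}"
    by (auto simp: single_def)
  then show "lin_ext g (single T t x) n = t n * g x"
    by (subst lin_ext_superset[of "{x}"]) (auto simp: single_def)
qed

lemma lin_ext_smult:
  assumes "t \<in> carrier T" "z \<in> free"
  shows "lin_ext g (\<lambda>v. t \<otimes>\<^bsub>T\<^esub> z v) = t \<otimes>\<^bsub>T\<^esub> lin_ext g z"
proof
  fix n
  let ?X = "{x. z x \<noteq> (\<lambda>_. 0)}"
  have "{x. t \<otimes>\<^bsub>T\<^esub> z x \<noteq> (\<lambda>_. 0)} \<subseteq> ?X"
    by (auto simp: T_ring_mult)
  then have "lin_ext g (\<lambda>v. t \<otimes>\<^bsub>T\<^esub> z v) n = (\<Sum>x\<in>?X. (t \<otimes>\<^bsub>T\<^esub> z x) n * g x)"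
    by (intro lin_ext_superset finite_support assms)
  also have "\<dots> = (\<Sum>x\<in>?X. \<Sum>i\<le>n. of_nat (n choose i) * t i * (z x (n - i) * g x))"
    by (simp add: T_ring_mult sum_distrib_right mult.assoc)
  also have "\<dots> = (\<Sum>i\<le>n. of_nat (n choose i) * t i * lin_ext g z (n - i))"
    unfolding lin_ext_def by (subst sum.swap) (simp add: sum_distrib_left)
  finally show "lin_ext g (\<lambda>v. t \<otimes>\<^bsub>T\<^esub> z v) n = (t \<otimes>\<^bsub>T\<^esub> lin_ext g z) n"
    by (simp add: T_ring_mult)
qed

text \<open>Additivity of \<open>g\<close> kills the additive relations and S-linearity the balanced
  ones, which makes \<open>coord\<close> well defined.\<close>

lemma lin_ext_rel: "r \<in> rel \<Longrightarrow> lin_ext g r = (\<lambda>_. 0)"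
proof (induction rule: tensor_relations.induct)
  case zero
  then show ?case
    by (simp add: lin_ext_def)
next
  case (additive t x y)
  then show ?case
    by (simp only: lin_ext_minus lin_ext_add lin_ext_single free_single free_add N_add_closed g_add)
      (simp add: distrib_left)
next
  case (balanced t s x)
  have "t \<otimes>\<^bsub>T\<^esub> S_to_T s = (\<lambda>n. s * t n)"
    using T.m_comm[OF balanced(1) S_to_T_carrier] by simp
  moreover have "t \<otimes>\<^bsub>T\<^esub> S_to_T s \<in> carrier T"
    using balanced by (intro T.m_closed S_to_T_carrier)
  ultimately show ?case
    using balanced by (simp only: lin_ext_minus lin_ext_single free_single N_smult_closed g_smult)
      (simp add: mult_ac)
next
  case (add z z')
  then show ?case
    by (simp only: lin_ext_add rel_free) simp
next
  case (neg z)
  then show ?case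
    by (simp only: lin_ext_neg rel_free) simp
qed

lemma lin_ext_closed:
  assumes "z \<in> free"
  shows "lin_ext g z \<in> carrier T"
proof -
  have "(\<lambda>n. \<Sum>x\<in>I. z x n * g x) \<in> carrier T" if "finite I" for I
    using that
  proof induction
    case empty
    then show ?case
      by (auto intro: T_carrierI)
  next
    case (insert x I)
    have "S_to_T (g x) \<otimes>\<^bsub>T\<^esub> z x \<in> carrier T"
      by (intro T.m_closed S_to_T_carrier free_closed assms)
    then have "(\<lambda>n. z x n * g x) \<in> carrier T"
      by (simp add: mult.commute)
    from T_add_closed[OF this insert.IH] show ?case
      using insert.hyps by simp
  qed
  from this[OF finite_support[OF assms]] show ?thesis
    unfolding lin_ext_def .
qed

lemma coord_cls:
  assumes "z \<in> free"
  shows "coord g (cls z) = lin_ext g z"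
proof -
  have "(SOME y. y \<in> cls z) \<in> cls z"
    using mem_cls[OF assms] by (rule someI[of "\<lambda>y. y \<in> cls z"])
  then obtain r where r: "r \<in> rel" "(SOME y. y \<in> cls z) = (\<lambda>v. z v \<oplus>\<^bsub>T\<^esub> r v)"
    by (rule clsE)
  then show ?thesis
    unfolding coord_def r(2) lin_ext_add[OF assms rel_free[OF r(1)]] lin_ext_rel[OF r(1)] by simp
qed

lemma base_changeE:
  assumes "V \<in> carrier B"
  obtains z where "z \<in> free" "V = cls z"
  using assms by (auto simp: base_change_carrier)

lemma coord_closed: "V \<in> carrier B \<Longrightarrow> coord g V \<in> carrier T"
  by (elim base_changeE) (simp add: coord_cls lin_ext_closed)

lemma coord_add:
  "V \<in> carrier B \<Longrightarrow> Y \<in> carrier B \<Longrightarrow> coord g (V \<oplus>\<^bsub>B\<^esub> Y) = (\<lambda>n. coord g V n + coord g Y n)"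
  by (elim base_changeE)
    (simp only: base_change_add coord_cls free_add lin_ext_add)

lemma coord_smult:
  "t \<in> carrier T \<Longrightarrow> V \<in> carrier B \<Longrightarrow> coord g (t \<odot>\<^bsub>B\<^esub> V) = t \<otimes>\<^bsub>T\<^esub> coord g V"
  by (elim base_changeE)
    (simp only: base_change_smult coord_cls free_smult lin_ext_smult)

lemma smult_B_closed: "t \<in> carrier T \<Longrightarrow> V \<in> carrier B \<Longrightarrow> t \<odot>\<^bsub>B\<^esub> V \<in> carrier B"
  by (elim base_changeE) (simp only: base_change_smult base_change_carrier free_smult imageI)

lemma coord_tensor:
  "t \<in> carrier T \<Longrightarrow> x \<in> carrier M \<Longrightarrow> coord g (tensor S_ring T S_to_T M t x) = (\<lambda>n. t n * g x)"
  by (simp only: tensor_def coord_cls free_single lin_ext_single)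

sublocale B: abelian_group B
  by (rule base_change_abelian_group)

lemma coord_zero: "coord g \<zero>\<^bsub>B\<^esub> = (\<lambda>_. 0)"
  by (simp only: base_change_zero coord_cls free_zero) (simp add: lin_ext_def)

lemma coord_neg:
  assumes "V \<in> carrier B"
  shows "coord g (\<ominus>\<^bsub>B\<^esub> V) = (\<lambda>n. - coord g V n)"
proof
  fix n
  have "coord g (V \<oplus>\<^bsub>B\<^esub> \<ominus>\<^bsub>B\<^esub> V) n = 0"
    using assms by (simp only: B.r_neg coord_zero)
  then show "coord g (\<ominus>\<^bsub>B\<^esub> V) n = - coord g V n"
    using assms by (simp only: coord_add B.a_inv_closed) (simp add: eq_neg_iff_add_eq_0 add.commute)
qed

lemma coord_finsum:
  assumes "finite I" "\<And>i. i \<in> I \<Longrightarrow> V i \<in> carrier B"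
  shows "coord g (\<Oplus>\<^bsub>B\<^esub>i\<in>I. V i) = (\<lambda>n. \<Sum>i\<in>I. coord g (V i) n)"
  using assms
proof (induction I)
  case empty
  then show ?case
    by (simp only: B.finsum_empty coord_zero) simp
next
  case (insert i I)
  then have "(\<Oplus>\<^bsub>B\<^esub>i\<in>insert i I. V i) = V i \<oplus>\<^bsub>B\<^esub> (\<Oplus>\<^bsub>B\<^esub>i\<in>I. V i)"
    by (intro B.finsum_insert) auto
  moreover have "(\<Oplus>\<^bsub>B\<^esub>i\<in>I. V i) \<in> carrier B"
    using insert by (intro B.finsum_closed) auto
  ultimately show ?case
    using insert by (simp add: coord_add)
qed

text \<open>The module topology is the finest for which scaling each fixed vector \<open>V\<close>
  is continuous, so continuity of \<open>coord g\<close> is tested on the multiples \<open>t\<close>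
  of \<open>V\<close>, where it is \<open>T_mult_continuous\<close>.\<close>

lemma coord_open_subgroup:
  "open_subgroup (T_nbhds p OK) B {V \<in> carrier B. \<forall>j. coord g V j \<in> nbhd a m}" (is "open_subgroup _ _ ?H")
  unfolding open_subgroup_def
proof (intro conjI ballI)
  show "additive_subgroup ?H B"
  proof (rule additive_subgroup.intro, rule B.add.subgroupI)
    show "?H \<noteq> {}"
      using coord_zero nbhd_closed(1) B.zero_closed by fastforce
    show "\<ominus>\<^bsub>B\<^esub> V \<in> ?H" if "V \<in> ?H" for V
      using that by (simp add: coord_neg nbhd_minus)
    show "V \<oplus>\<^bsub>B\<^esub> Y \<in> ?H" if "V \<in> ?H" "Y \<in> ?H" for V Y
      using that by (simp add: coord_add nbhd_closed)
  qed auto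
  fix V
  assume V: "V \<in> carrier B"
  obtain b where b: "\<And>t. (\<forall>n. t n \<in> nbhd b m) \<Longrightarrow> \<forall>n. (t \<otimes>\<^bsub>T\<^esub> coord g V) n \<in> nbhd a m"
    using T_mult_continuous[OF coord_closed[OF V]] by metis
  show "\<exists>U\<in>T_nbhds p OK. \<forall>t\<in>U. t \<odot>\<^bsub>B\<^esub> V \<in> ?H"
  proof (intro bexI ballI)
    show "{f \<in> carrier T. \<forall>n. f n \<in> nbhd b m} \<in> T_nbhds p OK"
      unfolding T_nbhds_eq by blast
    fix t
    assume "t \<in> {f \<in> carrier T. \<forall>n. f n \<in> nbhd b m}"
    then show "t \<odot>\<^bsub>B\<^esub> V \<in> ?H"
      using V b[of t] by (simp add: coord_smult smult_B_closed)
  qed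
qed

text \<open>Neighborhoods in \<open>T\<close> treat all coefficients alike, so one \<open>n0\<close>
  serves every \<open>j\<close>; \<open>delta_of_log_sums\<close> depends on this
  uniformity.\<close>

lemma coord_sums:
  assumes sums: "module_sums (T_nbhds p OK) B k (\<lambda>n. tensor S_ring T S_to_T M (t n) (d n)) l"
    and t: "\<And>n. t n \<in> carrier T" and d: "\<And>n. d n \<in> carrier M"
  shows "\<exists>n0. \<forall>n\<ge>n0. \<forall>j. (\<Sum>i\<in>{k..n}. t i j * g (d i)) - coord g l j \<in> nbhd a m"
proof -
  let ?s = "\<lambda>n. \<Oplus>\<^bsub>B\<^esub>i\<in>{k..n}. tensor S_ring T S_to_T M (t i) (d i)"
  have l: "l \<in> carrier B"
    using sums by (simp add: module_sums_def module_tendsto_def)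
  have s: "?s n \<in> carrier B" for n
    using t d by (intro B.finsum_closed) (auto intro: tensor_closed)
  have "coord g (?s n \<ominus>\<^bsub>B\<^esub> l) j = (\<Sum>i\<in>{k..n}. t i j * g (d i)) - coord g l j" for n j
  proof -
    have "coord g (?s n \<ominus>\<^bsub>B\<^esub> l) j = coord g (?s n) j - coord g l j"
      using s l by (simp add: a_minus_def coord_add coord_neg)
    also have "coord g (?s n) j = (\<Sum>i\<in>{k..n}. t i j * g (d i))"
      using t d by (simp add: coord_finsum tensor_closed coord_tensor)
    finally show ?thesis .
  qed
  moreover have "\<exists>n0. \<forall>n\<ge>n0. ?s n \<ominus>\<^bsub>B\<^esub> l \<in> {V \<in> carrier B. \<forall>j. coord g V j \<in> nbhd a m}"
    using sums coord_open_subgroup unfolding module_sums_def module_tendsto_def by blast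
  ultimately show ?thesis
    by (simp only: mem_Collect_eq) blast
qed

lemma g_finsum:
  assumes "finite I" "\<And>i. i \<in> I \<Longrightarrow> x i \<in> carrier M"
  shows "g (\<Oplus>\<^bsub>M\<^esub>i\<in>I. x i) = (\<Sum>i\<in>I. g (x i))"
  using assms
proof (induction I)
  case empty
  have "g (\<zero>\<^bsub>M\<^esub>) = 0"
    using g_add[of "\<zero>\<^bsub>M\<^esub>" "\<zero>\<^bsub>M\<^esub>"] by simp
  then show ?case
    by simp
next
  case (insert i I)
  then have "(\<Oplus>\<^bsub>M\<^esub>i\<in>insert i I. x i) = x i \<oplus>\<^bsub>M\<^esub> (\<Oplus>\<^bsub>M\<^esub>i\<in>I. x i)"
    by (intro M.finsum_insert) auto
  moreover have "(\<Oplus>\<^bsub>M\<^esub>i\<in>I. x i) \<in> carrier M"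
    using insert by (intro M.finsum_closed) auto
  ultimately show ?case
    using insert by (simp add: g_add)
qed

lemma g_minus:
  assumes "x \<in> carrier M" "y \<in> carrier M"
  shows "g (x \<ominus>\<^bsub>M\<^esub> y) = g x - g y"
proof -
  have "x = (x \<ominus>\<^bsub>M\<^esub> y) \<oplus>\<^bsub>M\<^esub> y"
    using assms by (simp add: a_minus_def M.a_assoc M.l_neg)
  then have "g x = g (x \<ominus>\<^bsub>M\<^esub> y) + g y"
    using g_add[of "x \<ominus>\<^bsub>M\<^esub> y" y] assms by simp
  then show ?thesis
    by simp
qed

end

section \<open>Comparison of coefficients and convergence in M\<close>

context cyclotomic_base
begin

text \<open>The coefficient at \<open>k\<close> of the partial sums is constant from
  \<open>n = k\<close> on, so it equals its limit by separatedness of \<open>S\<close>.\<close>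

lemma log_coefficients:
  assumes "\<And>a m. \<exists>n0. \<forall>n\<ge>n0. \<forall>j. (\<Sum>i\<in>{0..n}. omega_log i j * b i) - f j \<in> nbhd a m"
  shows "f k = b k"
proof -
  have "b k - f k \<in> nbhd a m" for a m
  proof -
    obtain n0 where "\<forall>n\<ge>n0. \<forall>j. (\<Sum>i\<in>{0..n}. omega_log i j * b i) - f j \<in> nbhd a m"
      using assms by blast
    then have "(\<Sum>i\<in>{0..n0 + k}. omega_log i k * b i) - f k \<in> nbhd a m"
      by simp
    moreover have "(\<Sum>i\<in>{0..n0 + k}. omega_log i k * b i)
        = (\<Sum>i\<in>{0..n0 + k}. if i = k then b k else 0)"
      by (intro sum.cong) (auto simp: omega_log_def)
    ultimately show ?thesis
      by simp
  qed
  then have "b k - f k = 0"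
    by (rule nbhd_separated)
  then show ?thesis
    by simp
qed

lemma log_of_delta_sums:
  assumes "\<And>a m. \<exists>n0. \<forall>n\<ge>n0. \<forall>j. (\<Sum>i\<in>{0..n}. log_of_delta i j * b i) - f j \<in> nbhd a m"
  shows "\<exists>n0. \<forall>n\<ge>n0. (\<Sum>i\<in>{k..n}. log_of_delta i k * b i) - f k \<in> nbhd a m"
proof -
  have "(\<Sum>i\<in>{k..n}. log_of_delta i k * b i) = (\<Sum>i\<in>{0..n}. log_of_delta i k * b i)" for n
    by (intro sum.mono_neutral_left) (auto simp: log_of_delta_eq_0)
  then show ?thesis
    using assms[of a m] by fastforce
qed

text \<open>The functionals that give the coefficients on the basis \<open>omega_delta\<close> are continuous, because
  the family \<open>delta_of_log\<close> is bounded. Therefore it is enough to know their values on finite sums.\<close>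

lemma delta_of_log_sums:
  assumes "\<And>a m. \<exists>n0. \<forall>n\<ge>n0. \<forall>j. (\<Sum>i\<in>{0..n}. log_of_delta i j * b i) - f j \<in> nbhd a m"
  shows "\<exists>n0. \<forall>n\<ge>n0. (\<Sum>i\<in>{k..n}. delta_of_log i k * f i) - b k \<in> nbhd a m"
proof -
  obtain n0 where n0: "\<And>n j. n \<ge> n0 \<Longrightarrow>
      (\<Sum>i\<in>{0..n}. log_of_delta i j * b i) - f j \<in> nbhd (a + (k + m)) m"
    using assms by meson
  \<comment> \<open>\<open>N \<ge> n0\<close> controls the error, and \<open>N \<ge> k\<close> lets
    \<open>b k\<close> occur in the partial sum.\<close>
  define N where "N = n0 + k"
  define s where "s = (\<lambda>j. \<Sum>i\<in>{0..N}. log_of_delta i j * b i)"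
  have s: "s j - f j \<in> nbhd (a + (k + m)) m" for j
    unfolding s_def by (rule n0) (simp add: N_def)
  have "(\<Sum>i\<in>{k..n}. delta_of_log i k * f i) - b k \<in> nbhd a m" if "n \<ge> N" for n
  proof -
    \<comment> \<open>Only the partial sum up to \<open>N\<close> is inverted. Its rows
      \<open>h \<le> N \<le> n\<close> are supported in columns up to \<open>n\<close>, so the
      truncated matrix product is exact.\<close>
    have "(\<Sum>i\<in>{k..n}. log_of_delta h i * delta_of_log i k) = (if h = k then 1 else 0)" if "h \<le> N" for h
    proof -
      have "(\<Sum>i\<in>{k..n}. log_of_delta h i * delta_of_log i k)
          = (\<Sum>i\<le>n. log_of_delta h i * delta_of_log i k)"
        by (intro sum.mono_neutral_left) (auto simp: delta_of_log_eq_0)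
      also have "\<dots> = (\<Sum>i\<le>h. log_of_delta h i * delta_of_log i k)"
        using that \<open>n \<ge> N\<close> by (intro sum.mono_neutral_right) (auto simp: log_of_delta_eq_0)
      finally show ?thesis
        by (simp only: log_of_delta_inverse)
    qed
    then have "(\<Sum>h\<in>{0..N}. b h * (\<Sum>i\<in>{k..n}. log_of_delta h i * delta_of_log i k))
        = (\<Sum>h\<in>{0..N}. if h = k then b h else 0)"
      by (intro sum.cong) auto
    also have "\<dots> = b k"
      by (simp add: N_def)
    also have "(\<Sum>h\<in>{0..N}. b h * (\<Sum>i\<in>{k..n}. log_of_delta h i * delta_of_log i k))
        = (\<Sum>i\<in>{k..n}. delta_of_log i k * s i)"
      unfolding s_def sum_distrib_left by (subst sum.swap) (simp add: mult_ac)
    finally have "(\<Sum>i\<in>{k..n}. delta_of_log i k * f i) - b k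
        = - (\<Sum>i\<in>{k..n}. delta_of_log i k * (s i - f i))"
      by (simp add: right_diff_distrib sum_subtractf)
    also have "\<dots> \<in> nbhd a m"
      by (intro nbhd_minus nbhd_sum nbhd_mult_bounded[OF delta_of_log_bounded] s)
    finally show ?thesis .
  qed
  then show ?thesis
    by blast
qed

text \<open>For each of the finitely many \<open>e i\<close>, an open subgroup contains its
  multiples by some neighborhood of zero. Once the coordinates of the error lie in these
  neighborhoods, the error is a sum of elements of the subgroup.\<close>

lemma module_sums_coordinates:
  fixes M :: "('f fps, 'm) module" and c :: "nat \<Rightarrow> 'm \<Rightarrow> 'f fps" and e :: "nat \<Rightarrow> 'm"
  assumes M: "Module.module S_ring M"
    and functional: "\<And>i. i < r \<Longrightarrow> linear_functional p W res \<zeta> M (c i)"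
    and e: "\<And>i. i < r \<Longrightarrow> e i \<in> carrier M"
    and basis: "\<And>x. x \<in> carrier M \<Longrightarrow> x = (\<Oplus>\<^bsub>M\<^esub>i\<in>{..<r}. c i x \<odot>\<^bsub>M\<^esub> e i)"
    and x: "\<And>n. x n \<in> carrier M" and l: "l \<in> carrier M"
    and sums: "\<And>i a m. i < r \<Longrightarrow>
      \<exists>n0. \<forall>n\<ge>n0. (\<Sum>h\<in>{k..n}. s h * c i (x h)) - c i l \<in> nbhd a m"
  shows "module_sums (S_nbhds p OK) M k (\<lambda>n. s n \<odot>\<^bsub>M\<^esub> x n) l"
  unfolding module_sums_def module_tendsto_def
proof (intro conjI allI impI l)
  interpret M: Module.module S_ring M
    by (rule M)
  fix H
  assume H: "open_subgroup (S_nbhds p OK) M H"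
  interpret H: additive_subgroup H M
    using H by (simp add: open_subgroup_def)
  let ?y = "\<lambda>n. \<Oplus>\<^bsub>M\<^esub>h\<in>{k..n}. s h \<odot>\<^bsub>M\<^esub> x h"
  have y: "?y n \<in> carrier M" for n
    using x by (intro M.finsum_closed) auto
  have coordinates: "c i (?y n \<ominus>\<^bsub>M\<^esub> l) = (\<Sum>h\<in>{k..n}. s h * c i (x h)) - c i l" if "i < r" for i n
  proof -
    interpret linear_functional p W res \<zeta> M "c i"
      by (rule functional[OF that])
    show ?thesis
      using x y[of n] l by (simp add: g_minus g_finsum g_smult)
  qed
  have "\<exists>n0. \<forall>n\<ge>n0. c i (?y n \<ominus>\<^bsub>M\<^esub> l) \<odot>\<^bsub>M\<^esub> e i \<in> H" if i: "i < r" for i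
  proof -
    obtain a m where "\<forall>t\<in>nbhd a m. t \<odot>\<^bsub>M\<^esub> e i \<in> H"
      using H e[OF i] unfolding open_subgroup_def S_nbhds_eq by blast
    then show ?thesis
      using sums[OF i, of a m] unfolding coordinates[OF i] by blast
  qed
  then obtain n0 where n0: "\<And>i n. i < r \<Longrightarrow> n \<ge> n0 i \<Longrightarrow> c i (?y n \<ominus>\<^bsub>M\<^esub> l) \<odot>\<^bsub>M\<^esub> e i \<in> H"
    by metis
  have "?y n \<ominus>\<^bsub>M\<^esub> l \<in> H" if n: "n \<ge> (\<Sum>i<r. n0 i)" for n
  proof -
    have "n0 i \<le> n" if "i < r" for i
      using n that member_le_sum[of i "{..<r}" n0] by auto
    then have summand: "c i (?y n \<ominus>\<^bsub>M\<^esub> l) \<odot>\<^bsub>M\<^esub> e i \<in> H" if "i < r" for i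
      using that n0 by blast
    have "(\<Oplus>\<^bsub>M\<^esub>i\<in>I. c i (?y n \<ominus>\<^bsub>M\<^esub> l) \<odot>\<^bsub>M\<^esub> e i) \<in> H" if "finite I" "I \<subseteq> {..<r}" for I
      using that
    proof (induction I)
      case (insert i I)
      then have "(\<Oplus>\<^bsub>M\<^esub>i\<in>insert i I. c i (?y n \<ominus>\<^bsub>M\<^esub> l) \<odot>\<^bsub>M\<^esub> e i)
          = c i (?y n \<ominus>\<^bsub>M\<^esub> l) \<odot>\<^bsub>M\<^esub> e i \<oplus>\<^bsub>M\<^esub> (\<Oplus>\<^bsub>M\<^esub>i\<in>I. c i (?y n \<ominus>\<^bsub>M\<^esub> l) \<odot>\<^bsub>M\<^esub> e i)"
        using e by (intro M.finsum_insert) auto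
      then show ?case
        using insert summand by (simp add: H.a_closed)
    qed (simp add: H.zero_closed)
    then have "(\<Oplus>\<^bsub>M\<^esub>i\<in>{..<r}. c i (?y n \<ominus>\<^bsub>M\<^esub> l) \<odot>\<^bsub>M\<^esub> e i) \<in> H"
      by simp
    then show ?thesis
      using basis[of "?y n \<ominus>\<^bsub>M\<^esub> l"] y[of n] l by simp
  qed
  then show "\<exists>n0. \<forall>n\<ge>n0. ?y n \<ominus>\<^bsub>M\<^esub> l \<in> H"
    by blast
qed

end

text \<open>By \<open>tau_S\<close>, \<open>\<tau>\<close> maps \<open>S_to_T s\<close> to the image
  of \<open>s\<close> along \<open>\<iota>\<close>, and \<open>\<tau>\<close> is injective. The
  pullback along \<open>\<iota>\<close> thus becomes extension of scalars along
  \<open>S_to_T\<close>, where \<open>coord\<close> is available.\<close>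

lemma (in bdr_identification) S_to_T_along_iota:
  assumes "range S_to_T \<subseteq> carrier (T_ring p (ring_of_integers W \<zeta>))"
  shows "S_to_T_along p (ring_of_integers W \<zeta>) A \<sigma> \<tau> \<iota> = S_to_T"
proof
  fix s
  have "inj_on \<tau> (carrier (T_ring p (ring_of_integers W \<zeta>)))"
    using tau_iso by (simp add: ring_iso_def bij_betw_def)
  then show "S_to_T_along p (ring_of_integers W \<zeta>) A \<sigma> \<tau> \<iota> s = S_to_T s"
    unfolding S_to_T_along_def tau_S[symmetric] using assms by (intro the_inv_into_f_f) auto
qed

theorem proposition8p16:
  fixes p :: nat and W :: "'f::field_char_0 set" and res :: "'f \<Rightarrow> 'k::field" and \<zeta> :: 'f
    and R A :: "('u, 'f) prism" and \<rho> :: "'f fps \<Rightarrow> 'u"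
    and P :: "'v ring" and j :: "'f fps \<Rightarrow> 'v" and w :: "nat \<Rightarrow> 'v"
    and \<alpha> :: "(nat \<Rightarrow> 'v set) \<Rightarrow> 'u" and \<iota> \<theta> :: "'u \<Rightarrow> 'u"
    and \<sigma> :: "'f fps \<Rightarrow> 'u bdr" and \<tau> :: "(nat \<Rightarrow> 'f fps) \<Rightarrow> 'u bdr"
    and E :: "('u, 'f, 'm) site_presheaf" and M :: "('f fps, 'm) module"
    and dlog ddelta :: "nat \<Rightarrow> 'm \<Rightarrow> 'm"
    and OK :: "'f set" and q :: "'f fps"
  assumes base: "cyclotomic_base p W res \<zeta>"
    and OK: "OK = ring_of_integers W \<zeta>"
    and q: "q = qS \<zeta>"
    and prisms: "bdr_identification p W \<zeta> R \<rho> P j w A \<alpha> \<iota> \<theta> \<sigma> \<tau>"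
    and crystal: "de_rham_crystal p OK E"
    and M: "M = crystal_module E R \<sigma>"
    and M_free: "finite_free S_ring M"
    and base_change_iota:
      "bij_betw (pullback_to_sections p OK E R A \<tau> \<iota>)
         (carrier (pullback p OK E R A \<sigma> \<tau> \<iota>)) (carrier (crystal_module E A \<tau>))"
    and base_change_theta:
      "bij_betw (pullback_to_sections p OK E R A \<tau> \<theta>)
         (carrier (pullback p OK E R A \<sigma> \<tau> \<theta>)) (carrier (crystal_module E A \<tau>))"
    and dlog: "taylor_coefficients p OK E R A \<sigma> \<tau> \<iota> \<theta> omega_log dlog"
    and ddelta: "taylor_coefficients p OK E R A \<sigma> \<tau> \<iota> \<theta> (omega_delta p OK \<zeta>) ddelta"
  shows "\<forall>s\<in>carrier M. \<forall>k.
    module_sums (S_nbhds p OK) M k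
      (\<lambda>n. (of_nat (fact k) / qfact (q ^ p) n * qstirling1 (q ^ p) n k
             * (q - 1) ^ (n - k) * q ^ (n - k)) \<odot>\<^bsub>M\<^esub> ddelta n s)
      (dlog k s) \<and>
    module_sums (S_nbhds p OK) M k
      (\<lambda>n. (qfact (q ^ p) k / of_nat (fact n) * qstirling2 (q ^ p) n k
             * (q - 1) ^ (n - k) * q ^ (n - k)) \<odot>\<^bsub>M\<^esub> dlog n s)
      (ddelta k s)"
proof (intro ballI allI)
  interpret cyclotomic_base p W res \<zeta>
    by (rule base)
  interpret bdr_identification p W \<zeta> R \<rho> P j w A \<alpha> \<iota> \<theta> \<sigma> \<tau>
    by (rule prisms)
  interpret M: Module.module S_ring M
    using M_free by (simp add: finite_free_def)
  obtain r e where e: "is_basis S_ring M r e"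
    using M_free by (auto simp: finite_free_def)
  obtain c where c: "\<forall>x\<in>carrier M. x = (\<Oplus>\<^bsub>M\<^esub>i\<in>{..<r}. c i x \<odot>\<^bsub>M\<^esub> e i)"
    "\<forall>i<r. \<forall>x\<in>carrier M. \<forall>y\<in>carrier M. c i (x \<oplus>\<^bsub>M\<^esub> y) = c i x \<oplus>\<^bsub>S_ring\<^esub> c i y"
    "\<forall>i<r. \<forall>a\<in>carrier S_ring. \<forall>x\<in>carrier M. c i (a \<odot>\<^bsub>M\<^esub> x) = a \<otimes>\<^bsub>S_ring\<^esub> c i x"
    using M.basis_coordinates[OF e] by blast
  \<comment> \<open>Through these functionals convergence is tested both in M and in its
    pullback.\<close>
  have functional: "linear_functional p W res \<zeta> M (c i)" if "i < r" for i
    by unfold_locales (simp_all add: c that)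
  have along: "S_to_T_along p (ring_of_integers W \<zeta>) A \<sigma> \<tau> \<iota> = S_to_T"
    by (rule S_to_T_along_iota) (auto intro: S_to_T_carrier)
  note pullback_simps = pullback_def pullback_tensor_def OK along M[symmetric]
  fix s k
  assume s: "s \<in> carrier M"
  \<comment> \<open>Both Taylor expansions have this element as their sum; its coordinates link the
    two families of derivatives.\<close>
  let ?l = "taylor_map p OK E R A \<sigma> \<tau> \<iota> \<theta> s"
  have closed: "dlog n s \<in> carrier M" "ddelta n s \<in> carrier M" for n
    using dlog ddelta s by (auto simp: taylor_coefficients_def M)
  have log: "\<exists>n0. \<forall>n\<ge>n0. \<forall>j. (\<Sum>h\<in>{0..n}. omega_log h j * c i (dlog h s)) - coord (c i) ?l j \<in> nbhd a m"
    and delta: "\<exists>n0. \<forall>n\<ge>n0. \<forall>j. (\<Sum>h\<in>{0..n}. log_of_delta h j * c i (ddelta h s)) - coord (c i) ?l j \<in> nbhd a m"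
    if "i < r" for i a m
  proof -
    interpret linear_functional p W res \<zeta> M "c i"
      by (rule functional[OF that])
    show "\<exists>n0. \<forall>n\<ge>n0. \<forall>j. (\<Sum>h\<in>{0..n}. omega_log h j * c i (dlog h s)) - coord (c i) ?l j \<in> nbhd a m"
      using dlog s unfolding taylor_coefficients_def pullback_simps
      by (intro coord_sums omega_log_carrier closed) blast
    show "\<exists>n0. \<forall>n\<ge>n0. \<forall>j. (\<Sum>h\<in>{0..n}. log_of_delta h j * c i (ddelta h s)) - coord (c i) ?l j \<in> nbhd a m"
      using ddelta s unfolding taylor_coefficients_def pullback_simps omega_delta_eq[symmetric]
      by (intro coord_sums omega_delta_carrier closed) blast
  qed
  \<comment> \<open>The logarithmic expansion identifies the coefficients of \<open>?l\<close> with
    the coordinates of the log-derivatives, so the sequence in \<open>log_of_delta_sums\<close> and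
    \<open>delta_of_log_sums\<close> can be replaced by these.\<close>
  have f: "coord (c i) ?l n = c i (dlog n s)" if "i < r" for i n
    using log[OF that] by (rule log_coefficients)
    have "e i \<in> carrier M" if "i < r" for i
    using e that by (simp add: is_basis_def)
  note sums = module_sums_coordinates[OF M.module_axioms functional this bspec[OF c(1)], folded OK]
  have "module_sums (S_nbhds p OK) M k (\<lambda>n. log_of_delta n k \<odot>\<^bsub>M\<^esub> ddelta n s) (dlog k s)"
    by (rule sums) (use closed log_of_delta_sums[OF delta] f in auto)
  moreover have "module_sums (S_nbhds p OK) M k (\<lambda>n. delta_of_log n k \<odot>\<^bsub>M\<^esub> dlog n s) (ddelta k s)"
    by (rule sums) (use closed delta_of_log_sums[OF delta] f in auto)
  ultimately show "module_sums (S_nbhds p OK) M k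
      (\<lambda>n. (of_nat (fact k) / qfact (q ^ p) n * qstirling1 (q ^ p) n k
             * (q - 1) ^ (n - k) * q ^ (n - k)) \<odot>\<^bsub>M\<^esub> ddelta n s)
      (dlog k s) \<and>
    module_sums (S_nbhds p OK) M k
      (\<lambda>n. (qfact (q ^ p) k / of_nat (fact n) * qstirling2 (q ^ p) n k
             * (q - 1) ^ (n - k) * q ^ (n - k)) \<odot>\<^bsub>M\<^esub> dlog n s)
      (ddelta k s)"
    unfolding log_of_delta_def delta_of_log_def q ..
qed

end
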